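(* Let $W\subseteq\mathbb{C}^n$ be open, $\zeta_0\in W$, and let $L_1,\ldots,L_m$ be complex vector fields on $W$ of the form $L_j=\sum_{k=1}^n b_j^k\frac{\partial}{\partial\overline{z}_k}$ with $b_j^k\in C^\infty(W)$, such that $\mathrm{span}_{\mathbb{C}}\{L_1(\zeta),\ldots,L_m(\zeta)\}=\mathrm{span}_{\mathbb{C}}\{\frac{\partial}{\partial\overline{z}_1},\ldots,\frac{\partial}{\partial\overline{z}_n}\}$ for all $\zeta\in W$. Let $d_1,\ldots,d_m\in[1,\infty)$. Suppose there is $\xi>0$ and, for every $\delta\in(0,1]$, an open neighborhood $W'_\delta\subseteq W$ of $\zeta_0$ with $$B_{\delta^{d_1}L_1,\ldots,\delta^{d_m}L_m}(\zeta_0,\xi)\subseteq W_\delta',$$ and functions $c_{j,k}^{1,l,\delta},c_{j,k}^{2,l,\delta},c_{j,k}^{3,l,\delta}:W_\delta'\to\mathbb{C}$ such that on $W'_\delta$ $$[\delta^{d_j}L_j,\delta^{d_k}L_k]=\sum_{l=1}^m c_{j,k}^{1,l,\delta}\delta^{d_l}L_l,\qquad [\delta^{d_j}L_j,\delta^{d_k}\overline{L_k}]=\sum_{l=1}^m c_{j,k}^{2,l,\delta}\delta^{d_l}L_l+\sum_{l=1}^m c_{j,k}^{3,l,\delta}\delta^{d_l}\overline{L_l},$$ and such that for every sequence $V_1^\delta,\ldots,V_K^\delta\in\{\delta^{d_1}L_1,\ldots,\delta^{d_m}L_m,\delta^{d_1}\overline{L_1},\ldots,\delta^{d_m}\overline{L_m}\}$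 of any length $K\in\mathbb{N}$, $$\sup_{\delta\in(0,1]}\|V_1^\delta\cdots V_K^\delta c_{j,k}^{p,l,\delta}\|_{C(W_\delta')}<\infty,\qquad 1\le p\le 3,\ 1\le j,k,l\le m.$$ Then for each $\delta\in(0,1]$ there exists a biholomorphism $\Phi_\delta:B_{\mathbb{C}^n}(1)\to W_\delta$ with $\Phi_\delta(0)=\zeta_0$, where $W_\delta\subseteq W$ is an open neighborhood of $\zeta_0$, such that $$\max_{1\le j\le m}\sup_{\delta\in(0,1]}\|\Phi_\delta^*\delta^{d_j}L_j\|_{C^k(B_{\mathbb{C}^n}(1);\mathbb{C}^n)}<\infty\quad\forall k\in\mathbb{N},$$ and $$\inf_{\delta\in(0,1]}\ \max_{j_1,\ldots,j_n\in\{1,\ldots,m\}}\ \inf_{z\in B_{\mathbb{C}^n}(1)}\left|\det\left(\Phi_\delta^*\delta^{d_{j_1}}L_{j_1}(z)\,|\cdots|\,\Phi_\delta^*\delta^{d_{j_n}}L_{j_n}(z)\right)\right|>0,$$ where the columns of the $n\times n$ matrix are the coefficients of the vector fields with respect to $\frac{\partial}{\partial\overline{z}_1},\ldots,\frac{\partial}{\partial\overline{z}_n}$.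
   Context: $\mathbb{N}=\{0,1,\ldots\}$; $B_{\mathbb{C}^n}(1)$ is the open unit ball centered at $0$. $\|f\|_{C(U)}=\sup_U|f|$, for $f$ continuous; $\|f\|_{C^k(U)}=\sum_{|\alpha|\le k}\|\partial^\alpha f\|_{C(U)}$ with derivatives in the underlying real coordinates. A vector field in the span of $\frac{\partial}{\partial\overline{z}_1},\ldots,\frac{\partial}{\partial\overline{z}_n}$ is identified with its coefficient function with values in $\mathbb{C}^n$. Ball: for complex vector fields $V_1,\ldots,V_m$, let $W_1,\ldots,W_{2m}$ be the real vector fields $2\mathrm{Re}(V_1),\ldots,2\mathrm{Re}(V_m),2\mathrm{Im}(V_1),\ldots,2\mathrm{Im}(V_m)$. Then $B_{V_1,\ldots,V_m}(x,\xi)$ is the set of points $\gamma(1)$ where $\gamma:[0,1]\to W$ is absolutely continuous with $\gamma(0)=x$ and $\gamma'(t)=\sum_j a_j(t)\,\xi\,W_j(\gamma(t))$ for a.e. $t$, for some $a_j\in L^\infty([0,1])$ with $\big\|\sum_j|a_j|^2\big\|_{L^\infty}<1$. *)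

theory Defs
  imports "HOL-Analysis.Analysis" "HOL-Library.Multiset" "HOL-Probability.Essential_Supremum"
begin

section \<open>Real partial derivatives and norms\<close>

definition partial_deriv ::
    "'a::euclidean_space \<Rightarrow> ('a \<Rightarrow> 'b::real_normed_vector) \<Rightarrow> 'a \<Rightarrow> 'b" where
  "partial_deriv e f x = frechet_derivative f (at x) e"

text \<open>Meant for open \<open>U\<close> only.\<close>

primrec Ck_on ::
    "nat \<Rightarrow> 'a::euclidean_space set \<Rightarrow> ('a \<Rightarrow> 'b::real_normed_vector) \<Rightarrow> bool" where
  "Ck_on 0 U f \<longleftrightarrow> continuous_on U f"
| "Ck_on (Suc k) U f \<longleftrightarrow>
     f differentiable_on U \<and> (\<forall>e\<in>Basis. Ck_on k U (partial_deriv e f))"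

definition smooth_on ::
    "'a::euclidean_space set \<Rightarrow> ('a \<Rightarrow> 'b::real_normed_vector) \<Rightarrow> bool" where
  "smooth_on U f \<longleftrightarrow> (\<forall>k. Ck_on k U f)"

text \<open>A multi-index is a multiset of coordinate directions; its order is its size. For functions
  of class \<open>C^k\<close> and multi-indices of order at most \<open>k\<close>, the order in which the
  derivatives are taken (the choice of the list) is irrelevant.\<close>

definition multi_deriv ::
    "'a::euclidean_space multiset \<Rightarrow> ('a \<Rightarrow> 'b::real_normed_vector) \<Rightarrow> 'a \<Rightarrow> 'b" where
  "multi_deriv \<alpha> f = foldr partial_deriv (SOME es. mset es = \<alpha>) f"

definition C_norm :: "'a set \<Rightarrow> ('a \<Rightarrow> 'b::real_normed_vector) \<Rightarrow> ennreal" where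
  "C_norm U f = (SUP x\<in>U. ennreal (norm (f x)))"

text \<open>The norm is \<open>\<infinity>\<close> for functions that are not of class \<open>C^k\<close>.\<close>

definition Ck_norm ::
    "nat \<Rightarrow> 'a::euclidean_space set \<Rightarrow> ('a \<Rightarrow> 'b::real_normed_vector) \<Rightarrow> ennreal" where
  "Ck_norm k U f =
     (if Ck_on k U f
      then \<Sum>\<alpha> | set_mset \<alpha> \<subseteq> Basis \<and> size \<alpha> \<le> k. C_norm U (multi_deriv \<alpha> f)
      else \<infinity>)"

section \<open>Complex vector fields\<close>

text \<open>The complexified tangent space of \<open>\<complex>\<^sup>n = \<real>\<^sup>2\<^sup>n\<close> at a point has the complex basis
  \<open>\<partial>/\<partial>z\<^sub>k\<close>, \<open>\<partial>/\<partial>z\<^sub>k-bar\<close>. A tangent vector is the vector of its coefficients: the component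
  \<open>Inl k\<close> belongs to \<open>\<partial>/\<partial>z\<^sub>k\<close> and the component \<open>Inr k\<close> to \<open>\<partial>/\<partial>z\<^sub>k-bar\<close>.\<close>

type_synonym 'n cvf = "complex ^ 'n \<Rightarrow> complex ^ ('n + 'n)"

definition dzbar :: "'n::finite \<Rightarrow> complex ^ ('n + 'n)" where
  "dzbar k = axis (Inr k) 1"

definition zbar_coeffs :: "complex ^ ('n + 'n) \<Rightarrow> complex ^ 'n::finite" where
  "zbar_coeffs X = (\<chi> k. X $ Inr k)"

definition wirtinger :: "'n::finite \<Rightarrow> (complex ^ 'n \<Rightarrow> complex) \<Rightarrow> complex ^ 'n \<Rightarrow> complex" where
  "wirtinger k f z =
     (partial_deriv (axis k 1) f z - \<i> * partial_deriv (axis k \<i>) f z) / 2"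

definition wirtinger_bar ::
    "'n::finite \<Rightarrow> (complex ^ 'n \<Rightarrow> complex) \<Rightarrow> complex ^ 'n \<Rightarrow> complex" where
  "wirtinger_bar k f z =
     (partial_deriv (axis k 1) f z + \<i> * partial_deriv (axis k \<i>) f z) / 2"

definition tangent_apply ::
    "complex ^ ('n::finite + 'n) \<Rightarrow> (complex ^ 'n \<Rightarrow> complex) \<Rightarrow> complex ^ 'n \<Rightarrow> complex" where
  "tangent_apply X f z =
     (\<Sum>k\<in>UNIV. X $ Inl k * wirtinger k f z + X $ Inr k * wirtinger_bar k f z)"

definition vf_apply ::
    "'n::finite cvf \<Rightarrow> (complex ^ 'n \<Rightarrow> complex) \<Rightarrow> complex ^ 'n \<Rightarrow> complex" where
  "vf_apply V f z = tangent_apply (V z) f z"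

definition lie_bracket :: "'n::finite cvf \<Rightarrow> 'n cvf \<Rightarrow> 'n cvf" where
  "lie_bracket V U z =
     (\<chi> i. vf_apply V (\<lambda>w. U w $ i) z - vf_apply U (\<lambda>w. V w $ i) z)"

definition cnj_vf :: "'n::finite cvf \<Rightarrow> 'n cvf" where
  "cnj_vf V z = (\<chi> i. case i of Inl k \<Rightarrow> cnj (V z $ Inr k) | Inr k \<Rightarrow> cnj (V z $ Inl k))"

text \<open>A real tangent vector is an element \<open>w\<close> of \<open>\<complex>\<^sup>n = \<real>\<^sup>2\<^sup>n\<close>; in the above basis it has the
  coefficients \<open>w\<^sub>k\<close> at \<open>\<partial>/\<partial>z\<^sub>k\<close> and \<open>cnj w\<^sub>k\<close> at \<open>\<partial>/\<partial>z\<^sub>k-bar\<close>. Hence the real part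
  \<open>(V + cnj V) / 2\<close> and the imaginary part \<open>(V - cnj V) / (2 \<i>)\<close> are determined by their
  coefficients at \<open>\<partial>/\<partial>z\<^sub>k\<close>.\<close>

definition Re_vf :: "'n::finite cvf \<Rightarrow> complex ^ 'n \<Rightarrow> complex ^ 'n" where
  "Re_vf V z = (\<chi> k. (V z $ Inl k + cnj_vf V z $ Inl k) / 2)"

definition Im_vf :: "'n::finite cvf \<Rightarrow> complex ^ 'n \<Rightarrow> complex ^ 'n" where
  "Im_vf V z = (\<chi> k. (V z $ Inl k - cnj_vf V z $ Inl k) / (2 * \<i>))"

definition scaled_vf ::
    "('m \<Rightarrow> real) \<Rightarrow> real \<Rightarrow> ('m \<Rightarrow> 'n::finite cvf) \<Rightarrow> 'm \<Rightarrow> 'n cvf" where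
  "scaled_vf d \<delta> L j z = complex_of_real (\<delta> powr d j) *s L j z"

text \<open>The family \<open>V\<^sub>1, \<dots>, V\<^sub>m, cnj V\<^sub>1, \<dots>, cnj V\<^sub>m\<close>.\<close>

definition with_cnj :: "('m \<Rightarrow> 'n::finite cvf) \<Rightarrow> 'm + 'm \<Rightarrow> 'n cvf" where
  "with_cnj V s = (case s of Inl j \<Rightarrow> V j | Inr j \<Rightarrow> cnj_vf (V j))"

text \<open>For \<open>s = [s\<^sub>1, \<dots>, s\<^sub>K]\<close> this is \<open>X\<^sub>s\<^sub>1 (\<dots> (X\<^sub>s\<^sub>K f) \<dots>)\<close>.\<close>

definition iter_apply ::
    "('s \<Rightarrow> 'n::finite cvf) \<Rightarrow> 's list \<Rightarrow> (complex ^ 'n \<Rightarrow> complex) \<Rightarrow> complex ^ 'n \<Rightarrow> complex"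
  where "iter_apply X s f = foldr (\<lambda>i. vf_apply (X i)) s f"

section \<open>Balls defined by vector fields\<close>

definition abs_continuous_on_01 :: "(real \<Rightarrow> 'a::real_normed_vector) \<Rightarrow> bool" where
  "abs_continuous_on_01 \<gamma> \<longleftrightarrow>
     (\<forall>\<epsilon>>0. \<exists>\<eta>>0. \<forall>D. D division_of \<Union>D \<and> \<Union>D \<subseteq> {0..1} \<and> (\<Sum>I\<in>D. Sup I - Inf I) < \<eta>
        \<longrightarrow> (\<Sum>I\<in>D. norm (\<gamma> (Sup I) - \<gamma> (Inf I))) < \<epsilon>)"

definition real_fields ::
    "('m \<Rightarrow> 'n::finite cvf) \<Rightarrow> 'm + 'm \<Rightarrow> complex ^ 'n \<Rightarrow> complex ^ 'n" where
  "real_fields V s z =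
     (case s of Inl j \<Rightarrow> 2 *\<^sub>R Re_vf (V j) z | Inr j \<Rightarrow> 2 *\<^sub>R Im_vf (V j) z)"

text \<open>Measurability and the bound on the essential supremum imply that every \<open>a j\<close> is in
  \<open>L\<^sup>\<infinity>([0,1])\<close>.\<close>

definition cc_ball ::
    "(complex ^ 'n) set \<Rightarrow> ('m::finite \<Rightarrow> 'n::finite cvf) \<Rightarrow> complex ^ 'n \<Rightarrow> real \<Rightarrow> (complex ^ 'n) set"
  where
  "cc_ball W V x \<xi> =
     {\<gamma> 1 | \<gamma>. \<gamma> ` {0..1} \<subseteq> W \<and> abs_continuous_on_01 \<gamma> \<and> \<gamma> 0 = x \<and>
        (\<exists>a :: 'm + 'm \<Rightarrow> real \<Rightarrow> real.
           (\<forall>j. a j \<in> borel_measurable (lebesgue_on {0..1})) \<and>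
           esssup (lebesgue_on {0..1}) (\<lambda>t. ereal (\<Sum>j\<in>UNIV. \<bar>a j t\<bar>\<^sup>2)) < 1 \<and>
           (AE t in lebesgue_on {0..1}.
              (\<gamma> has_vector_derivative (\<Sum>j\<in>UNIV. (a j t * \<xi>) *\<^sub>R real_fields V j (\<gamma> t)))
                (at t within {0..1})))}"

section \<open>Biholomorphisms and pullbacks\<close>

text \<open>Complex differentiability; \<open>A\<close> is the complex Jacobian matrix.\<close>

definition holomorphic_map_on ::
    "(complex ^ 'n) set \<Rightarrow> (complex ^ 'n \<Rightarrow> complex ^ 'k) \<Rightarrow> bool" where
  "holomorphic_map_on U F \<longleftrightarrow>
     (\<forall>z\<in>U. \<exists>A :: complex ^ 'n ^ 'k. (F has_derivative (\<lambda>v. A *v v)) (at z))"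

definition biholomorphism ::
    "(complex ^ 'n \<Rightarrow> complex ^ 'n) \<Rightarrow> (complex ^ 'n) set \<Rightarrow> (complex ^ 'n) set \<Rightarrow> bool" where
  "biholomorphism \<Phi> U V \<longleftrightarrow>
     open U \<and> open V \<and> bij_betw \<Phi> U V \<and>
     holomorphic_map_on U \<Phi> \<and> holomorphic_map_on V (the_inv_into U \<Phi>)"

text \<open>The complexification of the real differential: \<open>d\<Phi>(z) X\<close> acts on the coordinate
  functions \<open>z\<^sub>k\<close> and \<open>cnj z\<^sub>k\<close> as \<open>X\<close> acts on \<open>\<Phi>\<^sub>k\<close> and \<open>cnj \<Phi>\<^sub>k\<close>.\<close>

definition pushforward ::
    "(complex ^ 'n \<Rightarrow> complex ^ 'n) \<Rightarrow> complex ^ 'n \<Rightarrow>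
       complex ^ ('n::finite + 'n) \<Rightarrow> complex ^ ('n + 'n)" where
  "pushforward \<Phi> z X =
     (\<chi> i. case i of
        Inl k \<Rightarrow> tangent_apply X (\<lambda>w. \<Phi> w $ k) z
      | Inr k \<Rightarrow> tangent_apply X (\<lambda>w. cnj (\<Phi> w $ k)) z)"

definition pullback :: "(complex ^ 'n \<Rightarrow> complex ^ 'n) \<Rightarrow> 'n::finite cvf \<Rightarrow> 'n cvf" where
  "pullback \<Phi> V z = (THE X. pushforward \<Phi> z X = V (\<Phi> z))"

end

theory Submission
  imports Defs
begin

text \<open>
  The fields \<open>\<delta>\<^sup>d L\<close> are fixed smooth fields multiplied by powers of \<open>\<delta>\<close>, and a number \<open>c\<close> for which
  \<open>\<delta> powr (- s) * c\<close> stays bounded as \<open>\<delta>\<close> tends to \<open>0\<close> vanishes as soon as \<open>s > 0\<close>. Hence bounds at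
  \<open>\<zeta>0\<close> that are uniform in \<open>\<delta>\<close> are the same as the vanishing of certain derivatives at \<open>\<zeta>0\<close>: a smooth
  function has weighted order at least \<open>s\<close> if \<open>X\<^sub>1 \<dots> X\<^sub>K f\<close> vanishes at \<open>\<zeta>0\<close> for all choices of fields
  \<open>X\<^sub>i\<close> among the \<open>L\<^sub>j\<close> and their conjugates with total weight less than \<open>s\<close>. Orders add up under
  multiplication, and \<open>L\<^sub>j\<close> lowers them by at most \<open>d\<^sub>j\<close>. The analytic problem thereby turns into an
  algebraic one at a single point. It has one solution for all \<open>\<delta>\<close>: there are holomorphic
  coordinates \<open>w\<^sub>1, \<dots>, w\<^sub>n\<close> around \<open>\<zeta>0\<close> and weights \<open>e\<^sub>1, \<dots>, e\<^sub>n\<close> such that \<open>w\<^sub>k\<close> has order \<open>e\<^sub>k\<close>, and the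
  charts are the dilations \<open>\<Phi>\<^sub>\<delta> z = w\<^sup>-\<^sup>1 (\<epsilon> \<delta> powr e\<^sub>1 * z\<^sub>1, \<dots>, \<epsilon> \<delta> powr e\<^sub>n * z\<^sub>n)\<close>.

  The weights come from a basis of smallest total weight among the values of the fields at \<open>\<zeta>0\<close>
  (\<open>exists_minimal_frame\<close>). The members of this basis form a frame near \<open>\<zeta>0\<close>, and the coefficients of
  all other fields in the frame satisfy differential equations that are quadratic in them and
  linear in the bracket coefficients (\<open>\<alpha>_derivative\<close>). This transfers the uniform bounds to the
  frame (\<open>bdd_\<alpha>\<close>): the structure functions of the frame have the order that makes commutation
  compatible with the weights.

  The coordinate \<open>w\<^sub>k\<close> is obtained from a linear function by successive polynomial corrections
  (\<open>exists_graded\<close>). If all words of length at most \<open>r\<close> and weight less than \<open>e\<^sub>k\<close> annihilate a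
  holomorphic function at \<open>\<zeta>0\<close>, then its derivatives by words of length \<open>r + 1\<close> and weight less than
  \<open>e\<^sub>k\<close> are symmetric in the letters, since a commutator produces shorter words only. An antiholomorphic letter can thus
  be moved to the place where it acts first and gives zero. What remains is a symmetric tensor in
  the holomorphic letters, that is, a homogeneous holomorphic polynomial, which can be subtracted.

  In the coordinates \<open>w\<close> the derivative \<open>\<partial>/\<partial>w\<^sub>k\<close> lowers orders by at most \<open>e\<^sub>k\<close>, so by the mean value
  inequality a function of order \<open>s\<close> is \<open>O(\<delta> powr s)\<close> on the image of \<open>\<Phi>\<^sub>\<delta>\<close>
  (\<open>ord_ge_uniform_bound\<close>). The \<open>k\<close>-th coefficient of the pullback of \<open>\<delta> powr d\<^sub>j * L\<^sub>j\<close> is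
  \<open>\<delta> powr (d\<^sub>j - e\<^sub>k) / \<epsilon>\<close> times the value of \<open>L\<^sub>j (cnj w\<^sub>k)\<close> (\<open>pullback_coeffs\<close>), a function of order
  \<open>e\<^sub>k - d\<^sub>j\<close>; this gives all bounds. For the frame itself the powers of \<open>\<delta>\<close> cancel in the determinant.
\<close>

section \<open>Complex tangent vectors as derivations\<close>

text \<open>The action of a complex tangent vector on a function with real differential \<open>f'\<close>. Formulas for
  \<open>tangent_apply\<close> follow from those for real differentials.\<close>

definition complexify_apply :: "complex ^ ('n::finite + 'n) \<Rightarrow> (complex ^ 'n \<Rightarrow> complex) \<Rightarrow> complex" where
  "complexify_apply X f' =
     (\<Sum>k\<in>UNIV. X $ Inl k * ((f' (axis k 1) - \<i> * f' (axis k \<i>)) / 2)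
              + X $ Inr k * ((f' (axis k 1) + \<i> * f' (axis k \<i>)) / 2))"

lemma partial_deriv_eq:
  "(f has_derivative f') (at z) \<Longrightarrow> partial_deriv v f z = f' v"
  by (simp add: partial_deriv_def frechet_derivative_at[symmetric])

lemma tangent_apply_eq:
  "(f has_derivative f') (at z) \<Longrightarrow> tangent_apply X f z = complexify_apply X f'"
  by (simp add: tangent_apply_def complexify_apply_def wirtinger_def wirtinger_bar_def partial_deriv_eq)

lemma tangent_apply_cong_open:
  assumes "f differentiable (at z)" "open U" "z \<in> U" "\<And>w. w \<in> U \<Longrightarrow> f w = g w"
  shows "tangent_apply X f z = tangent_apply X g z"
proof -
  have "frechet_derivative f (at z) = frechet_derivative g (at z)"
    using frechet_derivative_transform_within_open[OF assms] .
  then show ?thesis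
    by (simp add: tangent_apply_def wirtinger_def wirtinger_bar_def partial_deriv_def)
qed

lemma tangent_apply_const [simp]: "tangent_apply X (\<lambda>w. c) z = 0"
  by (simp add: tangent_apply_def wirtinger_def wirtinger_bar_def partial_deriv_def)

lemma tangent_apply_add:
  assumes "f differentiable (at z)" "g differentiable (at z)"
  shows "tangent_apply X (\<lambda>w. f w + g w) z = tangent_apply X f z + tangent_apply X g z"
proof -
  obtain f' g' where *: "(f has_derivative f') (at z)" "(g has_derivative g') (at z)"
    using assms by (auto simp: differentiable_def)
  show ?thesis
    unfolding tangent_apply_eq[OF *(1)] tangent_apply_eq[OF *(2)] tangent_apply_eq[OF has_derivative_add[OF *]]
    by (simp add: complexify_apply_def sum.distrib[symmetric] algebra_simps add_divide_distrib diff_divide_distrib)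
qed

lemma tangent_apply_mult:
  assumes "f differentiable (at z)" "g differentiable (at z)"
  shows "tangent_apply X (\<lambda>w. f w * g w) z = tangent_apply X f z * g z + f z * tangent_apply X g z"
proof -
  obtain f' g' where *: "(f has_derivative f') (at z)" "(g has_derivative g') (at z)"
    using assms by (auto simp: differentiable_def)
  show ?thesis
    unfolding tangent_apply_eq[OF *(1)] tangent_apply_eq[OF *(2)] tangent_apply_eq[OF has_derivative_mult[OF *]]
    by (simp add: complexify_apply_def sum.distrib[symmetric] sum_distrib_left sum_distrib_right algebra_simps add_divide_distrib diff_divide_distrib)
qed

lemma tangent_apply_cmult:
  assumes "f differentiable (at z)"
  shows "tangent_apply X (\<lambda>w. c * f w) z = c * tangent_apply X f z"
  using tangent_apply_mult[of "\<lambda>_. c" z f X] assms by simp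

lemma tangent_apply_sum:
  assumes "finite S" "\<And>i. i \<in> S \<Longrightarrow> f i differentiable (at z)"
  shows "tangent_apply X (\<lambda>w. \<Sum>i\<in>S. f i w) z = (\<Sum>i\<in>S. tangent_apply X (f i) z)"
  using assms
proof (induction S rule: finite_induct)
  case (insert x F)
  then show ?case
    by (simp add: tangent_apply_add[of "f x" z "\<lambda>w. \<Sum>i\<in>F. f i w"] differentiable_sum)
qed simp

definition cnj_tangent :: "complex ^ ('n + 'n) \<Rightarrow> complex ^ ('n::finite + 'n)" where
  "cnj_tangent X = (\<chi> i. cnj (X $ (case i of Inl k \<Rightarrow> Inr k | Inr k \<Rightarrow> Inl k)))"

lemma cnj_vf_eq: "cnj_vf V z = cnj_tangent (V z)"
  by (auto simp: cnj_vf_def cnj_tangent_def vec_eq_iff split: sum.splits)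

lemma cnj_tangent_nth [simp]: "cnj_tangent X $ Inl k = cnj (X $ Inr k)" "cnj_tangent X $ Inr k = cnj (X $ Inl k)"
  by (simp_all add: cnj_tangent_def)

lemma cnj_tangent_simps [simp]:
  "cnj_tangent (cnj_tangent X) = X"
  "cnj_tangent (c *s X) = cnj c *s cnj_tangent X"
  "cnj_tangent (X + Y) = cnj_tangent X + cnj_tangent Y"
  "cnj_tangent 0 = 0"
  by (auto simp: cnj_tangent_def vec_eq_iff split: sum.splits)

lemma cnj_tangent_sum: "cnj_tangent (sum f S) = (\<Sum>i\<in>S. cnj_tangent (f i))"
  by (induction S rule: infinite_finite_induct) auto

lemma differentiable_cnj:
  "f differentiable (at z within S) \<Longrightarrow> (\<lambda>w. cnj (f w)) differentiable (at z within S)"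
  unfolding differentiable_def using has_derivative_cnj by blast

lemma tangent_apply_cnj:
  assumes "f differentiable (at z)"
  shows "tangent_apply X (\<lambda>w. cnj (f w)) z = cnj (tangent_apply (cnj_tangent X) f z)"
proof -
  obtain f' where *: "(f has_derivative f') (at z)"
    using assms by (auto simp: differentiable_def)
  show ?thesis
    unfolding tangent_apply_eq[OF *(1)] tangent_apply_eq[OF has_derivative_cnj[OF *]]
    by (simp add: complexify_apply_def add.commute)
qed

lemma tangent_apply_add_left: "tangent_apply (X + Y) f z = tangent_apply X f z + tangent_apply Y f z"
  by (simp add: tangent_apply_def sum.distrib[symmetric] algebra_simps)

lemma tangent_apply_scale_left: "tangent_apply (c *s X) f z = c * tangent_apply X f z"
  by (simp add: tangent_apply_def sum_distrib_left algebra_simps)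

lemma tangent_apply_0_left [simp]: "tangent_apply 0 f z = 0"
  by (simp add: tangent_apply_def)

lemma tangent_apply_sum_left: "tangent_apply (\<Sum>i\<in>S. Y i) f z = (\<Sum>i\<in>S. tangent_apply (Y i) f z)"
  by (induction S rule: infinite_finite_induct) (auto simp: tangent_apply_add_left)

text \<open>A real vector \<open>v\<close> as a complex tangent vector; it acts on functions as the directional derivative
  along \<open>v\<close> (\<open>has_derivative_tangent\<close>).\<close>

definition real_tangent :: "complex ^ 'n \<Rightarrow> complex ^ ('n::finite + 'n)" where
  "real_tangent v = (\<chi> i. case i of Inl k \<Rightarrow> v $ k | Inr k \<Rightarrow> cnj (v $ k))"

lemma real_tangent_nth [simp]: "real_tangent v $ Inl k = v $ k" "real_tangent v $ Inr k = cnj (v $ k)"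
  by (simp_all add: real_tangent_def)

lemma cnj_real_tangent [simp]: "cnj_tangent (real_tangent v) = real_tangent v"
  by (auto simp: cnj_tangent_def vec_eq_iff real_tangent_def split: sum.splits)

lemma complex_vec_expand: "(v :: complex ^ 'n::finite) = (\<Sum>k\<in>UNIV. Re (v $ k) *\<^sub>R axis k 1 + Im (v $ k) *\<^sub>R axis k \<i>)"
  by (simp add: vec_eq_iff axis_def if_distrib sum.distrib cong: if_cong)
     (simp add: complex_eq_iff)

lemma complexify_apply_real_tangent:
  assumes "linear f'"
  shows "complexify_apply (real_tangent v) f' = f' v"
proof -
  interpret linear f' by fact
  have "f' v = (\<Sum>k\<in>UNIV. Re (v $ k) *\<^sub>R f' (axis k 1) + Im (v $ k) *\<^sub>R f' (axis k \<i>))"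
    by (subst complex_vec_expand[of v]) (simp add: sum add scale)
  also have "\<dots> = complexify_apply (real_tangent v) f'"
    unfolding complexify_apply_def
    by (rule sum.cong) (auto simp: complex_eq_iff algebra_simps add_divide_distrib diff_divide_distrib)
  finally show ?thesis by simp
qed

lemma axis_nth_if: "axis k c $ i = (if i = k then c else 0)"
  by (simp add: axis_def)

lemma partial_deriv_conv_tangent_apply:
  "partial_deriv (axis k 1) f z = tangent_apply (real_tangent (axis k 1)) f z"
  "partial_deriv (axis k \<i>) f z = tangent_apply (real_tangent (axis k \<i>)) f z"
  unfolding tangent_apply_def
  by (simp_all add: axis_nth_if if_distrib[of cnj] if_distrib[of "\<lambda>x. x * _"] sum.distrib cong: if_cong)
     (simp_all add: wirtinger_def wirtinger_bar_def algebra_simps add_divide_distrib diff_divide_distrib)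

lemma has_derivative_tangent:
  assumes "(f has_derivative f') (at z)"
  shows "f' v = tangent_apply (real_tangent v) f z"
  using assms by (simp add: tangent_apply_eq complexify_apply_real_tangent has_derivative_linear)

lemma Basis_complex_vec:
  "(Basis :: (complex ^ 'n::finite) set) = (\<Union>k. {axis k 1, axis k \<i>})"
  by (auto simp: Basis_vec_def Basis_complex_def)

section \<open>Symmetry of second derivatives\<close>

text \<open>The second difference is a first difference of \<open>u \<mapsto> f (x + u a + t b) - f (x + u a)\<close>. The
  derivative of this function is a first difference of \<open>partial_deriv a f\<close>, which is \<open>t P b\<close> up to
  \<open>o(t)\<close>. Differentiability of \<open>partial_deriv a f\<close> is assumed at the one point \<open>x\<close>, because smoothness
  is used below in the form that all iterated derivatives exist.\<close>

lemma second_difference_bound: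
  fixes f :: "'a::euclidean_space \<Rightarrow> 'b::real_normed_vector"
  assumes U: "open U" "x \<in> U"
    and f: "\<And>y. y \<in> U \<Longrightarrow> f differentiable (at y)"
    and P: "((\<lambda>y. partial_deriv a f y) has_derivative P) (at x)"
    and e: "\<epsilon> > 0"
  shows "\<forall>\<^sub>F t in at_right 0. norm (f (x + t *\<^sub>R a + t *\<^sub>R b) - f (x + t *\<^sub>R a) - f (x + t *\<^sub>R b) + f x
            - (t * t) *\<^sub>R P b) \<le> \<epsilon> * (t * t)"
proof -
  \<comment> \<open>\<open>t K\<close> bounds the sum of the two displacements, the summand \<open>1\<close> keeps \<open>K\<close> positive\<close>
  define K where "K = 2 * (norm a + norm b) + 1"
  have K: "K > 0" unfolding K_def by (intro add_nonneg_pos mult_nonneg_nonneg) auto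
  interpret P: bounded_linear P using P by (rule has_derivative_bounded_linear)
  obtain r where r: "r > 0" "ball x r \<subseteq> U" using U open_contains_ball by blast
  obtain \<rho> where \<rho>: "\<rho> > 0"
    "\<And>y. norm (y - x) < \<rho> \<Longrightarrow> norm (partial_deriv a f y - partial_deriv a f x - P (y - x)) \<le> \<epsilon> / K * norm (y - x)"
    using P e K unfolding has_derivative_at_alt by (metis divide_pos_pos)
  define \<eta> where "\<eta> = min r \<rho> / K"
  have \<eta>: "\<eta> > 0" using r \<rho> K by (simp add: \<eta>_def)
  have main: "norm (f (x + t *\<^sub>R a + t *\<^sub>R b) - f (x + t *\<^sub>R a) - f (x + t *\<^sub>R b) + f x - (t * t) *\<^sub>R P b) \<le> \<epsilon> * (t * t)"
    if t: "0 < t" "t < \<eta>" for t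
  proof -
    have near: "norm (u *\<^sub>R a) + norm (t *\<^sub>R b) < min r \<rho>" "norm (u *\<^sub>R a) + norm (u *\<^sub>R a + t *\<^sub>R b) \<le> t * K" if u: "u \<in> {0..t}" for u
    proof -
      have "norm (u *\<^sub>R a) \<le> t * norm a" using u by (simp add: mult_right_mono)
      then have "norm (u *\<^sub>R a) + norm (t *\<^sub>R b) \<le> t * (norm a + norm b)" using t by (simp add: algebra_simps)
      also have "\<dots> \<le> t * K" using t unfolding K_def by (intro mult_left_mono) (simp_all add: add_nonneg_nonneg)
      also have "\<dots> < \<eta> * K" using t K by simp
      also have "\<dots> = min r \<rho>" using K by (simp add: \<eta>_def)
      finally show "norm (u *\<^sub>R a) + norm (t *\<^sub>R b) < min r \<rho>" .
      have "norm (u *\<^sub>R a) + norm (u *\<^sub>R a + t *\<^sub>R b) \<le> 2 * norm (u *\<^sub>R a) + norm (t *\<^sub>R b)"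
        using norm_triangle_ineq[of "u *\<^sub>R a" "t *\<^sub>R b"] by simp
      also have "\<dots> \<le> 2 * (t * norm a) + t * norm b"
        using \<open>norm (u *\<^sub>R a) \<le> t * norm a\<close> t by simp
      also have "\<dots> \<le> t * K" using t by (auto simp: K_def algebra_simps)
      finally show "norm (u *\<^sub>R a) + norm (u *\<^sub>R a + t *\<^sub>R b) \<le> t * K" .
    qed
    define h where "h = (\<lambda>u. f (x + u *\<^sub>R a + t *\<^sub>R b) - f (x + u *\<^sub>R a) - (u * t) *\<^sub>R P b)"
    have in1: "x + u *\<^sub>R a + t *\<^sub>R b \<in> U" "x + u *\<^sub>R a \<in> U" if u: "u \<in> {0..t}" for u
    proof -
      have "norm (u *\<^sub>R a + t *\<^sub>R b) < r" "norm (u *\<^sub>R a) < r"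
        using near(1)[OF u] norm_triangle_ineq[of "u *\<^sub>R a" "t *\<^sub>R b"]
        by (auto, smt (verit) norm_ge_zero zero_le_mult_iff abs_ge_zero)
      then show "x + u *\<^sub>R a + t *\<^sub>R b \<in> U" "x + u *\<^sub>R a \<in> U"
        using r(2) by (auto simp: subset_iff dist_norm algebra_simps norm_minus_commute)
    qed
    define h' where "h' = (\<lambda>u s. s *\<^sub>R (partial_deriv a f (x + u *\<^sub>R a + t *\<^sub>R b) - partial_deriv a f (x + u *\<^sub>R a) - t *\<^sub>R P b))"
    have der: "(h has_derivative h' u) (at u within {0..t})" if u: "u \<in> {0..t}" for u
    proof -
      have d: "(f has_derivative frechet_derivative f (at y)) (at y)" if "y \<in> U" for y
        using f[OF that] frechet_derivative_works by blast
      have l: "linear (frechet_derivative f (at y))" if "y \<in> U" for y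
        using f[OF that] linear_frechet_derivative by blast
      have 1: "((\<lambda>u. f (x + u *\<^sub>R a + t *\<^sub>R b)) has_derivative (\<lambda>s. frechet_derivative f (at (x + u *\<^sub>R a + t *\<^sub>R b)) (s *\<^sub>R a))) (at u within {0..t})"
        by (rule has_derivative_compose[where f = "\<lambda>u. x + u *\<^sub>R a + t *\<^sub>R b" and x = u, OF _ d[OF in1(1)[OF u]]]) (auto intro!: derivative_eq_intros)
      have 2: "((\<lambda>u. f (x + u *\<^sub>R a)) has_derivative (\<lambda>s. frechet_derivative f (at (x + u *\<^sub>R a)) (s *\<^sub>R a))) (at u within {0..t})"
        by (rule has_derivative_compose[where f = "\<lambda>u. x + u *\<^sub>R a" and x = u, OF _ d[OF in1(2)[OF u]]]) (auto intro!: derivative_eq_intros)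
      have 3: "((\<lambda>u. (u * t) *\<^sub>R P b) has_derivative (\<lambda>s. (s * t) *\<^sub>R P b)) (at u within {0..t})"
        by (auto intro!: derivative_eq_intros)
      have "h' u = (\<lambda>s. frechet_derivative f (at (x + u *\<^sub>R a + t *\<^sub>R b)) (s *\<^sub>R a)
          - frechet_derivative f (at (x + u *\<^sub>R a)) (s *\<^sub>R a) - (s * t) *\<^sub>R P b)"
        unfolding h'_def partial_deriv_def
          linear_scale[OF l[OF in1(1)[OF u]]] linear_scale[OF l[OF in1(2)[OF u]]]
        by (simp add: scaleR_right_diff_distrib)
      then show ?thesis unfolding h_def
        using has_derivative_diff[OF has_derivative_diff[OF 1 2] 3] by simp
    qed
    have on: "onorm (h' u) \<le> \<epsilon> * t" if u: "u \<in> {0..t}" for u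
    proof -
      let ?y1 = "x + u *\<^sub>R a + t *\<^sub>R b" and ?y2 = "x + u *\<^sub>R a"
      have n: "norm (u *\<^sub>R a + t *\<^sub>R b) < \<rho>" "norm (u *\<^sub>R a) < \<rho>"
        using near(1)[OF u] norm_triangle_ineq[of "u *\<^sub>R a" "t *\<^sub>R b"]
        by (auto, smt (verit) norm_ge_zero zero_le_mult_iff abs_ge_zero)
      have e1: "norm (partial_deriv a f ?y1 - partial_deriv a f x - P (u *\<^sub>R a + t *\<^sub>R b)) \<le> \<epsilon> / K * norm (u *\<^sub>R a + t *\<^sub>R b)"
        using \<rho>(2)[of ?y1] n by (simp add: algebra_simps)
      have e2: "norm (partial_deriv a f ?y2 - partial_deriv a f x - P (u *\<^sub>R a)) \<le> \<epsilon> / K * norm (u *\<^sub>R a)"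
        using \<rho>(2)[of ?y2] n by (simp add: algebra_simps)
      have "partial_deriv a f ?y1 - partial_deriv a f ?y2 - t *\<^sub>R P b
          = (partial_deriv a f ?y1 - partial_deriv a f x - P (u *\<^sub>R a + t *\<^sub>R b)) - (partial_deriv a f ?y2 - partial_deriv a f x - P (u *\<^sub>R a))"
        by (simp add: P.add P.scaleR)
      then have "norm (partial_deriv a f ?y1 - partial_deriv a f ?y2 - t *\<^sub>R P b) \<le> \<epsilon> / K * (norm (u *\<^sub>R a + t *\<^sub>R b) + norm (u *\<^sub>R a))"
        using e1 e2 norm_triangle_ineq4 by (smt (verit) distrib_left)
      also have "\<dots> \<le> \<epsilon> / K * (t * K)"
        using near(2)[OF u] e K by (intro mult_left_mono) auto
      also have "\<dots> = \<epsilon> * t" using K by simp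
      finally have *: "norm (partial_deriv a f ?y1 - partial_deriv a f ?y2 - t *\<^sub>R P b) \<le> \<epsilon> * t" .
      show ?thesis unfolding h'_def
        by (rule onorm_le) (simp add: mult.commute, metis * abs_ge_zero mult.commute mult_left_mono)
    qed
    have "norm (h t - h 0) \<le> \<epsilon> * t * norm (t - 0)"
      by (rule differentiable_bound[OF _ der on]) (use t in auto)
    moreover have "h t - h 0 = f (x + t *\<^sub>R a + t *\<^sub>R b) - f (x + t *\<^sub>R a) - f (x + t *\<^sub>R b) + f x - (t * t) *\<^sub>R P b"
      by (simp add: h_def)
    ultimately show ?thesis using t by (simp add: mult.assoc)
  qed
  show ?thesis
    unfolding eventually_at_right_field using main \<eta> by blast
qed

text \<open>The second difference does not change when \<open>a\<close> and \<open>b\<close> are exchanged.\<close>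

lemma second_derivative_symmetric:
  fixes f :: "'a::euclidean_space \<Rightarrow> 'b::real_normed_vector"
  assumes U: "open U" "x \<in> U"
    and f: "\<And>y. y \<in> U \<Longrightarrow> f differentiable (at y)"
    and a: "partial_deriv a f differentiable (at x)" and b: "partial_deriv b f differentiable (at x)"
  shows "partial_deriv a (partial_deriv b f) x = partial_deriv b (partial_deriv a f) x"
proof -
  obtain P where P: "(partial_deriv a f has_derivative P) (at x)" using a by (auto simp: differentiable_def)
  obtain Q where Q: "(partial_deriv b f has_derivative Q) (at x)" using b by (auto simp: differentiable_def)
  have "norm (P b - Q a) \<le> \<epsilon>" if e: "\<epsilon> > 0" for \<epsilon>
  proof -
    have e2: "\<epsilon> / 2 > 0" using e by simp
    have 0: "\<forall>\<^sub>F t in at_right (0::real). 0 < t" by (simp add: eventually_at_right_less)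
    note D = second_difference_bound[where f = f, OF U f]
    have "\<forall>\<^sub>F t in at_right (0::real). norm (P b - Q a) \<le> \<epsilon>"
      using D[OF _ P e2, of b, simplified] D[OF _ Q e2, of a, simplified] 0
    proof eventually_elim
      case (elim t)
      let ?D = "f (x + t *\<^sub>R a + t *\<^sub>R b) - f (x + t *\<^sub>R a) - f (x + t *\<^sub>R b) + f x"
      have "norm (?D - (t * t) *\<^sub>R P b) \<le> \<epsilon> / 2 * (t * t)" "norm (?D - (t * t) *\<^sub>R Q a) \<le> \<epsilon> / 2 * (t * t)"
        using elim(1,2) by (simp_all add: algebra_simps)
      then have "norm ((?D - (t * t) *\<^sub>R Q a) - (?D - (t * t) *\<^sub>R P b)) \<le> \<epsilon> * (t * t)"
        using norm_triangle_ineq4[of "?D - (t * t) *\<^sub>R Q a" "?D - (t * t) *\<^sub>R P b"] by linarith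
      then have "norm ((t * t) *\<^sub>R (P b - Q a)) \<le> \<epsilon> * (t * t)" by (simp add: algebra_simps)
      then show ?case using elim(3) by (simp add: mult.commute)
    qed
    then show ?thesis by (simp add: eventually_const)
  qed
  then have "P b = Q a"
    by (metis dense not_le norm_le_zero_iff right_minus_eq linorder_le_less_linear)
  then show ?thesis using partial_deriv_eq[OF P] partial_deriv_eq[OF Q] by simp
qed

lemma vf_apply_mult:
  "f differentiable (at z) \<Longrightarrow> g differentiable (at z) \<Longrightarrow>
    vf_apply V (\<lambda>w. f w * g w) z = vf_apply V f z * g z + f z * vf_apply V g z"
  by (simp add: vf_apply_def tangent_apply_mult)

lemma vf_apply_add:
  "f differentiable (at z) \<Longrightarrow> g differentiable (at z) \<Longrightarrow>
    vf_apply V (\<lambda>w. f w + g w) z = vf_apply V f z + vf_apply V g z"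
  by (simp add: vf_apply_def tangent_apply_add)

lemma vf_apply_cmult:
  "f differentiable (at z) \<Longrightarrow> vf_apply V (\<lambda>w. c * f w) z = c * vf_apply V f z"
  by (simp add: vf_apply_def tangent_apply_cmult)

lemma vf_apply_sum:
  "finite S \<Longrightarrow> (\<And>i. i \<in> S \<Longrightarrow> f i differentiable (at z)) \<Longrightarrow>
    vf_apply V (\<lambda>w. \<Sum>i\<in>S. f i w) z = (\<Sum>i\<in>S. vf_apply V (f i) z)"
  by (simp add: vf_apply_def tangent_apply_sum)

lemma vf_apply_const [simp]: "vf_apply V (\<lambda>w. c) z = 0"
  by (simp add: vf_apply_def)

lemma vf_apply_cnj:
  "f differentiable (at z) \<Longrightarrow> vf_apply V (\<lambda>w. cnj (f w)) z = cnj (vf_apply (cnj_vf V) f z)"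
  by (simp add: vf_apply_def tangent_apply_cnj cnj_vf_eq)

lemma vf_apply_cong_open:
  "f differentiable (at z) \<Longrightarrow> open U \<Longrightarrow> z \<in> U \<Longrightarrow> (\<And>w. w \<in> U \<Longrightarrow> f w = g w) \<Longrightarrow>
    vf_apply V f z = vf_apply V g z"
  unfolding vf_apply_def by (rule tangent_apply_cong_open)

lemma differentiable_onD_open:
  "f differentiable_on U \<Longrightarrow> open U \<Longrightarrow> z \<in> U \<Longrightarrow> f differentiable (at z)"
  by (simp add: differentiable_on_eq_differentiable_at)

lemma differentiable_on_cong:
  "(\<And>z. z \<in> U \<Longrightarrow> f z = g z) \<Longrightarrow> f differentiable_on U \<longleftrightarrow> g differentiable_on U"
  unfolding differentiable_on_def differentiable_def
  by (intro ball_cong ex_cong1 refl) (metis has_derivative_transform)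

section \<open>Families of functions with bounded iterated derivatives at a point\<close>

text \<open>The derivatives are bounded at the one point \<open>p\<close> where all charts are centred, while
  differentiability is required on a neighbourhood that may depend on \<open>\<delta>\<close>. The calculus serves two
  purposes. With the index set \<open>{0<..1}\<close> it expresses uniform bounds along scaled fields. With a
  single index and weight \<open>0\<close> the bounds are void, and it expresses smoothness; thus the rules for
  products and inverse matrices are proved once.\<close>

locale bounded_calculus =
  fixes X :: "'s \<Rightarrow> 'n::finite cvf" and e :: "'s \<Rightarrow> real" and I :: "real set"
    and U :: "real \<Rightarrow> (complex ^ 'n) set" and p :: "complex ^ 'n"
  assumes open_U: "\<delta> \<in> I \<Longrightarrow> open (U \<delta>)" and p_in_U: "\<delta> \<in> I \<Longrightarrow> p \<in> U \<delta>"
begin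

definition scaled_deriv ::
    "'s \<Rightarrow> (real \<Rightarrow> complex ^ 'n \<Rightarrow> complex) \<Rightarrow> real \<Rightarrow> complex ^ 'n \<Rightarrow> complex" where
  "scaled_deriv i F = (\<lambda>\<delta> z. of_real (\<delta> powr e i) * vf_apply (X i) (F \<delta>) z)"

definition base_bdd :: "(real \<Rightarrow> complex ^ 'n \<Rightarrow> complex) \<Rightarrow> bool" where
  [simp]: "base_bdd F \<longleftrightarrow> (\<forall>\<delta>\<in>I. F \<delta> differentiable_on U \<delta>) \<and> (\<exists>C. \<forall>\<delta>\<in>I. cmod (F \<delta> p) \<le> C)"

primrec bdd :: "nat \<Rightarrow> (real \<Rightarrow> complex ^ 'n \<Rightarrow> complex) \<Rightarrow> bool" where
  "bdd 0 F \<longleftrightarrow> base_bdd F"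
| "bdd (Suc r) F \<longleftrightarrow> base_bdd F \<and> (\<forall>i. bdd r (scaled_deriv i F))"

lemma bdd_0: "bdd r F \<Longrightarrow> bdd 0 F"
  by (cases r) auto

lemma bdd_differentiable: "bdd r F \<Longrightarrow> \<delta> \<in> I \<Longrightarrow> z \<in> U \<delta> \<Longrightarrow> F \<delta> differentiable (at z)"
  using bdd_0[of r F] open_U by (auto intro: differentiable_onD_open)

lemma bdd_bound: "bdd r F \<Longrightarrow> \<exists>C. \<forall>\<delta>\<in>I. cmod (F \<delta> p) \<le> C"
  using bdd_0[of r F] by auto

lemma bdd_0I:
  "(\<And>\<delta> z. \<delta> \<in> I \<Longrightarrow> z \<in> U \<delta> \<Longrightarrow> F \<delta> differentiable (at z)) \<Longrightarrow> (\<And>\<delta>. \<delta> \<in> I \<Longrightarrow> cmod (F \<delta> p) \<le> C) \<Longrightarrow> bdd 0 F"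
  using open_U by (auto simp: differentiable_on_eq_differentiable_at)

lemma bdd_cong:
  "bdd r F \<Longrightarrow> (\<And>\<delta> z. \<delta> \<in> I \<Longrightarrow> z \<in> U \<delta> \<Longrightarrow> F \<delta> z = G \<delta> z) \<Longrightarrow> bdd r G"
proof (induction r arbitrary: F G)
  case 0
  then have "F \<delta> differentiable_on U \<delta> \<longleftrightarrow> G \<delta> differentiable_on U \<delta>" if "\<delta> \<in> I" for \<delta>
    using that by (intro differentiable_on_cong) auto
  then show ?case using 0 p_in_U by auto
next
  case (Suc r)
  have "scaled_deriv i F \<delta> z = scaled_deriv i G \<delta> z" if "\<delta> \<in> I" "z \<in> U \<delta>" for i \<delta> z
    using vf_apply_cong_open[of "F \<delta>" z "U \<delta>" "G \<delta>" "X i"] bdd_differentiable[OF Suc.prems(1) that]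
      open_U Suc.prems(2) that by (simp add: scaled_deriv_def)
  moreover have "bdd r (scaled_deriv i F)" for i using Suc.prems by auto
  ultimately have 1: "bdd r (scaled_deriv i G)" for i by (rule Suc.IH[rotated])
  have "F \<delta> differentiable_on U \<delta> \<longleftrightarrow> G \<delta> differentiable_on U \<delta>" if "\<delta> \<in> I" for \<delta>
    using Suc.prems(2) that by (intro differentiable_on_cong) auto
  then show ?case using Suc.prems p_in_U 1 by auto
qed

lemma bdd_Suc: "bdd (Suc r) F \<Longrightarrow> bdd r F"
  by (induction r arbitrary: F) auto

lemma bdd_mono: "bdd r F \<Longrightarrow> s \<le> r \<Longrightarrow> bdd s F"
proof (induction r)
  case (Suc r)
  then show ?case by (metis bdd_Suc le_Suc_eq)
qed auto

lemma bdd_scaled_deriv: "bdd (Suc r) F \<Longrightarrow> bdd r (scaled_deriv i F)"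
  by simp

lemma bdd_add: "bdd r F \<Longrightarrow> bdd r G \<Longrightarrow> bdd r (\<lambda>\<delta> z. F \<delta> z + G \<delta> z)"
proof (induction r arbitrary: F G)
  case 0
  note d = bdd_differentiable[OF 0(1)] bdd_differentiable[OF 0(2)]
  obtain C D where "\<forall>\<delta>\<in>I. cmod (F \<delta> p) \<le> C" "\<forall>\<delta>\<in>I. cmod (G \<delta> p) \<le> D"
    using bdd_bound[OF 0(1)] bdd_bound[OF 0(2)] by blast
  then show ?case
    by (intro bdd_0I[where C = "C + D"] differentiable_add d norm_triangle_mono) auto
next
  case (Suc r)
  note d = bdd_differentiable[OF Suc.prems(1)] bdd_differentiable[OF Suc.prems(2)]
  have "bdd r (scaled_deriv i (\<lambda>\<delta> z. F \<delta> z + G \<delta> z))" for i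
    by (rule bdd_cong[OF Suc.IH[OF bdd_scaled_deriv[OF Suc.prems(1)] bdd_scaled_deriv[OF Suc.prems(2)], of i i]])
      (simp add: scaled_deriv_def vf_apply_add[OF d] algebra_simps)
  moreover have "bdd 0 (\<lambda>\<delta> z. F \<delta> z + G \<delta> z)"
    using Suc.IH[OF Suc.prems[THEN bdd_Suc]] bdd_0 by blast
  ultimately show ?case by simp
qed

lemma bdd_mult: "bdd r F \<Longrightarrow> bdd r G \<Longrightarrow> bdd r (\<lambda>\<delta> z. F \<delta> z * G \<delta> z)"
proof (induction r arbitrary: F G)
  case 0
  note d = bdd_differentiable[OF 0(1)] bdd_differentiable[OF 0(2)]
  obtain C D where "\<forall>\<delta>\<in>I. cmod (F \<delta> p) \<le> C" "\<forall>\<delta>\<in>I. cmod (G \<delta> p) \<le> D"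
    using bdd_bound[OF 0(1)] bdd_bound[OF 0(2)] by blast
  then have "cmod (F \<delta> p * G \<delta> p) \<le> C * D" if "\<delta> \<in> I" for \<delta>
    unfolding norm_mult using that by (intro mult_mono) (auto intro: order_trans[OF norm_ge_zero])
  then show ?case by (intro bdd_0I[where C = "C * D"] differentiable_mult d)
next
  case (Suc r)
  note d = bdd_differentiable[OF Suc.prems(1)] bdd_differentiable[OF Suc.prems(2)]
  have "bdd r (scaled_deriv i (\<lambda>\<delta> z. F \<delta> z * G \<delta> z))" for i
    by (rule bdd_cong[OF bdd_add[OF Suc.IH[OF bdd_scaled_deriv[OF Suc.prems(1), of i] bdd_Suc[OF Suc.prems(2)]]
          Suc.IH[OF bdd_Suc[OF Suc.prems(1)] bdd_scaled_deriv[OF Suc.prems(2), of i]]]])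
      (simp add: scaled_deriv_def vf_apply_mult[OF d] algebra_simps)
  moreover have "bdd 0 (\<lambda>\<delta> z. F \<delta> z * G \<delta> z)"
    using Suc.IH[OF Suc.prems[THEN bdd_Suc]] bdd_0 by blast
  ultimately show ?case by simp
qed

lemma bdd_const: "(\<And>\<delta>. \<delta> \<in> I \<Longrightarrow> cmod (c \<delta>) \<le> C) \<Longrightarrow> bdd r (\<lambda>\<delta> z. c \<delta>)"
proof (induction r arbitrary: c C)
  case 0
  then show ?case by (intro bdd_0I) auto
next
  case (Suc r)
  have "bdd r (scaled_deriv i (\<lambda>\<delta> z. c \<delta>))" for i
    using Suc.IH[of "\<lambda>_. 0" 0] by (simp add: scaled_deriv_def)
  then show ?case using Suc.prems by auto
qed

lemma bdd_cmult: "bdd r F \<Longrightarrow> bdd r (\<lambda>\<delta> z. c * F \<delta> z)"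
  by (rule bdd_mult[OF bdd_const]) auto

lemma bdd_uminus: "bdd r F \<Longrightarrow> bdd r (\<lambda>\<delta> z. - F \<delta> z)"
  using bdd_cmult[of r F "-1"] by simp

lemma bdd_diff: "bdd r F \<Longrightarrow> bdd r G \<Longrightarrow> bdd r (\<lambda>\<delta> z. F \<delta> z - G \<delta> z)"
  using bdd_add[of r F "\<lambda>\<delta> z. - G \<delta> z"] bdd_uminus[of r G] by simp

lemma bdd_sum: "(\<And>i. i \<in> S \<Longrightarrow> bdd r (F i)) \<Longrightarrow> bdd r (\<lambda>\<delta> z. \<Sum>i\<in>S. F i \<delta> z)"
  by (induction S rule: infinite_finite_induct) (auto intro!: bdd_add bdd_const[of "\<lambda>_. 0" 0])

lemma bdd_cnj:
  assumes "\<And>i. \<exists>j. e j = e i \<and> (\<forall>z. X j z = cnj_tangent (X i z))"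
  shows "bdd r F \<Longrightarrow> bdd r (\<lambda>\<delta> z. cnj (F \<delta> z))"
proof (induction r arbitrary: F)
  case 0
  obtain C where "\<forall>\<delta>\<in>I. cmod (F \<delta> p) \<le> C" using bdd_bound[OF 0] by blast
  then show ?case
    by (intro bdd_0I[where C = C] differentiable_cnj bdd_differentiable[OF 0]) auto
next
  case (Suc r)
  note d = bdd_differentiable[OF Suc.prems]
  have "bdd r (scaled_deriv i (\<lambda>\<delta> z. cnj (F \<delta> z)))" for i
  proof -
    obtain j where j: "e j = e i" "\<And>z. X j z = cnj_tangent (X i z)" using assms by blast
    have "vf_apply (X i) (\<lambda>w. cnj (F \<delta> w)) z = cnj (vf_apply (X j) (F \<delta>) z)" if "\<delta> \<in> I" "z \<in> U \<delta>" for \<delta> z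
      unfolding vf_apply_cnj[OF d[OF that]] by (simp add: vf_apply_def cnj_vf_eq j)
    then show ?thesis
      by (intro bdd_cong[OF Suc.IH[OF bdd_scaled_deriv[OF Suc.prems, of j]]])
        (simp add: scaled_deriv_def j)
  qed
  moreover have "bdd 0 (\<lambda>\<delta> z. cnj (F \<delta> z))"
    using Suc.IH[OF Suc.prems[THEN bdd_Suc]] bdd_0 by blast
  ultimately show ?case by simp
qed

end

lemma differentiable_prod:
  fixes f :: "'i \<Rightarrow> 'a::real_normed_vector \<Rightarrow> 'b::real_normed_field"
  shows "(\<And>i. i \<in> S \<Longrightarrow> f i differentiable (at z)) \<Longrightarrow> (\<lambda>w. \<Prod>i\<in>S. f i w) differentiable (at z)"
  by (induction S rule: infinite_finite_induct) (auto intro!: differentiable_mult)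

lemma differentiable_det:
  fixes M :: "'a::real_normed_vector \<Rightarrow> complex ^ 'k::finite ^ 'k"
  assumes "\<And>i j. (\<lambda>w. M w $ i $ j) differentiable (at z)"
  shows "(\<lambda>w. det (M w)) differentiable (at z)"
  unfolding det_def using assms by (intro differentiable_sum ballI differentiable_mult differentiable_prod) auto

text \<open>Cramer's rule exhibits the entries of the inverse as quotients of determinants.\<close>

lemma differentiable_inverse_matrix:
  fixes M N :: "'k::finite \<Rightarrow> 'k \<Rightarrow> 'a::real_normed_vector \<Rightarrow> complex"
  assumes "open U" "z \<in> U"
    and M: "\<And>i j. M i j differentiable (at z)"
    and inv: "\<And>w i l. w \<in> U \<Longrightarrow> (\<Sum>j\<in>UNIV. M i j w * N j l w) = (if i = l then 1 else 0)"
  shows "N k l differentiable (at z)"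
proof -
  define A where "A = (\<lambda>w. \<chi> i j. M i j w)"
  have det: "det (A w) \<noteq> 0 \<and> N k l w = det (\<chi> i j. if j = k then axis l 1 $ i else A w $ i $ j) / det (A w)"
    if "w \<in> U" for w
  proof -
    have "A w ** (\<chi> j l. N j l w) = mat 1"
      using inv[OF that] by (simp add: A_def matrix_matrix_mult_def mat_def vec_eq_iff)
    then have 0: "det (A w) \<noteq> 0"
      by (metis det_I det_mul mult_zero_left zero_neq_one)
    have "A w *v (\<chi> j. N j l w) = axis l 1"
      using inv[OF that] by (simp add: A_def matrix_vector_mult_def vec_eq_iff axis_def)
    then have "(\<chi> j. N j l w) = (\<chi> k. det (\<chi> i j. if j = k then axis l 1 $ i else A w $ i $ j) / det (A w))"
      using cramer[OF 0] by blast
    then show ?thesis using 0 by (simp add: vec_eq_iff)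
  qed
  have "(\<lambda>w. det (A w)) differentiable (at z)"
    by (rule differentiable_det) (simp add: A_def M)
  moreover have "(\<lambda>w. det (\<chi> i j. if j = k then axis l 1 $ i else A w $ i $ j)) differentiable (at z)"
  proof (rule differentiable_det)
    show "(\<lambda>w. (\<chi> i j. if j = k then axis l 1 $ i else A w $ i $ j) $ i $ j) differentiable (at z)" for i j
      by (cases "j = k") (simp_all add: A_def M)
  qed
  ultimately have "(\<lambda>w. det (\<chi> i j. if j = k then axis l 1 $ i else A w $ i $ j) / det (A w)) differentiable (at z)"
    using det[OF assms(2)] by (intro differentiable_divide) auto
  then obtain D where "((\<lambda>w. det (\<chi> i j. if j = k then axis l 1 $ i else A w $ i $ j) / det (A w)) has_derivative D) (at z)"
    by (auto simp: differentiable_def)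
  then have "(N k l has_derivative D) (at z)"
    by (rule has_derivative_transform_within_open[OF _ assms(1,2)]) (use det in auto)
  then show ?thesis by (auto simp: differentiable_def)
qed

lemma open_det_nonzero:
  fixes M :: "'a::real_normed_vector \<Rightarrow> complex ^ 'k::finite ^ 'k"
  assumes "open U" "\<And>i j z. z \<in> U \<Longrightarrow> (\<lambda>w. M w $ i $ j) differentiable (at z)"
  shows "open {z \<in> U. det (M z) \<noteq> 0}"
proof -
  have "(\<lambda>z. det (M z)) differentiable_on U"
    using assms by (simp add: differentiable_on_eq_differentiable_at differentiable_det)
  then have "open (U \<inter> (\<lambda>z. det (M z)) -` (- {0}))"
    using assms(1) by (intro continuous_open_preimage differentiable_imp_continuous_on) auto
  moreover have "U \<inter> (\<lambda>z. det (M z)) -` (- {0}) = {z \<in> U. det (M z) \<noteq> 0}" by auto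
  ultimately show ?thesis by simp
qed

lemma matrix_inv_right_inverse:
  fixes A :: "complex ^ 'k::finite ^ 'k"
  assumes "det A \<noteq> 0"
  shows "A ** matrix_inv A = mat 1"
  using assms unfolding invertible_det_nz[symmetric] invertible_def matrix_inv_def by (rule someI2_ex) simp

lemma left_inverse_from_right:
  fixes M N :: "'k::finite \<Rightarrow> 'k \<Rightarrow> complex"
  assumes "\<And>i l. (\<Sum>j\<in>UNIV. M i j * N j l) = (if i = l then 1 else 0)"
  shows "(\<Sum>j\<in>UNIV. N i j * M j l) = (if i = l then 1 else 0)"
proof -
  have "(\<chi> i j. M i j) ** (\<chi> i j. N i j) = mat 1"
    using assms by (simp add: matrix_matrix_mult_def mat_def vec_eq_iff)
  then have "(\<chi> i j. N i j) ** (\<chi> i j. M i j) = mat 1"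
    using matrix_left_right_inverse by blast
  then show ?thesis by (simp add: matrix_matrix_mult_def mat_def vec_eq_iff)
qed

context bounded_calculus begin

text \<open>Differentiating \<open>M N = 1\<close> gives \<open>X N = - N (X M) N\<close>, so derivatives of the inverse are
  controlled by lower ones.\<close>

lemma bdd_inverse_matrix:
  fixes M N :: "'k::finite \<Rightarrow> 'k \<Rightarrow> real \<Rightarrow> complex ^ 'n \<Rightarrow> complex"
  assumes inv: "\<And>\<delta> z i l. \<delta> \<in> I \<Longrightarrow> z \<in> U \<delta> \<Longrightarrow> (\<Sum>j\<in>UNIV. M i j \<delta> z * N j l \<delta> z) = (if i = l then 1 else 0)"
    and N: "\<And>i j. \<exists>C. \<forall>\<delta>\<in>I. cmod (N i j \<delta> p) \<le> C"
  shows "(\<And>i j. bdd r (M i j)) \<Longrightarrow> bdd r (N k l)"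
proof (induction r arbitrary: k l)
  case 0
  from N[of k l] obtain C where C: "\<forall>\<delta>\<in>I. cmod (N k l \<delta> p) \<le> C" ..
  show ?case
  proof (rule bdd_0I)
    show "cmod (N k l \<delta> p) \<le> C" if "\<delta> \<in> I" for \<delta>
      using C that by (rule bspec)
    show "N k l \<delta> differentiable (at z)" if "\<delta> \<in> I" "z \<in> U \<delta>" for \<delta> z
    proof (rule differentiable_inverse_matrix[where U = "U \<delta>" and M = "\<lambda>i j. M i j \<delta>" and N = "\<lambda>i j. N i j \<delta>"])
      show "open (U \<delta>)" by (rule open_U[OF that(1)])
      show "z \<in> U \<delta>" by (rule that(2))
      show "M i j \<delta> differentiable at z" for i j by (rule bdd_differentiable[OF 0 that])
      show "(\<Sum>j\<in>UNIV. M i j \<delta> w * N j l \<delta> w) = (if i = l then 1 else 0)" if "w \<in> U \<delta>" for w i l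
        by (rule inv[OF \<open>\<delta> \<in> I\<close> that])
    qed
  qed
next
  case (Suc r)
  have IH: "bdd r (N i j)" for i j by (rule Suc.IH) (rule bdd_Suc[OF Suc.prems])
  have dN: "N i j \<delta> differentiable (at z)" if "\<delta> \<in> I" "z \<in> U \<delta>" for \<delta> z i j
    using bdd_differentiable[OF IH that] .
  have dM: "M i j \<delta> differentiable (at z)" if "\<delta> \<in> I" "z \<in> U \<delta>" for \<delta> z i j
    using bdd_differentiable[OF Suc.prems that] .
  have "bdd r (scaled_deriv s (N k l))" for s
  proof (rule bdd_cong)
    show "bdd r (\<lambda>\<delta> z. - (\<Sum>i\<in>UNIV. N k i \<delta> z * (\<Sum>j\<in>UNIV. scaled_deriv s (M i j) \<delta> z * N j l \<delta> z)))"
      by (intro bdd_uminus bdd_sum bdd_mult IH bdd_scaled_deriv Suc.prems)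
    fix \<delta> z assume dz: "\<delta> \<in> I" "z \<in> U \<delta>"
    let ?V = "\<lambda>f. vf_apply (X s) f z"
    have 1: "(\<Sum>j\<in>UNIV. M i j \<delta> z * ?V (N j l \<delta>)) = - (\<Sum>j\<in>UNIV. ?V (M i j \<delta>) * N j l \<delta> z)" for i
    proof -
      have "?V (\<lambda>w. \<Sum>j\<in>UNIV. M i j \<delta> w * N j l \<delta> w) = (\<Sum>j\<in>UNIV. ?V (M i j \<delta>) * N j l \<delta> z + M i j \<delta> z * ?V (N j l \<delta>))"
        using dM[OF dz] dN[OF dz] by (simp add: vf_apply_sum vf_apply_mult differentiable_mult)
      moreover have "?V (\<lambda>w. \<Sum>j\<in>UNIV. M i j \<delta> w * N j l \<delta> w) = ?V (\<lambda>w. if i = l then 1 else 0)"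
        by (rule vf_apply_cong_open[OF _ open_U[OF dz(1)] dz(2)])
          (use dM[OF dz] dN[OF dz] inv[OF dz(1)] in \<open>auto intro!: differentiable_sum differentiable_mult\<close>)
      ultimately show ?thesis by (simp add: sum.distrib add_eq_0_iff2)
    qed
    have "(\<Sum>i\<in>UNIV. N k i \<delta> z * (\<Sum>j\<in>UNIV. M i j \<delta> z * ?V (N j l \<delta>)))
        = (\<Sum>j\<in>UNIV. (\<Sum>i\<in>UNIV. N k i \<delta> z * M i j \<delta> z) * ?V (N j l \<delta>))"
      by (simp add: sum_distrib_left sum_distrib_right mult.assoc) (rule sum.swap)
    also have "\<dots> = ?V (N k l \<delta>)"
      using left_inverse_from_right[of "\<lambda>i j. M i j \<delta> z" "\<lambda>i j. N i j \<delta> z", OF inv[OF dz]]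
      by (simp add: if_distrib[of "\<lambda>x. x * _"] cong: if_cong)
    finally have 2: "?V (N k l \<delta>) = (\<Sum>i\<in>UNIV. N k i \<delta> z * (\<Sum>j\<in>UNIV. M i j \<delta> z * ?V (N j l \<delta>)))" by simp
    show "- (\<Sum>i\<in>UNIV. N k i \<delta> z * (\<Sum>j\<in>UNIV. scaled_deriv s (M i j) \<delta> z * N j l \<delta> z)) = scaled_deriv s (N k l) \<delta> z"
      unfolding scaled_deriv_def 2 1 by (simp add: sum_distrib_left sum_negf algebra_simps)
  qed
  moreover have "bdd 0 (N k l)" using IH bdd_0 by blast
  ultimately show ?case by simp
qed

end

section \<open>Smooth functions and the commutator of two fields\<close>

text \<open>The real coordinate directions of \<open>\<complex>\<^sup>n\<close>; the flag selects the imaginary direction.\<close>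

definition coord_vf :: "'n \<times> bool \<Rightarrow> 'n::finite cvf" where
  "coord_vf c = (\<lambda>_. real_tangent (axis (fst c) (if snd c then \<i> else 1)))"

definition real_coef :: "complex ^ ('n::finite + 'n) \<Rightarrow> 'n \<times> bool \<Rightarrow> complex" where
  "real_coef X c = (if snd c then (\<i> / 2) * (X $ Inr (fst c) + (- 1) * X $ Inl (fst c))
                    else (1 / 2) * (X $ Inl (fst c) + X $ Inr (fst c)))"

lemma vf_apply_coord_vf: "vf_apply (coord_vf c) f = partial_deriv (axis (fst c) (if snd c then \<i> else 1)) f"
  by (rule ext) (auto simp: vf_apply_def coord_vf_def partial_deriv_conv_tangent_apply)

lemma sum_prod_bool: "(\<Sum>c\<in>UNIV. h c) = (\<Sum>k\<in>(UNIV :: 'k::finite set). h (k, False) + h (k, True))"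
proof -
  have "(\<Sum>c\<in>UNIV. h c) = (\<Sum>k\<in>UNIV. \<Sum>b\<in>UNIV. h (k, b))"
    by (simp add: sum.cartesian_product)
  then show ?thesis by (simp add: UNIV_bool)
qed

lemma tangent_apply_real_coef: "tangent_apply X f z = (\<Sum>c\<in>UNIV. real_coef X c * vf_apply (coord_vf c) f z)"
  unfolding sum_prod_bool vf_apply_coord_vf tangent_apply_def wirtinger_def wirtinger_bar_def
  by (rule sum.cong) (auto simp: real_coef_def algebra_simps add_divide_distrib diff_divide_distrib)

lemma real_coef_diff:
  "real_coef (X - Y) c = real_coef X c - real_coef Y c"
  by (simp add: real_coef_def algebra_simps add_divide_distrib diff_divide_distrib)

lemma differentiable_real_coef:
  "(\<And>i. (\<lambda>w. V w $ i) differentiable (at z)) \<Longrightarrow> (\<lambda>w. real_coef (V w) c) differentiable (at z)"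
  unfolding real_coef_def
  by (cases "snd c") (simp_all add: differentiable_add differentiable_mult differentiable_minus)

lemma vf_apply_real_coef:
  assumes "\<And>i. (\<lambda>w. V w $ i) differentiable (at z)"
  shows "vf_apply Y (\<lambda>w. real_coef (V w) c) z = real_coef (\<chi> i. vf_apply Y (\<lambda>w. V w $ i) z) c"
proof (cases "snd c")
  case True
  have "vf_apply Y (\<lambda>w. (\<i> / 2) * (V w $ Inr (fst c) + (- 1) * (V w $ Inl (fst c)))) z
      = (\<i> / 2) * (vf_apply Y (\<lambda>w. V w $ Inr (fst c)) z + (- 1) * vf_apply Y (\<lambda>w. V w $ Inl (fst c)) z)"
    by (simp only: vf_apply_cmult vf_apply_add differentiable_add differentiable_mult assms differentiable_const)
  then show ?thesis using True by (simp only: real_coef_def if_True vec_lambda_beta)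
next
  case False
  have "vf_apply Y (\<lambda>w. (1 / 2) * (V w $ Inl (fst c) + (V w $ Inr (fst c)))) z
      = (1 / 2) * (vf_apply Y (\<lambda>w. V w $ Inl (fst c)) z + vf_apply Y (\<lambda>w. V w $ Inr (fst c)) z)"
    by (simp only: vf_apply_cmult vf_apply_add differentiable_add differentiable_mult assms differentiable_const)
  then show ?thesis using False by (simp only: real_coef_def if_False vec_lambda_beta)
qed

text \<open>In real coordinates the second-order terms of \<open>V Y f\<close> and \<open>Y V f\<close> cancel by the symmetry of second
  derivatives.\<close>

lemma vf_apply_commutator:
  fixes V Y :: "'n::finite cvf"
  assumes U: "open U" "z \<in> U"
    and f: "f differentiable_on U" "\<And>c. vf_apply (coord_vf c) f differentiable_on U"
    and V: "\<And>i. (\<lambda>w. V w $ i) differentiable (at z)" and Y: "\<And>i. (\<lambda>w. Y w $ i) differentiable (at z)"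
  shows "vf_apply V (vf_apply Y f) z - vf_apply Y (vf_apply V f) z = vf_apply (lie_bracket V Y) f z"
proof -
  have sym: "vf_apply (coord_vf c) (vf_apply (coord_vf d) f) z = vf_apply (coord_vf d) (vf_apply (coord_vf c) f) z" for c d
    unfolding vf_apply_coord_vf
    by (rule second_derivative_symmetric[OF U])
      (use f U in \<open>auto simp: differentiable_on_eq_differentiable_at vf_apply_coord_vf\<close>)
  have df: "vf_apply (coord_vf c) f differentiable (at z)" for c
    using f U by (auto simp: differentiable_on_eq_differentiable_at)
  have ex: "vf_apply A (vf_apply B f) z = (\<Sum>c\<in>UNIV. vf_apply A (\<lambda>w. real_coef (B w) c) z * vf_apply (coord_vf c) f z)
      + (\<Sum>c\<in>UNIV. \<Sum>d\<in>UNIV. real_coef (B z) c * real_coef (A z) d * vf_apply (coord_vf d) (vf_apply (coord_vf c) f) z)"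
    if B: "\<And>i. (\<lambda>w. B w $ i) differentiable (at z)" for A B :: "'n cvf"
  proof -
    have "vf_apply B f = (\<lambda>w. \<Sum>c\<in>UNIV. real_coef (B w) c * vf_apply (coord_vf c) f w)"
      by (rule ext) (simp add: vf_apply_def[of B] tangent_apply_real_coef)
    then have "vf_apply A (vf_apply B f) z = (\<Sum>c\<in>UNIV. vf_apply A (\<lambda>w. real_coef (B w) c) z * vf_apply (coord_vf c) f z
        + real_coef (B z) c * vf_apply A (vf_apply (coord_vf c) f) z)"
      using df differentiable_real_coef[OF B] by (simp add: vf_apply_sum vf_apply_mult differentiable_mult)
    moreover have "vf_apply A (vf_apply (coord_vf c) f) z = (\<Sum>d\<in>UNIV. real_coef (A z) d * vf_apply (coord_vf d) (vf_apply (coord_vf c) f) z)" for c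
      by (simp add: vf_apply_def[of A] tangent_apply_real_coef)
    ultimately show ?thesis by (simp add: sum.distrib sum_distrib_left mult.assoc)
  qed
  have "(\<Sum>c\<in>UNIV. \<Sum>d\<in>UNIV. real_coef (Y z) c * real_coef (V z) d * vf_apply (coord_vf d) (vf_apply (coord_vf c) f) z)
     = (\<Sum>c\<in>UNIV. \<Sum>d\<in>UNIV. real_coef (V z) c * real_coef (Y z) d * vf_apply (coord_vf d) (vf_apply (coord_vf c) f) z)"
    by (subst sum.swap) (simp add: sym mult.commute mult.left_commute)
  then have "vf_apply V (vf_apply Y f) z - vf_apply Y (vf_apply V f) z
     = (\<Sum>c\<in>UNIV. (vf_apply V (\<lambda>w. real_coef (Y w) c) z - vf_apply Y (\<lambda>w. real_coef (V w) c) z) * vf_apply (coord_vf c) f z)"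
    unfolding ex[OF Y, of V] ex[OF V, of Y] by (simp add: sum_subtractf left_diff_distrib)
  also have "\<dots> = (\<Sum>c\<in>UNIV. real_coef (lie_bracket V Y z) c * vf_apply (coord_vf c) f z)"
  proof -
    have "lie_bracket V Y z = (\<chi> i. vf_apply V (\<lambda>w. Y w $ i) z) - (\<chi> i. vf_apply Y (\<lambda>w. V w $ i) z)"
      by (simp add: lie_bracket_def vec_eq_iff)
    then show ?thesis by (simp add: vf_apply_real_coef[OF V] vf_apply_real_coef[OF Y] real_coef_diff)
  qed
  also have "\<dots> = vf_apply (lie_bracket V Y) f z"
    by (simp add: vf_apply_def[of "lie_bracket V Y"] tangent_apply_real_coef)
  finally show ?thesis .
qed

locale smooth_calculus =
  fixes U0 :: "(complex ^ 'n::finite) set" and p :: "complex ^ 'n"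
  assumes open_U0: "open U0" and p_in_U0: "p \<in> U0"
begin

sublocale crd: bounded_calculus "coord_vf :: 'n \<times> bool \<Rightarrow> 'n cvf" "\<lambda>_. 0" "{1}" "\<lambda>_. U0" p
  by unfold_locales (simp_all add: open_U0 p_in_U0)

definition smooth :: "(complex ^ 'n \<Rightarrow> complex) \<Rightarrow> bool" where
  "smooth f \<longleftrightarrow> (\<forall>n. crd.bdd n (\<lambda>_. f))"

lemma crd_base_bdd: "crd.base_bdd (\<lambda>_. f) \<longleftrightarrow> f differentiable_on U0"
  by auto

lemma crd_scaled_deriv: "crd.bdd n (crd.scaled_deriv i (\<lambda>_. f)) \<longleftrightarrow> crd.bdd n (\<lambda>_. vf_apply (coord_vf i) f)"
  using crd.bdd_cong[of n "crd.scaled_deriv i (\<lambda>_. f)" "\<lambda>_. vf_apply (coord_vf i) f"]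
    crd.bdd_cong[of n "\<lambda>_. vf_apply (coord_vf i) f" "crd.scaled_deriv i (\<lambda>_. f)"]
  by (auto simp: crd.scaled_deriv_def)

text \<open>Replaces inductions over the number of derivatives.\<close>

lemma smooth_coinduct:
  assumes "P f" "\<And>f. P f \<Longrightarrow> f differentiable_on U0" "\<And>f i. P f \<Longrightarrow> P (vf_apply (coord_vf i) f)"
  shows "smooth f"
proof -
  have "crd.bdd n (\<lambda>_. f)" for n
    using assms(1)
  proof (induction n arbitrary: f)
    case 0
    then show ?case using assms(2) by (simp only: crd.bdd.simps crd_base_bdd)
  next
    case (Suc n)
    then show ?case using assms(2)[of f] assms(3)[of f] by (simp only: crd.bdd.simps crd_base_bdd crd_scaled_deriv) blast
  qed
  then show ?thesis by (simp add: smooth_def)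
qed

lemma smooth_coord_deriv: "smooth f \<Longrightarrow> smooth (vf_apply (coord_vf i) f)"
  using crd_scaled_deriv[of _ i f] crd.bdd_scaled_deriv[of _ "\<lambda>_. f" i] by (auto simp: smooth_def simp del: crd.bdd.simps)

lemma smooth_differentiable: "smooth f \<Longrightarrow> z \<in> U0 \<Longrightarrow> f differentiable (at z)"
  using crd.bdd_differentiable[of 0 "\<lambda>_. f" 1 z] by (auto simp: smooth_def simp del: crd.bdd.simps)

lemma smooth_differentiable_on: "smooth f \<Longrightarrow> f differentiable_on U0"
  using smooth_differentiable open_U0 by (simp add: differentiable_on_eq_differentiable_at)

lemma smooth_cong: "smooth f \<Longrightarrow> (\<And>z. z \<in> U0 \<Longrightarrow> f z = g z) \<Longrightarrow> smooth g"
  using crd.bdd_cong[of _ "\<lambda>_. f" "\<lambda>_. g"] by (auto simp: smooth_def)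

lemma smooth_const [simp]: "smooth (\<lambda>_. c)"
  unfolding smooth_def by (intro allI crd.bdd_const[of "\<lambda>_. c" "cmod c"]) simp

lemma smooth_add: "smooth f \<Longrightarrow> smooth g \<Longrightarrow> smooth (\<lambda>z. f z + g z)"
  unfolding smooth_def using crd.bdd_add[of _ "\<lambda>_. f" "\<lambda>_. g"] by blast

lemma smooth_mult: "smooth f \<Longrightarrow> smooth g \<Longrightarrow> smooth (\<lambda>z. f z * g z)"
  unfolding smooth_def using crd.bdd_mult[of _ "\<lambda>_. f" "\<lambda>_. g"] by blast

lemma smooth_diff: "smooth f \<Longrightarrow> smooth g \<Longrightarrow> smooth (\<lambda>z. f z - g z)"
  unfolding smooth_def using crd.bdd_diff[of _ "\<lambda>_. f" "\<lambda>_. g"] by blast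

lemma smooth_sum: "(\<And>i. i \<in> S \<Longrightarrow> smooth (f i)) \<Longrightarrow> smooth (\<lambda>z. \<Sum>i\<in>S. f i z)"
  unfolding smooth_def using crd.bdd_sum[of S _ "\<lambda>i _. f i"] by blast

lemma smooth_cnj: "smooth f \<Longrightarrow> smooth (\<lambda>z. cnj (f z))"
proof -
  have "\<exists>j. (0::real) = 0 \<and> (\<forall>z. coord_vf j z = cnj_tangent (coord_vf i z))" for i :: "'n \<times> bool"
    by (rule exI[of _ i]) (auto simp: coord_vf_def real_tangent_def cnj_tangent_def vec_eq_iff split: sum.splits)
  then show "smooth f \<Longrightarrow> smooth (\<lambda>z. cnj (f z))"
    unfolding smooth_def using crd.bdd_cnj[of _ "\<lambda>_. f"] by blast
qed

lemma smooth_inverse_matrix: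
  fixes M N :: "'k::finite \<Rightarrow> 'k \<Rightarrow> complex ^ 'n \<Rightarrow> complex"
  assumes "\<And>z i l. z \<in> U0 \<Longrightarrow> (\<Sum>j\<in>UNIV. M i j z * N j l z) = (if i = l then 1 else 0)"
    and "\<And>i j. smooth (M i j)"
  shows "smooth (N k l)"
  unfolding smooth_def
proof
  fix r
  show "crd.bdd r (\<lambda>_. N k l)"
    by (rule crd.bdd_inverse_matrix[where M = "\<lambda>i j _. M i j" and N = "\<lambda>i j _. N i j"])
      (use assms in \<open>auto simp: smooth_def simp del: crd.bdd.simps\<close>)
qed

lemma smooth_vf_apply:
  assumes "\<And>i. smooth (\<lambda>z. V z $ i)" "smooth f"
  shows "smooth (vf_apply V f)"
proof -
  have "smooth (\<lambda>z. real_coef (V z) c)" for c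
  proof (cases "snd c")
    case True
    have "smooth (\<lambda>z. (\<i> / 2) * (V z $ Inr (fst c) + (- 1) * V z $ Inl (fst c)))"
      by (intro smooth_mult smooth_add assms smooth_const)
    then show ?thesis using True by (simp only: real_coef_def if_True)
  next
    case False
    have "smooth (\<lambda>z. (1 / 2) * (V z $ Inl (fst c) + V z $ Inr (fst c)))"
      by (intro smooth_mult smooth_add assms smooth_const)
    then show ?thesis using False by (simp only: real_coef_def if_False)
  qed
  then have "smooth (\<lambda>z. \<Sum>c\<in>UNIV. real_coef (V z) c * vf_apply (coord_vf c) f z)"
    by (intro smooth_sum smooth_mult smooth_coord_deriv assms(2))
  then show ?thesis
    by (rule smooth_cong) (simp add: vf_apply_def[of V] tangent_apply_real_coef)
qed

lemma smooth_if_smooth_on: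
  assumes "smooth_on W f" "U0 \<subseteq> W"
  shows "smooth f"
proof (rule smooth_coinduct[where P = "smooth_on W"])
  show "smooth_on W f" by fact
  show "f differentiable_on U0" if "smooth_on W f" for f :: "complex ^ 'n \<Rightarrow> complex"
    using that assms(2) unfolding smooth_on_def by (meson Ck_on.simps(2) differentiable_on_subset)
  show "smooth_on W (vf_apply (coord_vf i) f)" if "smooth_on W f" for f :: "complex ^ 'n \<Rightarrow> complex" and i
  proof -
    have "axis (fst i) (if snd i then \<i> else 1) \<in> (Basis :: (complex ^ 'n) set)"
      by (auto simp: Basis_complex_vec)
    then show ?thesis
      using that unfolding smooth_on_def vf_apply_coord_vf by (metis Ck_on.simps(2))
  qed
qed

lemma smooth_coordinate: "smooth (\<lambda>z. z $ k)"
proof (rule smooth_coinduct[where P = "\<lambda>f. f = (\<lambda>z. z $ k) \<or> (\<exists>c. f = (\<lambda>_. c))"])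
  have d: "((\<lambda>z::complex ^ 'n. z $ k) has_derivative (\<lambda>z. z $ k)) (at z)" for z
    by (rule bounded_linear_imp_has_derivative) (rule bounded_linear_vec_nth)
  show "f differentiable_on U0" if "f = (\<lambda>z. z $ k) \<or> (\<exists>c. f = (\<lambda>_. c))" for f :: "complex ^ 'n \<Rightarrow> complex"
    using that
  proof
    assume "f = (\<lambda>z. z $ k)"
    then show ?thesis using d by (auto simp: differentiable_on_def differentiable_def intro: has_derivative_at_withinI)
  qed auto
  show "vf_apply (coord_vf i) f = (\<lambda>z. z $ k) \<or> (\<exists>c. vf_apply (coord_vf i) f = (\<lambda>_. c))"
    if "f = (\<lambda>z. z $ k) \<or> (\<exists>c. f = (\<lambda>_. c))" for f :: "complex ^ 'n \<Rightarrow> complex" and i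
    using that
  proof
    assume f: "f = (\<lambda>z. z $ k)"
    show ?thesis unfolding f vf_apply_coord_vf using partial_deriv_eq[OF d] by (auto simp: fun_eq_iff)
  next
    assume "\<exists>c. f = (\<lambda>_. c)"
    then have "vf_apply (coord_vf i) f = (\<lambda>_. 0)" by auto
    then show ?thesis by blast
  qed
qed simp

end

section \<open>Weighted orders of vanishing\<close>

text \<open>The fields \<open>Z s\<close> have weights \<open>e s\<close>, and the calculus of bounded families is applied to the fields
  \<open>\<delta> powr e s * Z s\<close>.\<close>

locale weighted_calculus =
  smooth_calculus U0 p + bounded_calculus Z e "{0<..1}" U p
  for U0 :: "(complex ^ 'n::finite) set" and p and Z :: "'s::finite \<Rightarrow> 'n cvf" and e U +
  assumes U_subset: "\<delta> \<in> {0<..1} \<Longrightarrow> U \<delta> \<subseteq> U0"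
    and e_ge_1: "e s \<ge> 1"
    and Z_smooth: "smooth (\<lambda>z. Z s z $ i)"
begin

text \<open>The weighted order of \<open>f\<close> at \<open>p\<close> is at least \<open>s\<close>, tested by at most \<open>r\<close> derivatives. Stating it through
  bounded families rather than through vanishing derivatives makes additivity of orders under
  products immediate; \<open>ord_ge_0_iff\<close> and \<open>ord_ge_Suc_iff\<close> translate it into vanishing.\<close>

definition ord_ge :: "nat \<Rightarrow> real \<Rightarrow> (complex ^ 'n \<Rightarrow> complex) \<Rightarrow> bool" where
  "ord_ge r s f \<longleftrightarrow> bdd r (\<lambda>\<delta> z. of_real (\<delta> powr (- s)) * f z)"

lemma smooth_Z: "smooth f \<Longrightarrow> smooth (vf_apply (Z a) f)"
  by (rule smooth_vf_apply[OF Z_smooth])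

lemma ord_ge_cong: "ord_ge r s f \<Longrightarrow> (\<And>z. z \<in> U0 \<Longrightarrow> f z = g z) \<Longrightarrow> ord_ge r s g"
  unfolding ord_ge_def by (erule bdd_cong) (use U_subset in auto)

lemma ord_ge_add: "ord_ge r s f \<Longrightarrow> ord_ge r s g \<Longrightarrow> ord_ge r s (\<lambda>z. f z + g z)"
  unfolding ord_ge_def by (drule bdd_add, assumption) (simp add: distrib_left)

lemma ord_ge_mult:
  assumes "ord_ge r s f" "ord_ge r t g"
  shows "ord_ge r (s + t) (\<lambda>z. f z * g z)"
  unfolding ord_ge_def
  by (rule bdd_cong[OF bdd_mult[OF assms[unfolded ord_ge_def]]]) (simp add: powr_add powr_diff powr_minus field_simps)

lemma ord_ge_const: "ord_ge r 0 (\<lambda>_. c)"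
  unfolding ord_ge_def by (rule bdd_cong[OF bdd_const[of "\<lambda>_. c" "cmod c"]]) auto

lemma ord_ge_zero: "ord_ge r s (\<lambda>_. 0)"
  unfolding ord_ge_def by (rule bdd_cong[OF bdd_const[of "\<lambda>_. 0" 0]]) auto

lemma ord_ge_sum: "(\<And>i. i \<in> S \<Longrightarrow> ord_ge r s (f i)) \<Longrightarrow> ord_ge r s (\<lambda>z. \<Sum>i\<in>S. f i z)"
  by (induction S rule: infinite_finite_induct) (auto intro!: ord_ge_add ord_ge_zero)

lemma ord_ge_less: "ord_ge r s f \<Longrightarrow> r' \<le> r \<Longrightarrow> ord_ge r' s f"
  unfolding ord_ge_def by (rule bdd_mono)

lemma scaled_deriv_powr:
  assumes "smooth f" "\<delta> \<in> {0<..1}" "z \<in> U \<delta>"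
  shows "scaled_deriv a (\<lambda>\<delta> z. of_real (\<delta> powr (- s)) * f z) \<delta> z = of_real (\<delta> powr (- (s - e a))) * vf_apply (Z a) f z"
proof -
  have "f differentiable (at z)" using assms U_subset smooth_differentiable by blast
  then have "vf_apply (Z a) (\<lambda>z. of_real (\<delta> powr (- s)) * f z) z = of_real (\<delta> powr (- s)) * vf_apply (Z a) f z"
    by (rule vf_apply_cmult)
  moreover have "\<delta> powr (- (s - e a)) = \<delta> powr e a * \<delta> powr (- s)"
    by (simp add: powr_add[symmetric] algebra_simps)
  ultimately show ?thesis by (simp add: scaled_deriv_def)
qed

lemma ord_ge_Suc_iff:
  assumes f: "smooth f"
  shows "ord_ge (Suc r) s f \<longleftrightarrow> ord_ge 0 s f \<and> (\<forall>a. ord_ge r (s - e a) (vf_apply (Z a) f))"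
proof -
  have "bdd r (scaled_deriv a (\<lambda>\<delta> z. of_real (\<delta> powr (- s)) * f z)) \<longleftrightarrow> ord_ge r (s - e a) (vf_apply (Z a) f)" for a
    unfolding ord_ge_def using scaled_deriv_powr[OF f]
    by (auto intro: bdd_cong[of r "scaled_deriv a (\<lambda>\<delta> z. of_real (\<delta> powr (- s)) * f z)"]
        bdd_cong[of r "\<lambda>\<delta> z. of_real (\<delta> powr (- (s - e a))) * vf_apply (Z a) f z"])
  then show ?thesis unfolding ord_ge_def by (simp del: base_bdd_def)
qed

lemma ord_ge_Z: "smooth f \<Longrightarrow> ord_ge (Suc r) s f \<Longrightarrow> ord_ge r (s - e a) (vf_apply (Z a) f)"
  by (simp add: ord_ge_Suc_iff)

text \<open>Boundedness of \<open>\<delta> powr (- s) * f p\<close> as \<open>\<delta>\<close> tends to \<open>0\<close>.\<close>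

lemma ord_ge_0_iff:
  assumes f: "smooth f"
  shows "ord_ge 0 s f \<longleftrightarrow> (s > 0 \<longrightarrow> f p = 0)"
proof
  assume "ord_ge 0 s f"
  then obtain C where C': "\<forall>\<delta>\<in>{0<..1}. cmod (of_real (\<delta> powr (- s)) * f p) \<le> C"
    unfolding ord_ge_def using bdd_bound by blast
  have C: "\<delta> powr (- s) * cmod (f p) \<le> C" if "0 < \<delta>" "\<delta> \<le> 1" for \<delta>
    using bspec[OF C', of \<delta>] that by (simp add: norm_mult)
  show "s > 0 \<longrightarrow> f p = 0"
  proof (intro impI, rule ccontr)
    assume s: "s > 0" and ne: "f p \<noteq> 0"
    have C0: "C > 0" using C[of 1] ne by (simp add: less_le_trans[of 0 "cmod (f p)"])
    \<comment> \<open>so small that \<open>C * \<delta> powr s\<close> is at most half of \<open>cmod (f p)\<close>\<close>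
    define \<delta> where "\<delta> = min 1 ((cmod (f p) / (2 * C)) powr (1 / s))"
    have d: "0 < \<delta>" "\<delta> \<le> 1" using ne C0 by (auto simp: \<delta>_def)
    have "\<delta> powr s \<le> ((cmod (f p) / (2 * C)) powr (1 / s)) powr s"
      using d s by (intro powr_mono2) (auto simp: \<delta>_def)
    also have "\<dots> = cmod (f p) / (2 * C)" using s ne C0 by (simp add: powr_powr)
    finally have "C * \<delta> powr s \<le> cmod (f p) / 2" using C0 by (simp add: field_simps)
    moreover have "cmod (f p) \<le> C * \<delta> powr s"
      using C[OF d] d by (simp add: powr_minus field_simps)
    ultimately show False using ne by (smt (verit) field_sum_of_halves zero_less_norm_iff)
  qed
next
  assume *: "s > 0 \<longrightarrow> f p = 0"
  show "ord_ge 0 s f" unfolding ord_ge_def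
  proof (rule bdd_0I)
    show "(\<lambda>z. of_real (\<delta> powr (- s)) * f z) differentiable (at z)" if "\<delta> \<in> {0<..1}" "z \<in> U \<delta>" for \<delta> z
      using that U_subset f by (auto intro!: differentiable_mult smooth_differentiable)
    show "cmod (of_real (\<delta> powr (- s)) * f p) \<le> cmod (f p)" if "\<delta> \<in> {0<..1}" for \<delta>
      using * that by (cases "s > 0") (auto simp: norm_mult intro!: mult_left_le_one_le powr_le1)
  qed
qed

lemma ord_ge_cnj:
  assumes "\<And>i. \<exists>j. e j = e i \<and> (\<forall>z. Z j z = cnj_tangent (Z i z))" and "ord_ge r s f"
  shows "ord_ge r s (\<lambda>z. cnj (f z))"
  using bdd_cnj[OF assms(1) assms(2)[unfolded ord_ge_def]] by (simp add: ord_ge_def)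

definition weight :: "'s list \<Rightarrow> real" where
  "weight w = sum_list (map e w)"

lemma weight_simps [simp]: "weight [] = 0" "weight (a # w) = e a + weight w" "weight (v @ w) = weight v + weight w"
  by (simp_all add: weight_def)

lemma weight_mset: "mset v = mset w \<Longrightarrow> weight v = weight w"
  unfolding weight_def by (metis mset_map sum_mset_sum_list)

lemma weight_ge_length: "weight w \<ge> real (length w)"
proof (induction w)
  case (Cons a w)
  then show ?case using e_ge_1[of a] by simp
qed simp

text \<open>The first letter of a word acts first, in contrast to \<open>iter_apply\<close>: recursion on the list then peels off
  the derivative that is applied directly to \<open>f\<close>.\<close>

definition word :: "'s list \<Rightarrow> (complex ^ 'n \<Rightarrow> complex) \<Rightarrow> complex ^ 'n \<Rightarrow> complex" where
  "word w f = fold (\<lambda>a. vf_apply (Z a)) w f"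

lemma word_simps [simp]: "word [] f = f" "word (a # w) f = word w (vf_apply (Z a) f)" "word (v @ w) f = word w (word v f)"
  by (simp_all add: word_def)

lemma smooth_word: "smooth f \<Longrightarrow> smooth (word w f)"
  by (induction w arbitrary: f) (auto intro: smooth_Z)

lemma vf_apply_Z_cong: "smooth f \<Longrightarrow> (\<And>z. z \<in> U0 \<Longrightarrow> f z = g z) \<Longrightarrow> z \<in> U0 \<Longrightarrow> vf_apply (Z a) f z = vf_apply (Z a) g z"
  by (rule vf_apply_cong_open[OF smooth_differentiable open_U0]) auto

lemma word_cong:
  "smooth f \<Longrightarrow> (\<And>z. z \<in> U0 \<Longrightarrow> f z = g z) \<Longrightarrow> z \<in> U0 \<Longrightarrow> word w f z = word w g z"
proof (induction w arbitrary: f g)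
  case (Cons a w)
  show ?case unfolding word_simps
    by (rule Cons.IH[OF smooth_Z[OF Cons.prems(1)] vf_apply_Z_cong[OF Cons.prems(1,2)] Cons.prems(3)])
qed simp

lemma word_add: "smooth f \<Longrightarrow> smooth g \<Longrightarrow> z \<in> U0 \<Longrightarrow> word w (\<lambda>z. f z + g z) z = word w f z + word w g z"
proof (induction w arbitrary: f g)
  case (Cons a w)
  have "word w (vf_apply (Z a) (\<lambda>z. f z + g z)) z = word w (\<lambda>z. vf_apply (Z a) f z + vf_apply (Z a) g z) z"
    by (rule word_cong) (use Cons.prems in \<open>auto intro!: smooth_Z smooth_add vf_apply_add smooth_differentiable\<close>)
  then show ?case using Cons by (simp add: smooth_Z)
qed simp

lemma word_zero: "z \<in> U0 \<Longrightarrow> word w (\<lambda>_. 0) z = 0"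
proof (induction w)
  case (Cons a w)
  have "vf_apply (Z a) (\<lambda>_. 0) = (\<lambda>_. 0)" by (rule ext) simp
  then show ?case using Cons by simp
qed simp

lemma word_cmult: "smooth f \<Longrightarrow> z \<in> U0 \<Longrightarrow> word w (\<lambda>z. c * f z) z = c * word w f z"
proof (induction w arbitrary: f)
  case (Cons a w)
  have "word w (vf_apply (Z a) (\<lambda>z. c * f z)) z = word w (\<lambda>z. c * vf_apply (Z a) f z) z"
    by (rule word_cong) (use Cons.prems in \<open>auto intro!: smooth_Z smooth_mult vf_apply_cmult smooth_differentiable\<close>)
  then show ?case using Cons by (simp add: smooth_Z)
qed simp

lemma word_sum:
  "(\<And>i. i \<in> S \<Longrightarrow> smooth (f i)) \<Longrightarrow> z \<in> U0 \<Longrightarrow> word w (\<lambda>z. \<Sum>i\<in>S. f i z) z = (\<Sum>i\<in>S. word w (f i) z)"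
  by (induction S rule: infinite_finite_induct) (auto simp: word_zero word_add smooth_sum)

lemma word_diff: "smooth f \<Longrightarrow> smooth g \<Longrightarrow> z \<in> U0 \<Longrightarrow> word w (\<lambda>z. f z - g z) z = word w f z - word w g z"
  using word_add[of f "\<lambda>z. (-1) * g z" z w] word_cmult[of g z w "-1"] smooth_mult[OF smooth_const[of "-1"], of g] by simp

lemma word_Cons_mult:
  assumes "smooth f" "smooth g" "z \<in> U0"
  shows "word (a # w) (\<lambda>z. f z * g z) z = word w (\<lambda>z. vf_apply (Z a) f z * g z) z + word w (\<lambda>z. f z * vf_apply (Z a) g z) z"
proof -
  have "word w (vf_apply (Z a) (\<lambda>z. f z * g z)) z = word w (\<lambda>z. vf_apply (Z a) f z * g z + f z * vf_apply (Z a) g z) z"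
    by (rule word_cong) (use assms in \<open>auto intro!: smooth_Z smooth_mult vf_apply_mult smooth_differentiable\<close>)
  then show ?thesis using assms by (simp add: word_add smooth_mult smooth_Z)
qed

lemma ord_ge_word: "smooth f \<Longrightarrow> ord_ge (length w + r) s f \<Longrightarrow> ord_ge r (s - weight w) (word w f)"
proof (induction w arbitrary: f s)
  case (Cons a w)
  have "ord_ge (length w + r) (s - e a) (vf_apply (Z a) f)"
    using Cons.prems by (simp add: ord_ge_Z)
  from Cons.IH[OF smooth_Z[OF Cons.prems(1)] this] show ?case by (simp add: algebra_simps)
qed simp

text \<open>Together with \<open>ord_ge_if_words_vanish\<close>: the order is the smallest weight of a word of length at most
  \<open>r\<close> that does not annihilate \<open>f\<close> at \<open>p\<close>.\<close>

lemma ord_ge_word_vanish: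
  assumes "smooth f" "ord_ge r s f" "length w \<le> r" "weight w < s"
  shows "word w f p = 0"
proof -
  have "ord_ge 0 (s - weight w) (word w f)"
    using ord_ge_word[OF assms(1), of w 0] ord_ge_less[OF assms(2,3)] by simp
  then show ?thesis using assms(4) smooth_word[OF assms(1)] by (simp add: ord_ge_0_iff)
qed

lemma ord_ge_if_words_vanish:
  "smooth f \<Longrightarrow> (\<And>w. length w \<le> r \<Longrightarrow> weight w < s \<Longrightarrow> word w f p = 0) \<Longrightarrow> ord_ge r s f"
proof (induction r arbitrary: f s)
  case 0
  then show ?case using "0.prems"(2)[of "[]"] by (simp add: ord_ge_0_iff)
next
  case (Suc r)
  have "ord_ge r (s - e a) (vf_apply (Z a) f)" for a
  proof (rule Suc.IH[OF smooth_Z[OF Suc.prems(1)]])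
    show "word w (vf_apply (Z a) f) p = 0" if "length w \<le> r" "weight w < s - e a" for w
      using Suc.prems(2)[of "a # w"] that by simp
  qed
  then show ?case using Suc.prems(1) Suc.prems(2)[of "[]"] by (simp add: ord_ge_Suc_iff ord_ge_0_iff)
qed

text \<open>If \<open>g\<close> vanishes to order \<open>r\<close>, counted without weights, then all \<open>r\<close> letters have to fall on \<open>g\<close>.\<close>

lemma word_mult_vanishing:
  "smooth h \<Longrightarrow> smooth g \<Longrightarrow> (\<And>w. length w < r \<Longrightarrow> word w g p = 0) \<Longrightarrow> length w \<le> r \<Longrightarrow>
    word w (\<lambda>z. h z * g z) p = h p * word w g p"
proof (induction w arbitrary: h g r)
  case (Cons a w)
  have "word w (\<lambda>z. vf_apply (Z a) h z * g z) p = vf_apply (Z a) h p * word w g p"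
    using Cons.prems by (intro Cons.IH[where r = r]) (auto intro: smooth_Z)
  also have "\<dots> = 0" using Cons.prems by simp
  finally have 1: "word w (\<lambda>z. vf_apply (Z a) h z * g z) p = 0" .
  have "word w (\<lambda>z. h z * vf_apply (Z a) g z) p = h p * word w (vf_apply (Z a) g) p"
  proof (rule Cons.IH[where r = "r - 1"])
    show "word w (vf_apply (Z a) g) p = 0" if "length w < r - 1" for w
      using Cons.prems(3)[of "a # w"] that by simp
  qed (use Cons.prems in \<open>auto intro: smooth_Z\<close>)
  then show ?case using 1 word_Cons_mult[of h g p a w] Cons.prems p_in_U0 by simp
qed simp

text \<open>If \<open>u\<close> vanishes at \<open>p\<close> and \<open>g\<close> vanishes to order \<open>r\<close>, exactly one of the \<open>r + 1\<close> letters has to fall on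
  \<open>u\<close>.\<close>

lemma word_vanishing_mult:
  "smooth u \<Longrightarrow> u p = 0 \<Longrightarrow> smooth g \<Longrightarrow> (\<And>w. length w < r \<Longrightarrow> word w g p = 0) \<Longrightarrow> length w \<le> Suc r \<Longrightarrow>
    word w (\<lambda>z. u z * g z) p
      = (\<Sum>j<length w. vf_apply (Z (w ! j)) u p * word (take j w @ drop (Suc j) w) g p)"
proof (induction w arbitrary: g r)
  case (Cons a w)
  have 1: "word w (\<lambda>z. vf_apply (Z a) u z * g z) p = vf_apply (Z a) u p * word w g p"
    using Cons.prems by (intro word_mult_vanishing[where r = r]) (auto intro: smooth_Z)
  have 2: "word w (\<lambda>z. u z * vf_apply (Z a) g z) p
      = (\<Sum>j<length w. vf_apply (Z (w ! j)) u p * word (take j w @ drop (Suc j) w) (vf_apply (Z a) g) p)"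
  proof (rule Cons.IH[where r = "r - 1"])
    show "word w (vf_apply (Z a) g) p = 0" if "length w < r - 1" for w
      using Cons.prems(4)[of "a # w"] that by simp
  qed (use Cons.prems in \<open>auto intro: smooth_Z\<close>)
  have "word (a # w) (\<lambda>z. u z * g z) p = vf_apply (Z a) u p * word w g p
      + (\<Sum>j<length w. vf_apply (Z (w ! j)) u p * word (take j w @ drop (Suc j) w) (vf_apply (Z a) g) p)"
    using Cons.prems p_in_U0 unfolding 1[symmetric] 2[symmetric] by (intro word_Cons_mult) auto
  then show ?case by (simp add: sum.lessThan_Suc_shift del: sum.lessThan_Suc)
qed simp

lemma mset_insert_nth: "j < length w \<Longrightarrow> mset (w ! j # take j w @ drop (Suc j) w) = mset w"
  by (metis id_take_nth_drop mset_append mset.simps(2) union_mset_add_mset_right)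

end

text \<open>Adjacent transpositions generate all permutations.\<close>

lemma symmetric_list_function:
  assumes "\<And>v a b w. h (v @ a # b # w) = h (v @ b # a # w)"
  shows "mset v = mset w \<Longrightarrow> h v = h w"
  using assms
proof (induction v arbitrary: w h)
  case Nil
  then show ?case by simp
next
  case (Cons x v)
  have "x \<in> set w" using Cons.prems(1) by (metis list.set_intros(1) set_mset_mset)
  then obtain w1 w2 where w: "w = w1 @ x # w2" by (meson split_list)
  have front: "h (u @ w1 @ x # w2) = h (u @ x # w1 @ w2)" for u
  proof (induction w1 arbitrary: u)
    case (Cons y w1)
    have "h (u @ (y # w1) @ x # w2) = h ((u @ [y]) @ w1 @ x # w2)" by simp
    also have "\<dots> = h ((u @ [y]) @ x # w1 @ w2)" by (rule Cons)
    also have "\<dots> = h (u @ x # (y # w1) @ w2)" using Cons.prems \<open>\<And>v a b w. h (v @ a # b # w) = h (v @ b # a # w)\<close> by simp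
    finally show ?case .
  qed simp
  have "h (x # v) = h (x # (w1 @ w2))"
  proof (rule Cons.IH[where h = "\<lambda>v. h (x # v)"])
    show "mset v = mset (w1 @ w2)" using Cons.prems(1) w by simp
    show "h (x # v @ a # b # w) = h (x # v @ b # a # w)" for v a b w
      using Cons.prems(2)[of "x # v"] by simp
  qed
  then show ?case using front[of "[]"] w by simp
qed

text \<open>The frame is graded: the function that multiplies \<open>Z k\<close> in the bracket of \<open>Z a\<close> and \<open>Z b\<close> has the order
  that is missing when the letters \<open>a\<close> and \<open>b\<close> of a word are replaced by \<open>k\<close>.\<close>

locale graded_frame = weighted_calculus U0 p Z e U
  for U0 :: "(complex ^ 'n::finite) set" and p and Z :: "'s::finite \<Rightarrow> 'n cvf" and e U +
  fixes g :: "'s \<Rightarrow> 's \<Rightarrow> 's \<Rightarrow> complex ^ 'n \<Rightarrow> complex"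
  assumes g_smooth: "smooth (g a b k)"
    and bracket: "z \<in> U0 \<Longrightarrow> lie_bracket (Z a) (Z b) z = (\<Sum>k\<in>UNIV. g a b k z *s Z k z)"
    and g_ord_ge: "ord_ge r (e k - e a - e b) (g a b k)"
begin

lemma Z_commute:
  assumes f: "smooth f" and z: "z \<in> U0"
  shows "vf_apply (Z a) (vf_apply (Z b) f) z - vf_apply (Z b) (vf_apply (Z a) f) z = (\<Sum>k\<in>UNIV. g a b k z * vf_apply (Z k) f z)"
proof -
  have "vf_apply (Z a) (vf_apply (Z b) f) z - vf_apply (Z b) (vf_apply (Z a) f) z = vf_apply (lie_bracket (Z a) (Z b)) f z"
    by (rule vf_apply_commutator[OF open_U0 z])
      (auto intro: smooth_differentiable_on smooth_coord_deriv f smooth_differentiable[OF Z_smooth z])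
  then show ?thesis
    by (simp add: vf_apply_def[of "lie_bracket _ _"] bracket[OF z] tangent_apply_sum_left tangent_apply_scale_left)
      (simp add: vf_apply_def)
qed

text \<open>The difference of the two words contains the commutator of \<open>a\<close> and \<open>b\<close>. Expanding it in the frame
  replaces the two letters by one letter \<open>k\<close>, and the order of the structure function makes up for the
  difference of the weights. The shortened word still has to fall on a function of order \<open>E\<close>.\<close>

lemma word_swap:
  assumes f: "smooth f" and ord_ge: "ord_ge r E f" and len: "length v + length w + 2 = Suc r"
    and weight: "weight (v @ a # b # w) < E"
  shows "word (v @ a # b # w) f p = word (v @ b # a # w) f p"
proof -
  define h where "h = word v f"
  have h: "smooth h" unfolding h_def by (rule smooth_word[OF f])
  have "ord_ge (length v + Suc (length w)) E f" by (rule ord_ge_less[OF ord_ge]) (use len in simp)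
  then have odh: "ord_ge (Suc (length w)) (E - weight v) h" unfolding h_def using ord_ge_word[OF f] by blast
  let ?c = "\<lambda>z. \<Sum>k\<in>UNIV. g b a k z * vf_apply (Z k) h z"
  have "ord_ge (length w) ((e k - e b - e a) + (E - weight v - e k)) (\<lambda>z. g b a k z * vf_apply (Z k) h z)" for k
    by (rule ord_ge_mult[OF g_ord_ge ord_ge_Z[OF h odh]])
  then have "ord_ge (length w) (E - weight v - e a - e b) ?c"
    by (intro ord_ge_sum) (simp add: algebra_simps)
  then have 0: "word w ?c p = 0"
    by (rule ord_ge_word_vanish[rotated]) (use weight in \<open>auto intro!: smooth_sum smooth_mult g_smooth smooth_Z h\<close>)
  have "word (v @ a # b # w) f p - word (v @ b # a # w) f p = word w (\<lambda>z. vf_apply (Z b) (vf_apply (Z a) h) z - vf_apply (Z a) (vf_apply (Z b) h) z) p"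
    by (simp add: h_def word_diff smooth_Z smooth_word f p_in_U0)
  also have "\<dots> = word w ?c p"
    by (rule word_cong) (auto intro!: smooth_diff smooth_Z h p_in_U0 Z_commute)
  finally show ?thesis using 0 by simp
qed

text \<open>For words of length \<open>r + 1\<close> every exchange of neighbours falls under the previous lemma; setting the
  function to zero on all other words turns it into a symmetric function on all lists.\<close>

lemma word_permute:
  assumes f: "smooth f" and ord_ge: "ord_ge r E f" and len: "length v = Suc r" and weight: "weight v < E" and mset: "mset v = mset w"
  shows "word v f p = word w f p"
proof -
  define h where "h = (\<lambda>v. if length v = Suc r \<and> weight v < E then word v f p else 0)"
  have "h (v @ a # b # w) = h (v @ b # a # w)" for v a b w
    using word_swap[OF f ord_ge, of v w a b] by (auto simp: h_def algebra_simps)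
  then have "h v = h w" using mset by (rule symmetric_list_function)
  moreover have "weight w < E" "length w = Suc r" using weight_mset[OF mset] mset_eq_length[OF mset] weight len by auto
  ultimately show ?thesis using weight len by (simp add: h_def)
qed

text \<open>A symmetric array \<open>T\<close> with indices in the range of \<open>\<beta>\<close> is the top-order symbol of a homogeneous
  polynomial in the functions \<open>u i\<close>. By Euler's formula this polynomial is \<open>1 / r\<close> times the sum over
  \<open>i\<close> of \<open>u i\<close> times the polynomial for the array \<open>v \<mapsto> T (\<beta> i # v)\<close>, which gives an induction on the
  degree without multi-indices or factorials. The predicate \<open>H\<close> stands for an algebra of functions
  that contains the \<open>u i\<close>.\<close>

lemma exists_symbol:
  fixes u :: "'b::finite \<Rightarrow> complex ^ 'n \<Rightarrow> complex" and \<beta> :: "'b \<Rightarrow> 's"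
  assumes u: "\<And>i. smooth (u i)" "\<And>i. u i p = 0"
    and \<beta>: "inj \<beta>" "\<And>i a. vf_apply (Z a) (u i) p = (if a = \<beta> i then 1 else 0)"
    and H: "\<And>i. H (u i)" "\<And>c. H (\<lambda>_. c)" "\<And>f g. H f \<Longrightarrow> H g \<Longrightarrow> H (\<lambda>z. f z * g z)"
      "\<And>f g. H f \<Longrightarrow> H g \<Longrightarrow> H (\<lambda>z. f z + g z)" "\<And>f. H f \<Longrightarrow> smooth f"
  shows "(\<And>v w. length v = r \<Longrightarrow> mset v = mset w \<Longrightarrow> T v = T w) \<Longrightarrow>
      (\<And>v. length v = r \<Longrightarrow> \<not> set v \<subseteq> range \<beta> \<Longrightarrow> T v = 0) \<Longrightarrow>
    \<exists>q. H q \<and> (\<forall>v. length v < r \<longrightarrow> word v q p = 0) \<and> (\<forall>v. length v = r \<longrightarrow> word v q p = T v)"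
proof (induction r arbitrary: T)
  case 0
  show ?case by (rule exI[of _ "\<lambda>_. T []"]) (simp add: H)
next
  case (Suc r)
  have "\<exists>q. H q \<and> (\<forall>v. length v < r \<longrightarrow> word v q p = 0) \<and> (\<forall>v. length v = r \<longrightarrow> word v q p = T (\<beta> i # v))" for i
  proof (rule Suc.IH)
    show "T (\<beta> i # v) = T (\<beta> i # w)" if "length v = r" "mset v = mset w" for v w
      by (rule Suc.prems(1)) (use that in auto)
    show "T (\<beta> i # v) = 0" if "length v = r" "\<not> set v \<subseteq> range \<beta>" for v
      by (rule Suc.prems(2)) (use that in auto)
  qed
  then obtain q where q: "\<And>i. H (q i)" "\<And>i v. length v < r \<Longrightarrow> word v (q i) p = 0"
    "\<And>i v. length v = r \<Longrightarrow> word v (q i) p = T (\<beta> i # v)" by metis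
  define Q where "Q = (\<lambda>z. (1 / of_nat (Suc r)) * (\<Sum>i\<in>UNIV. u i z * q i z))"
  have Hsum: "H (\<lambda>z. \<Sum>i\<in>S. u i z * q i z)" for S
    by (induction S rule: infinite_finite_induct) (auto intro!: H q)
  have smq: "smooth (\<lambda>z. u i z * q i z)" for i by (intro H(5) H(3) H(1) q(1))
  have wdQ: "word v Q p = (1 / of_nat (Suc r)) * (\<Sum>i\<in>UNIV. word v (\<lambda>z. u i z * q i z) p)" for v
    unfolding Q_def by (simp only: word_cmult[OF smooth_sum[OF smq] p_in_U0] word_sum[OF smq p_in_U0])
  have leib: "word v (\<lambda>z. u i z * q i z) p
      = (\<Sum>j<length v. vf_apply (Z (v ! j)) (u i) p * word (take j v @ drop (Suc j) v) (q i) p)" if "length v \<le> Suc r" for v i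
    by (rule word_vanishing_mult[where r = r]) (use u q H(5) that in auto)
  have "word v Q p = 0" if v: "length v < Suc r" for v
  proof -
    have "word (take j v @ drop (Suc j) v) (q i) p = 0" if "j < length v" for i j
      by (rule q(2)) (use v that in auto)
    then have "word v (\<lambda>z. u i z * q i z) p = 0" for i
      using v by (simp only: leib less_imp_le) (auto intro!: sum.neutral simp del: word_simps)
    then show ?thesis by (simp add: wdQ)
  qed
  moreover have "word v Q p = T v" if v: "length v = Suc r" for v
  proof -
    have letter: "(\<Sum>i\<in>UNIV. vf_apply (Z (v ! j)) (u i) p * word (take j v @ drop (Suc j) v) (q i) p) = T v" if j: "j < Suc r" for j
    proof -
      let ?v = "take j v @ drop (Suc j) v"
      have len: "length ?v = r" using v j by simp
      have m: "mset (v ! j # ?v) = mset v" using mset_insert_nth[of j v] v j by simp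
      have "(\<Sum>i\<in>UNIV. vf_apply (Z (v ! j)) (u i) p * word ?v (q i) p) = (\<Sum>i\<in>UNIV. if v ! j = \<beta> i then T (v ! j # ?v) else 0)"
        by (rule sum.cong) (auto simp: \<beta> q(3)[OF len] simp del: word_simps)
      also have "\<dots> = T v"
      proof (cases "v ! j \<in> range \<beta>")
        case True
        then obtain i where i: "v ! j = \<beta> i" by auto
        have "(\<Sum>i\<in>UNIV. if v ! j = \<beta> i then T (v ! j # ?v) else 0) = (\<Sum>i'\<in>UNIV. if i' = i then T (v ! j # ?v) else 0)"
          by (rule sum.cong) (auto simp: i inj_eq[OF \<beta>(1)])
        then show ?thesis using Suc.prems(1)[OF v m[symmetric]] by simp
      next
        case False
        then have "T v = 0" using v j by (intro Suc.prems(2)) (auto simp: in_set_conv_nth subset_iff)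
        then show ?thesis using False by (auto intro!: sum.neutral)
      qed
      finally show ?thesis .
    qed
    have "(\<Sum>i\<in>UNIV. word v (\<lambda>z. u i z * q i z) p)
        = (\<Sum>j<Suc r. \<Sum>i\<in>UNIV. vf_apply (Z (v ! j)) (u i) p * word (take j v @ drop (Suc j) v) (q i) p)"
      using v by (subst sum.swap) (simp add: leib)
    also have "\<dots> = (\<Sum>j<Suc r. T v)" using letter by (intro sum.cong) auto
    finally show ?thesis unfolding wdQ by (simp del: of_nat_Suc)
  qed
  moreover have "H Q" unfolding Q_def by (intro H(3) H(2) Hsum)
  ultimately show ?case by blast
qed

text \<open>Raising the order step by step. Once the words of length at most \<open>r\<close> and weight less than \<open>E\<close>
  annihilate \<open>f\<close> at \<open>p\<close>, the values of the words of length \<open>r + 1\<close> and weight less than \<open>E\<close> form a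
  symmetric array. It is supported on the range of \<open>\<beta>\<close>, because any other letter can be permuted to
  act first and kills \<open>f\<close>. Subtracting the polynomial with this symbol does not affect shorter
  words. Since all weights are at least \<open>1\<close>, words of length greater than \<open>E\<close> have weight greater
  than \<open>E\<close>, so finitely many corrections suffice.\<close>

lemma exists_graded:
  fixes u :: "'b::finite \<Rightarrow> complex ^ 'n \<Rightarrow> complex" and \<beta> :: "'b \<Rightarrow> 's"
  assumes u: "\<And>i. smooth (u i)" "\<And>i. u i p = 0"
    and \<beta>: "inj \<beta>" "\<And>i a. vf_apply (Z a) (u i) p = (if a = \<beta> i then 1 else 0)"
    and H: "\<And>i. H (u i)" "\<And>c. H (\<lambda>_. c)" "\<And>f g. H f \<Longrightarrow> H g \<Longrightarrow> H (\<lambda>z. f z * g z)"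
      "\<And>f g. H f \<Longrightarrow> H g \<Longrightarrow> H (\<lambda>z. f z + g z)" "\<And>f. H f \<Longrightarrow> smooth f"
      "\<And>f a z. H f \<Longrightarrow> a \<notin> range \<beta> \<Longrightarrow> z \<in> U0 \<Longrightarrow> vf_apply (Z a) f z = 0"
  obtains f where "H f" "f p = 0" "\<And>a. vf_apply (Z a) f p = (if a = \<beta> i then 1 else 0)" "\<And>r. ord_ge r (e (\<beta> i)) f"
proof -
  let ?E = "e (\<beta> i)"
  let ?P = "\<lambda>r f. H f \<and> f p = 0 \<and> (\<forall>a. vf_apply (Z a) f p = (if a = \<beta> i then 1 else 0))
    \<and> (\<forall>w. length w \<le> r \<longrightarrow> weight w < ?E \<longrightarrow> word w f p = 0)"
  have ex: "\<exists>f. ?P (Suc r) f" for r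
  proof (induction r)
    case 0
    have "word w (u i) p = 0" if "length w \<le> Suc 0" "weight w < ?E" for w
      using that u(2) \<beta>(2) by (cases w) auto
    then show ?case using H(1) u(2) \<beta>(2) by blast
  next
    case (Suc r)
    then obtain f where f: "H f" "f p = 0" "\<And>a. vf_apply (Z a) f p = (if a = \<beta> i then 1 else 0)"
      "\<And>w. length w \<le> Suc r \<Longrightarrow> weight w < ?E \<Longrightarrow> word w f p = 0" by blast
    have smf: "smooth f" by (rule H(5)[OF f(1)])
    have odf: "ord_ge (Suc r) ?E f" by (rule ord_ge_if_words_vanish[OF smf f(4)])
    define T where "T = (\<lambda>v. if weight v < ?E then word v f p else 0)"
    have "\<exists>q. H q \<and> (\<forall>v. length v < Suc (Suc r) \<longrightarrow> word v q p = 0) \<and> (\<forall>v. length v = Suc (Suc r) \<longrightarrow> word v q p = T v)"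
    proof (rule exists_symbol[OF u \<beta> H(1-5)])
      show "T v = T w" if "length v = Suc (Suc r)" "mset v = mset w" for v w
        using word_permute[OF smf odf that(1) _ that(2)] weight_mset[OF that(2)] by (simp add: T_def)
      show "T v = 0" if v: "length v = Suc (Suc r)" "\<not> set v \<subseteq> range \<beta>" for v
      proof (cases "weight v < ?E")
        case True
        obtain a where a: "a \<in> set v" "a \<notin> range \<beta>" using v by auto
        then obtain v1 v2 where v12: "v = v1 @ a # v2" by (meson split_list)
        have "word v f p = word (a # v1 @ v2) f p"
          by (rule word_permute[OF smf odf v(1) True]) (simp add: v12)
        also have "\<dots> = word (v1 @ v2) (\<lambda>_. 0) p"
          unfolding word_simps(2)
          by (rule word_cong[OF smooth_Z[OF smf]]) (use H(6)[OF f(1) a(2)] p_in_U0 in auto)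
        also have "\<dots> = 0" by (rule word_zero[OF p_in_U0])
        finally show ?thesis by (simp add: T_def)
      qed (simp add: T_def)
    qed
    then obtain q where q: "H q" "\<And>v. length v < Suc (Suc r) \<Longrightarrow> word v q p = 0"
      "\<And>v. length v = Suc (Suc r) \<Longrightarrow> word v q p = T v" by blast
    define f' where "f' = (\<lambda>z. f z + (\<lambda>_. - 1) z * q z)"
    have "H f'" unfolding f'_def by (intro H f q)
    have wdf: "word w f' p = word w f p - word w q p" for w
      unfolding f'_def using word_diff[OF smf H(5)[OF q(1)] p_in_U0, of w] by simp
    have "word w f' p = 0" if "length w \<le> Suc (Suc r)" "weight w < ?E" for w
      using that f(4)[of w] q(2)[of w] q(3)[of w] by (cases "length w = Suc (Suc r)") (auto simp: wdf T_def)
    moreover have "f' p = 0" using wdf[of "[]"] f(2) q(2)[of "[]"] by simp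
    moreover have "vf_apply (Z a) f' p = (if a = \<beta> i then 1 else 0)" for a
      using wdf[of "[a]"] f(3)[of a] q(2)[of "[a]"] by simp
    ultimately show ?case using \<open>H f'\<close> by blast
  qed
  obtain R where R: "real R > ?E" using reals_Archimedean2 by blast
  obtain f where f: "?P (Suc R) f" using ex by blast
  have "word w f p = 0" if "weight w < ?E" for w
  proof -
    have "real (length w) < real R" using weight_ge_length[of w] that R by linarith
    then show ?thesis using f that by auto
  qed
  then have "ord_ge r ?E f" for r
    using f H(5) by (intro ord_ge_if_words_vanish) auto
  then show ?thesis using that[of f] f by blast
qed

end

section \<open>Coordinates adapted to the weights\<close>

lemma tangent_apply_coordinate:
  fixes z :: "complex ^ 'n::finite"
  shows "tangent_apply X (\<lambda>z. z $ k) z = X $ Inl k"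
proof -
  have "((\<lambda>z::complex ^ 'n. z $ k) has_derivative (\<lambda>z. z $ k)) (at z)"
    by (rule bounded_linear_imp_has_derivative) (rule bounded_linear_vec_nth)
  then have "tangent_apply X (\<lambda>z. z $ k) z = complexify_apply X (\<lambda>z. z $ k)"
    by (rule tangent_apply_eq)
  also have "\<dots> = (\<Sum>q\<in>UNIV. if q = k then X $ Inl k else 0)"
    unfolding complexify_apply_def by (rule sum.cong) (auto simp: axis_nth_if)
  finally show ?thesis by simp
qed

lemma tangent_apply_cnj_coordinate:
  fixes z :: "complex ^ 'n::finite"
  shows "tangent_apply X (\<lambda>z. cnj (z $ k)) z = X $ Inr k"
proof -
  have "(\<lambda>z::complex ^ 'n. z $ k) differentiable (at z)"
    using bounded_linear_imp_has_derivative[OF bounded_linear_vec_nth] by (auto simp: differentiable_def)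
  then show ?thesis by (simp add: tangent_apply_cnj tangent_apply_coordinate)
qed

lemma has_derivative_vec:
  fixes f :: "'a::real_normed_vector \<Rightarrow> complex ^ 'k::finite"
  assumes "\<And>k. ((\<lambda>z. f z $ k) has_derivative (\<lambda>v. f' v $ k)) F"
    and "F = at z within S"
  shows "(f has_derivative f') F"
  unfolding assms(2)
proof (subst has_derivative_componentwise_within, intro ballI)
  fix b :: "complex ^ 'k" assume "b \<in> Basis"
  then obtain k c where b: "b = axis k c" by (auto simp: Basis_vec_def)
  show "((\<lambda>x. f x \<bullet> b) has_derivative (\<lambda>x. f' x \<bullet> b)) (at z within S)"
    unfolding b inner_axis using has_derivative_inner_left assms by blast
qed

lemma linear_matrix_complex: "linear ((*v) (A :: complex ^ 'n ^ 'm))"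
  by (rule linearI) (simp_all add: vec_eq_iff matrix_vector_mult_def distrib_left sum.distrib scaleR_sum_right)

text \<open>For coordinates \<open>w\<close> of type \<open>(1,0)\<close> the pair lists the conjugates first. The antiholomorphic frame
  fields, which come first among the fields, are then dual to their own index.\<close>

definition conj_pair :: "('n \<Rightarrow> 'a \<Rightarrow> complex) \<Rightarrow> 'n + 'n \<Rightarrow> 'a \<Rightarrow> complex" where
  "conj_pair w s = (case s of Inl k \<Rightarrow> (\<lambda>z. cnj (w k z)) | Inr k \<Rightarrow> w k)"

lemma conj_pair_simps [simp]: "conj_pair w (Inl k) = (\<lambda>z. cnj (w k z))" "conj_pair w (Inr k) = w k"
  by (simp_all add: conj_pair_def)

text \<open>Holomorphic functions \<open>w\<close> of the right orders, dual to the frame at \<open>p\<close>, on a neighbourhood where the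
  matrix of the derivatives of \<open>w\<close> and its conjugates along the frame has an inverse \<open>N\<close>.\<close>

locale graded_coordinates = weighted_calculus U0 p Z e U
  for U0 :: "(complex ^ 'n::finite) set" and p and Z :: "'n + 'n \<Rightarrow> 'n cvf" and e U +
  fixes w :: "'n \<Rightarrow> complex ^ 'n \<Rightarrow> complex" and \<Gamma> :: "'n + 'n \<Rightarrow> 'n + 'n \<Rightarrow> complex ^ 'n \<Rightarrow> complex"
    and N :: "'n + 'n \<Rightarrow> 'n + 'n \<Rightarrow> complex ^ 'n \<Rightarrow> complex"
  assumes frame: "z \<in> U0 \<Longrightarrow> (\<Sum>s\<in>UNIV. \<Gamma> i s z * Z s z $ j) = (if i = j then 1 else 0)"
    and e_Inr: "e (Inr k) = e (Inl k)"
    and w_smooth: "smooth (w k)" and w_p: "w k p = 0"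
    and w_hol: "z \<in> U0 \<Longrightarrow> (\<And>k. X $ Inl k = 0) \<Longrightarrow> tangent_apply X (w k) z = 0"
    and Z_what_p: "vf_apply (Z i) (conj_pair w s) p = (if i = s then 1 else 0)"
    and Z_what_N: "z \<in> U0 \<Longrightarrow> (\<Sum>j\<in>UNIV. vf_apply (Z i) (conj_pair w j) z * N j l z) = (if i = l then 1 else 0)"
    and what_ord_ge: "ord_ge r (e s) (conj_pair w s)"
begin

abbreviation "what \<equiv> conj_pair w"

lemma what_smooth: "smooth (what s)"
  by (cases s) (auto intro: w_smooth smooth_cnj)

lemma N_smooth: "smooth (N k l)"
  by (rule smooth_inverse_matrix[where M = "\<lambda>i j. vf_apply (Z i) (what j)", OF Z_what_N smooth_Z[OF what_smooth]])

lemma N_p: "N i j p = (if i = j then 1 else 0)"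
  using Z_what_N[OF p_in_U0, of i j] by (simp add: Z_what_p if_distrib[of "\<lambda>x. x * _"] cong: if_cong)

lemma N_ord_ge: "ord_ge r (e i - e k) (N k i)"
  unfolding ord_ge_def
proof (rule bdd_inverse_matrix[where M = "\<lambda>i k \<delta> z. of_real (\<delta> powr (- (e k - e i))) * vf_apply (Z i) (what k) z"
      and N = "\<lambda>k i \<delta> z. of_real (\<delta> powr (- (e i - e k))) * N k i z"])
  show "bdd r (\<lambda>\<delta> z. of_real (\<delta> powr (- (e k - e i))) * vf_apply (Z i) (what k) z)" for i k
    using ord_ge_Z[OF what_smooth what_ord_ge] unfolding ord_ge_def .
  show "(\<Sum>j\<in>UNIV. of_real (\<delta> powr (- (e j - e i))) * vf_apply (Z i) (what j) z * (of_real (\<delta> powr (- (e l - e j))) * N j l z))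
      = (if i = l then 1 else 0)" if "\<delta> \<in> {0<..1}" "z \<in> U \<delta>" for \<delta> z i l
  proof -
    have *: "\<delta> powr (- (e j - e i)) * \<delta> powr (- (e l - e j)) = \<delta> powr (e i - e l)" for j
      by (simp add: powr_add[symmetric])
    have "(\<Sum>j\<in>UNIV. of_real (\<delta> powr (- (e j - e i))) * vf_apply (Z i) (what j) z * (of_real (\<delta> powr (- (e l - e j))) * N j l z))
      = (\<Sum>j\<in>UNIV. of_real (\<delta> powr (- (e j - e i)) * \<delta> powr (- (e l - e j))) * (vf_apply (Z i) (what j) z * N j l z))"
      by (rule sum.cong) (simp_all add: algebra_simps)
    also have "\<dots> = of_real (\<delta> powr (e i - e l)) * (if i = l then 1 else 0)"
      unfolding * sum_distrib_left[symmetric] using Z_what_N[of z i l] that U_subset[of \<delta>] by auto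
    finally show ?thesis using that by simp
  qed
  show "\<exists>C. \<forall>\<delta>\<in>{0<..1}. cmod (of_real (\<delta> powr (- (e j - e i))) * N i j p) \<le> C" for i j
    by (rule exI[of _ 1]) (auto simp: N_p)
qed

text \<open>The coordinate derivatives \<open>\<partial>/\<partial>w\<close> and \<open>\<partial>/\<partial>(cnj w)\<close>, see \<open>chain_rule\<close>. Being combinations of the frame
  with coefficients of known order, they are compatible with the weights.\<close>

definition D :: "'n + 'n \<Rightarrow> (complex ^ 'n \<Rightarrow> complex) \<Rightarrow> complex ^ 'n \<Rightarrow> complex" where
  "D k f z = (\<Sum>i\<in>UNIV. N k i z * vf_apply (Z i) f z)"

lemma D_smooth: "smooth f \<Longrightarrow> smooth (D k f)"
  unfolding D_def by (intro smooth_sum smooth_mult N_smooth smooth_Z)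

lemma D_ord_ge:
  assumes "smooth f" "ord_ge (Suc r) s f"
  shows "ord_ge r (s - e k) (D k f)"
proof -
  have "ord_ge r ((e i - e k) + (s - e i)) (\<lambda>z. N k i z * vf_apply (Z i) f z)" for i
    by (intro ord_ge_mult N_ord_ge ord_ge_Z assms)
  then show ?thesis unfolding D_def by (intro ord_ge_sum) simp
qed

lemma frame_expand:
  assumes "z \<in> U0"
  shows "X = (\<Sum>s\<in>UNIV. (\<Sum>i\<in>UNIV. X $ i * \<Gamma> i s z) *s Z s z)"
proof -
  have "(\<Sum>s\<in>UNIV. (\<Sum>i\<in>UNIV. X $ i * \<Gamma> i s z) * Z s z $ j) = X $ j" for j
  proof -
    have "(\<Sum>s\<in>UNIV. (\<Sum>i\<in>UNIV. X $ i * \<Gamma> i s z) * Z s z $ j) = (\<Sum>i\<in>UNIV. X $ i * (\<Sum>s\<in>UNIV. \<Gamma> i s z * Z s z $ j))"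
      by (simp add: sum_distrib_left sum_distrib_right mult.assoc) (rule sum.swap)
    then show ?thesis by (simp add: frame[OF assms] if_distrib[of "\<lambda>x. _ * x"] cong: if_cong)
  qed
  then show ?thesis by (simp add: vec_eq_iff)
qed

lemma chain_rule:
  assumes z: "z \<in> U0"
  shows "tangent_apply X f z = (\<Sum>k\<in>UNIV. tangent_apply X (what k) z * D k f z)"
proof -
  define \<mu> where "\<mu> = (\<lambda>s. \<Sum>i\<in>UNIV. X $ i * \<Gamma> i s z)"
  have X: "tangent_apply X h z = (\<Sum>s\<in>UNIV. \<mu> s * vf_apply (Z s) h z)" for h
    by (subst frame_expand[OF z, of X]) (simp add: tangent_apply_sum_left tangent_apply_scale_left \<mu>_def vf_apply_def)
  have "(\<Sum>k\<in>UNIV. vf_apply (Z s) (what k) z * D k f z) = vf_apply (Z s) f z" for s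
  proof -
    have "(\<Sum>k\<in>UNIV. vf_apply (Z s) (what k) z * D k f z)
        = (\<Sum>i\<in>UNIV. (\<Sum>k\<in>UNIV. vf_apply (Z s) (what k) z * N k i z) * vf_apply (Z i) f z)"
      by (simp add: D_def sum_distrib_left sum_distrib_right mult.assoc) (rule sum.swap)
    then show ?thesis by (simp add: Z_what_N[OF z] if_distrib[of "\<lambda>x. x * _"] cong: if_cong)
  qed
  then have "tangent_apply X f z = (\<Sum>s\<in>UNIV. \<mu> s * (\<Sum>k\<in>UNIV. vf_apply (Z s) (what k) z * D k f z))"
    by (simp add: X)
  also have "\<dots> = (\<Sum>k\<in>UNIV. (\<Sum>s\<in>UNIV. \<mu> s * vf_apply (Z s) (what k) z) * D k f z)"
    by (simp add: sum_distrib_left sum_distrib_right mult.assoc) (rule sum.swap)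
  finally show ?thesis by (simp add: X)
qed

definition wmap :: "complex ^ 'n \<Rightarrow> complex ^ 'n" where
  "wmap z = (\<chi> k. w k z)"

definition jac :: "complex ^ 'n \<Rightarrow> complex ^ 'n ^ 'n" where
  "jac z = (\<chi> k q. tangent_apply (axis (Inl q) 1) (w k) z)"

lemma jac_real_tangent:
  assumes "z \<in> U0"
  shows "(jac z *v v) $ k = tangent_apply (real_tangent v) (w k) z"
proof -
  define Y where "Y = real_tangent v - (\<Sum>q\<in>UNIV. v $ q *s axis (Inl q) 1)"
  have "Y $ Inl q = 0" for q
    by (simp add: Y_def axis_nth_if if_distrib[of "\<lambda>x. _ * x"] cong: if_cong)
  then have "tangent_apply Y (w k) z = 0" using w_hol[OF assms] by blast
  moreover have "real_tangent v = Y + (\<Sum>q\<in>UNIV. v $ q *s axis (Inl q) 1)" by (simp add: Y_def)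
  ultimately show ?thesis
    by (simp add: tangent_apply_add_left tangent_apply_sum_left tangent_apply_scale_left jac_def matrix_vector_mult_def mult.commute)
qed

lemma wmap_derivative:
  assumes "z \<in> U0"
  shows "(wmap has_derivative (*v) (jac z)) (at z)"
proof (rule has_derivative_vec[OF _ refl])
  fix k
  obtain f' where f': "(w k has_derivative f') (at z)"
    using smooth_differentiable[OF w_smooth assms] by (auto simp: differentiable_def)
  moreover have "f' = (\<lambda>v. (jac z *v v) $ k)"
    using has_derivative_tangent[OF f'] jac_real_tangent[OF assms] by auto
  ultimately show "((\<lambda>z. wmap z $ k) has_derivative (\<lambda>v. (jac z *v v) $ k)) (at z)"
    by (simp add: wmap_def)
qed

text \<open>A real vector annihilated by all \<open>w k\<close> is annihilated by their conjugates, hence by all functions,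
  in particular by the coordinates \<open>z \<mapsto> z $ q\<close>.\<close>

lemma jac_injective:
  assumes z: "z \<in> U0" and "jac z *v v = 0"
  shows "v = 0"
proof -
  have 0: "tangent_apply (real_tangent v) (w k) z = 0" for k
    using jac_real_tangent[OF z, of v k] assms(2) by simp
  then have "tangent_apply (real_tangent v) (\<lambda>z. cnj (w k z)) z = 0" for k
    by (simp add: tangent_apply_cnj smooth_differentiable[OF w_smooth z])
  then have "tangent_apply (real_tangent v) (what s) z = 0" for s
    using 0 by (cases s) auto
  then have "tangent_apply (real_tangent v) (\<lambda>z. z $ q) z = 0" for q
    using chain_rule[OF z, of "real_tangent v" "\<lambda>z. z $ q"] by simp
  then show ?thesis by (simp add: tangent_apply_coordinate vec_eq_iff)
qed

lemma jac_left_inverse: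
  assumes "z \<in> U0"
  obtains A where "A ** jac z = mat 1" "jac z ** A = mat 1"
proof -
  have "inj ((*v) (jac z))"
  proof (rule injI)
    fix x y assume "jac z *v x = jac z *v y"
    then have "jac z *v (x - y) = 0" by (simp add: matrix_vector_mult_diff_distrib)
    then show "x = y" using jac_injective[OF assms] by force
  qed
  then obtain A where "A ** jac z = mat 1" using matrix_left_invertible_injective by blast
  then show ?thesis using that matrix_left_right_inverse by blast
qed

lemma local_inverse:
  obtains U' V g where "open U'" "U' \<subseteq> U0" "p \<in> U'" "open V" "0 \<in> V" "homeomorphism U' V wmap g"
    "\<And>y. y \<in> V \<Longrightarrow> \<exists>A. (g has_derivative (*v) A) (at y)"
proof -
  have bl: "bounded_linear ((*v) A)" for A :: "complex ^ 'n ^ 'n"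
    using linear_matrix_complex linear_conv_bounded_linear by blast
  obtain A where A: "A ** jac p = mat 1" using jac_left_inverse[OF p_in_U0] .
  define f' where "f' = (\<lambda>z. Blinfun ((*v) (jac z)))"
  have f': "blinfun_apply (f' z) = (*v) (jac z)" for z
    unfolding f'_def by (rule bounded_linear_Blinfun_apply[OF bl])
  have cont: "continuous_on U0 f'"
  proof (rule continuous_on_blinfun_componentwise)
    fix v :: "complex ^ 'n"
    have "continuous_on U0 (\<lambda>z. tangent_apply (real_tangent v) (w k) z)" for k
    proof -
      have "smooth (vf_apply (\<lambda>_. real_tangent v) (w k))" by (rule smooth_vf_apply[OF _ w_smooth]) simp
      then show ?thesis using smooth_differentiable_on[THEN differentiable_imp_continuous_on]
        by (simp add: vf_apply_def[abs_def])
    qed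
    then have "continuous_on U0 (\<lambda>z. (jac z *v v) $ k)" for k
      using jac_real_tangent by (simp cong: continuous_on_cong)
    then have "continuous_on U0 (\<lambda>z. \<chi> k. (jac z *v v) $ k)" by (intro continuous_on_vec_lambda)
    then show "continuous_on U0 (\<lambda>z. f' z v)" by (simp add: f')
  qed
  have inv: "Blinfun ((*v) A) o\<^sub>L f' p = id_blinfun"
    by (rule blinfun_eqI) (simp add: bounded_linear_Blinfun_apply[OF bl] f' matrix_vector_mul_assoc A)
  have der: "(wmap has_derivative blinfun_apply (f' z)) (at z)" if "z \<in> U0" for z
    using wmap_derivative[OF that] by (simp add: f')
  show ?thesis
  proof (rule inverse_function_theorem[of U0 wmap f' p "Blinfun ((*v) A)"])
    show "open U0" "p \<in> U0" "continuous_on U0 f'" by (fact open_U0 p_in_U0 cont)+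
    show "(wmap has_derivative blinfun_apply (f' z)) (at z)" if "z \<in> U0" for z by (rule der[OF that])
    show "Blinfun ((*v) A) o\<^sub>L f' p = id_blinfun" by (rule inv)
    fix U' V g g'
    assume *: "open U'" "U' \<subseteq> U0" "p \<in> U'" "open V" "wmap p \<in> V" "homeomorphism U' V wmap g"
      and **: "\<And>y. y \<in> V \<Longrightarrow> (g has_derivative g' y) (at y)"
      "\<And>y. y \<in> V \<Longrightarrow> g' y = inv (blinfun_apply (f' (g y)))"
    have "\<exists>A. (g has_derivative (*v) A) (at y)" if y: "y \<in> V" for y
    proof -
      have "g y \<in> U0" using *(2,6) y unfolding homeomorphism_def by blast
      then obtain B where B: "B ** jac (g y) = mat 1" "jac (g y) ** B = mat 1" using jac_left_inverse by blast
      have "inv ((*v) (jac (g y))) = (*v) B"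
        by (rule inv_unique_comp) (auto simp: fun_eq_iff matrix_vector_mul_assoc B)
      then have "g' y = (*v) B" using **(2)[OF y] f' by simp
      then show ?thesis using **(1)[OF y] by auto
    qed
    moreover have "0 \<in> V" using *(5) by (simp add: wmap_def w_p zero_vec_def)
    ultimately show ?thesis using *(1-4,6) by (intro that)
  qed
qed

end

section \<open>Anisotropic dilations in adapted coordinates\<close>

lemma sum_UNIV_sum: "(\<Sum>s\<in>UNIV. h s) = (\<Sum>k\<in>UNIV. h (Inl k)) + (\<Sum>k\<in>UNIV. h (Inr k :: 'a::finite + 'b::finite))"
  using sum.Plus[of "UNIV :: 'a set" "UNIV :: 'b set" h] by (simp add: o_def)

lemma axis_sum:
  fixes \<alpha> \<beta> :: "'n::finite \<Rightarrow> complex"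
  shows "(\<Sum>k\<in>UNIV. axis q c $ k * \<alpha> k + cnj (axis q c $ k) * \<beta> k) = c * \<alpha> q + cnj c * \<beta> q"
proof -
  have "(\<Sum>k\<in>UNIV. axis q c $ k * \<alpha> k + cnj (axis q c $ k) * \<beta> k) = (\<Sum>k\<in>UNIV. if k = q then c * \<alpha> q + cnj c * \<beta> q else 0)"
    by (rule sum.cong) (auto simp: axis_nth_if)
  then show ?thesis by simp
qed

lemma complexify_apply_sum:
  fixes X :: "complex ^ ('n::finite + 'n)"
  shows "complexify_apply X (\<lambda>v. \<Sum>k\<in>UNIV. v $ k * \<alpha> k + cnj (v $ k) * \<beta> k)
      = (\<Sum>k\<in>UNIV. X $ Inl k * \<alpha> k + X $ Inr k * \<beta> k)"
  unfolding complexify_apply_def axis_sum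
  by (rule sum.cong) (auto simp: algebra_simps add_divide_distrib diff_divide_distrib)

text \<open>Dilating source and target scales the determinant of the coefficient matrix by the two products.\<close>

lemma det_scale_rows_columns:
  fixes m :: "'n::finite \<Rightarrow> 'n \<Rightarrow> complex"
  shows "det (\<chi> r q. a r * b q * m r q) = prod a UNIV * prod b UNIV * det (\<chi> r q. m r q)"
proof -
  have "det (\<chi> r q. a r * b q * m r q) = det (\<chi> r. a r *s (\<chi> q. b q * m r q))"
    by (rule arg_cong[of _ _ det]) (simp add: vec_eq_iff mult.assoc)
  also have "\<dots> = prod a UNIV * det (\<chi> r. \<chi> q. b q * m r q)" by (rule det_rows_mul)
  also have "det (\<chi> r. \<chi> q. b q * m r q) = det (transpose (\<chi> q. b q *s (\<chi> r. m r q)))"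
    by (rule arg_cong[of _ _ det]) (simp add: vec_eq_iff transpose_def)
  also have "\<dots> = prod b UNIV * det (transpose (\<chi> r q. m r q))"
    unfolding det_transpose by (subst det_rows_mul) (simp add: transpose_def det_transpose[of "\<chi> r q. m r q", symmetric])
  finally show ?thesis by (simp add: det_transpose)
qed

lemma partial_deriv_cong_open:
  assumes "open B" "z \<in> B" "\<And>w. w \<in> B \<Longrightarrow> f w = g w" "f differentiable (at z)"
  shows "partial_deriv v f z = partial_deriv v g z"
  unfolding partial_deriv_def using frechet_derivative_transform_within_open[OF assms(4,1,2)] assms(3) by simp

text \<open>The number \<open>\<epsilon>\<close> is so small that the inverse \<open>g\<close> of the coordinate map is defined on the ball of
  radius \<open>\<epsilon>\<close> and the determinant of the frame in the coordinates \<open>w\<close> stays away from \<open>0\<close> there.\<close>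

locale scaled_chart = graded_coordinates U0 p Z e U w \<Gamma> N
  for U0 :: "(complex ^ 'n::finite) set" and p and Z :: "'n + 'n \<Rightarrow> 'n cvf" and e U w \<Gamma> N +
  fixes \<epsilon> :: real and g :: "complex ^ 'n \<Rightarrow> complex ^ 'n" and U' V :: "(complex ^ 'n) set"
  assumes eps: "\<epsilon> > 0" and cball_V: "cball 0 \<epsilon> \<subseteq> V"
    and U': "open U'" "U' \<subseteq> U0" and pU': "p \<in> U'"
    and homeo: "homeomorphism U' V wmap g"
    and g_der: "y \<in> V \<Longrightarrow> \<exists>A. (g has_derivative (*v) A) (at y)"
    and det_ge: "y \<in> cball 0 \<epsilon> \<Longrightarrow> cmod (det (\<chi> r q. vf_apply (Z (Inl q)) (conj_pair w (Inl r)) (g y))) \<ge> 1 / 2"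
begin

definition a :: "real \<Rightarrow> 'n \<Rightarrow> real" where "a \<delta> k = \<epsilon> * \<delta> powr e (Inl k)"

definition S :: "real \<Rightarrow> complex ^ 'n \<Rightarrow> complex ^ 'n" where
  "S \<delta> z = (\<chi> k. of_real (a \<delta> k) * z $ k)"

definition \<Phi> :: "real \<Rightarrow> complex ^ 'n \<Rightarrow> complex ^ 'n" where "\<Phi> \<delta> z = g (S \<delta> z)"

lemma a_pos: "\<delta> \<in> {0<..1} \<Longrightarrow> a \<delta> k > 0"
  by (simp add: a_def eps)

lemma S_matrix: "S \<delta> = (*v) (\<chi> i j. if i = j then of_real (a \<delta> i) else 0)"
  by (auto simp: S_def matrix_vector_mult_def fun_eq_iff vec_eq_iff if_distrib[of "\<lambda>x. x * _"] cong: if_cong)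

lemma S_in_V:
  assumes "\<delta> \<in> {0<..1}" "z \<in> ball 0 1"
  shows "S \<delta> z \<in> cball 0 \<epsilon>" "S \<delta> z \<in> V"
proof -
  have "norm (S \<delta> z) \<le> norm (\<epsilon> *\<^sub>R z)"
  proof (rule norm_le_componentwise_cart)
    fix k
    have "\<delta> powr e (Inl k) \<le> 1" using assms e_ge_1[of "Inl k"] by (intro powr_le1) auto
    then show "norm (S \<delta> z $ k) \<le> norm ((\<epsilon> *\<^sub>R z) $ k)"
      using eps by (simp add: S_def norm_mult a_def abs_mult mult_left_le mult_right_mono)
  qed
  also have "\<dots> \<le> \<epsilon>" using assms eps by simp
  finally show "S \<delta> z \<in> cball 0 \<epsilon>" by simp
  then show "S \<delta> z \<in> V" using cball_V by blast
qed

lemma \<Phi>_mem: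
  assumes "\<delta> \<in> {0<..1}" "z \<in> ball 0 1"
  shows "\<Phi> \<delta> z \<in> U'" "\<Phi> \<delta> z \<in> U0" "wmap (\<Phi> \<delta> z) = S \<delta> z"
  using S_in_V[OF assms] homeo U' unfolding \<Phi>_def homeomorphism_def by auto

lemma \<Phi>_0: "\<Phi> \<delta> 0 = p"
proof -
  have "wmap p = 0" by (simp add: wmap_def w_p zero_vec_def)
  moreover have "g (wmap p) = p" using homeo pU' unfolding homeomorphism_def by blast
  moreover have "S \<delta> 0 = 0" by (simp add: S_def zero_vec_def)
  ultimately show ?thesis by (simp add: \<Phi>_def)
qed

lemma S_derivative: "(S \<delta> has_derivative S \<delta>) (at z)"
  unfolding S_matrix
  using linear_matrix_complex linear_conv_bounded_linear bounded_linear_imp_has_derivative by blast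

lemma \<Phi>_derivative:
  assumes "\<delta> \<in> {0<..1}" "z \<in> ball 0 1"
  obtains A where "(\<Phi> \<delta> has_derivative (*v) A) (at z)" "\<forall>v. jac (\<Phi> \<delta> z) *v (A *v v) = S \<delta> v"
proof -
  obtain A0 where A0: "(g has_derivative (*v) A0) (at (S \<delta> z))" using g_der[OF S_in_V(2)[OF assms]] by blast
  define A where "A = A0 ** (\<chi> i j. if i = j then of_real (a \<delta> i) else 0)"
  have "((\<lambda>z. g (S \<delta> z)) has_derivative (\<lambda>v. A0 *v S \<delta> v)) (at z)"
    using S_derivative A0 by (rule has_derivative_compose)
  then have A: "(\<Phi> \<delta> has_derivative (*v) A) (at z)"
    by (simp add: \<Phi>_def[abs_def] S_matrix matrix_vector_mul_assoc A_def)
  have "((\<lambda>z. wmap (\<Phi> \<delta> z)) has_derivative (\<lambda>v. jac (\<Phi> \<delta> z) *v (A *v v))) (at z)"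
    using A wmap_derivative[OF \<Phi>_mem(2)[OF assms]] by (rule has_derivative_compose)
  then have "(S \<delta> has_derivative (\<lambda>v. jac (\<Phi> \<delta> z) *v (A *v v))) (at z)"
    by (rule has_derivative_transform_within_open[OF _ open_ball assms(2)]) (use \<Phi>_mem(3) assms in auto)
  then have "(\<lambda>v. jac (\<Phi> \<delta> z) *v (A *v v)) = S \<delta>"
    using S_derivative has_derivative_unique by blast
  then show ?thesis using that[OF A] by (simp add: fun_eq_iff)
qed

text \<open>In the coordinates \<open>w\<close> the chart is the diagonal map with entries \<open>a \<delta> k\<close>, so \<open>\<partial>/\<partial>z\<^sub>k\<close> becomes
  \<open>a \<delta> k\<close> times \<open>\<partial>/\<partial>w\<^sub>k\<close>, and likewise for the conjugates.\<close>

lemma comp_derivative: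
  assumes d: "\<delta> \<in> {0<..1}" "z \<in> ball 0 1" and F: "smooth F"
  shows "((\<lambda>z. F (\<Phi> \<delta> z)) has_derivative
     (\<lambda>v. \<Sum>k\<in>UNIV. v $ k * (of_real (a \<delta> k) * D (Inr k) F (\<Phi> \<delta> z))
                    + cnj (v $ k) * (of_real (a \<delta> k) * D (Inl k) F (\<Phi> \<delta> z)))) (at z)"
proof -
  note mem = \<Phi>_mem(2)[OF d]
  obtain A where A: "(\<Phi> \<delta> has_derivative (*v) A) (at z)" "\<forall>v. jac (\<Phi> \<delta> z) *v (A *v v) = S \<delta> v"
    using \<Phi>_derivative[OF d] .
  obtain F' where F': "(F has_derivative F') (at (\<Phi> \<delta> z))"
    using smooth_differentiable[OF F mem] by (auto simp: differentiable_def)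
  have 1: "((\<lambda>z. F (\<Phi> \<delta> z)) has_derivative (\<lambda>v. F' (A *v v))) (at z)"
    using A(1) F' by (rule has_derivative_compose)
  have "F' (A *v v) = (\<Sum>k\<in>UNIV. v $ k * (of_real (a \<delta> k) * D (Inr k) F (\<Phi> \<delta> z))
                    + cnj (v $ k) * (of_real (a \<delta> k) * D (Inl k) F (\<Phi> \<delta> z)))" for v
  proof -
    let ?X = "real_tangent (A *v v)"
    have tw: "tangent_apply ?X (w k) (\<Phi> \<delta> z) = of_real (a \<delta> k) * v $ k" for k
      using jac_real_tangent[OF mem, of "A *v v" k] A(2) by (simp add: S_def)
    have tcw: "tangent_apply ?X (\<lambda>z. cnj (w k z)) (\<Phi> \<delta> z) = of_real (a \<delta> k) * cnj (v $ k)" for k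
      using tw[of k] by (simp add: tangent_apply_cnj smooth_differentiable[OF w_smooth mem])
    have "F' (A *v v) = (\<Sum>s\<in>UNIV. tangent_apply ?X (what s) (\<Phi> \<delta> z) * D s F (\<Phi> \<delta> z))"
      unfolding has_derivative_tangent[OF F'] by (rule chain_rule[OF mem])
    then show ?thesis
      by (simp add: sum_UNIV_sum tw tcw sum.distrib algebra_simps)
  qed
  then show ?thesis using 1 by simp
qed

lemma comp_tangent_apply:
  assumes d: "\<delta> \<in> {0<..1}" "z \<in> ball 0 1" and F: "smooth F"
  shows "tangent_apply X (\<lambda>z. F (\<Phi> \<delta> z)) z
     = (\<Sum>k\<in>UNIV. X $ Inl k * (of_real (a \<delta> k) * D (Inr k) F (\<Phi> \<delta> z)) + X $ Inr k * (of_real (a \<delta> k) * D (Inl k) F (\<Phi> \<delta> z)))"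
  unfolding tangent_apply_eq[OF comp_derivative[OF assms]] by (rule complexify_apply_sum)

text \<open>A function of weighted order \<open>s\<close> is \<open>O(\<delta> powr s)\<close> on the image of the unit ball: the mean
  value inequality reduces the claim to the derivatives, which have smaller order.\<close>

lemma ord_ge_uniform_bound:
  assumes "s \<le> real n" "smooth F" "\<And>r. ord_ge r s F"
  shows "\<exists>C. \<forall>\<delta>\<in>{0<..1}. \<forall>z\<in>ball 0 1. cmod (F (\<Phi> \<delta> z)) \<le> C * \<delta> powr s"
proof -
  have base: "\<exists>C. \<forall>\<delta>\<in>{0<..1}. \<forall>z\<in>ball 0 1. cmod (F (\<Phi> \<delta> z)) \<le> C * \<delta> powr s" if s: "s \<le> 0" and F: "smooth F" for s F
  proof -
    have "continuous_on (cball 0 \<epsilon>) g"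
      using homeomorphism_cont2[OF homeo] cball_V continuous_on_subset by blast
    moreover have "g ` cball 0 \<epsilon> \<subseteq> U0"
      using image_mono[OF cball_V, of g] homeomorphism_image2[OF homeo] U'(2) by simp
    then have "continuous_on (g ` cball 0 \<epsilon>) F"
      using differentiable_imp_continuous_on[OF smooth_differentiable_on[OF F]] continuous_on_subset by blast
    ultimately have "compact (F ` g ` cball 0 \<epsilon>)"
      by (intro compact_continuous_image compact_cball)
    then have "bounded (F ` g ` cball 0 \<epsilon>)" by (rule compact_imp_bounded)
    then obtain C where C': "\<forall>x\<in>F ` g ` cball 0 \<epsilon>. norm x \<le> C" unfolding bounded_iff ..
    have C: "cmod (F (g y)) \<le> C" if "y \<in> cball 0 \<epsilon>" for y using C' that by blast
    have C0: "C \<ge> 0" using order_trans[OF norm_ge_zero C[of 0]] eps by simp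
    have "cmod (F (\<Phi> \<delta> z)) \<le> C * \<delta> powr s" if "\<delta> \<in> {0<..1}" "z \<in> ball 0 1" for \<delta> z
    proof -
      have "1 \<le> \<delta> powr s" using that s powr_mono'[of s 0 \<delta>] by simp
      then show ?thesis using C[OF S_in_V(1)[OF that]] mult_left_mono[of 1 "\<delta> powr s" C] C0 by (simp add: \<Phi>_def)
    qed
    then show ?thesis by blast
  qed
  show ?thesis using assms
  proof (induction n arbitrary: s F)
    case 0
    then show ?case using base by simp
  next
    case (Suc n)
    have "\<exists>C. \<forall>\<delta>\<in>{0<..1}. \<forall>z\<in>ball 0 1. cmod (D k F (\<Phi> \<delta> z)) \<le> C * \<delta> powr (s - e k)" for k
    proof (rule Suc.IH)
      show "s - e k \<le> real n" using Suc.prems(1) e_ge_1[of k] by simp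
      show "smooth (D k F)" by (rule D_smooth[OF Suc.prems(2)])
      show "ord_ge r (s - e k) (D k F)" for r by (rule D_ord_ge[OF Suc.prems(2,3)])
    qed
    then obtain C where C: "\<And>k \<delta> z. \<delta> \<in> {0<..1} \<Longrightarrow> z \<in> ball 0 1 \<Longrightarrow> cmod (D k F (\<Phi> \<delta> z)) \<le> C k * \<delta> powr (s - e k)"
      by metis
    define K where "K = (\<Sum>k\<in>UNIV. \<epsilon> * C (Inr k) + \<epsilon> * C (Inl k))"
    obtain C0 where C0: "\<And>\<delta>. \<delta> \<in> {0<..1} \<Longrightarrow> cmod (of_real (\<delta> powr (- s)) * F p) \<le> C0"
      using bdd_bound[OF Suc.prems(3)[of 0, unfolded ord_ge_def]] by blast
    have "cmod (F (\<Phi> \<delta> z)) \<le> (C0 + K) * \<delta> powr s" if d: "\<delta> \<in> {0<..1}" and z: "z \<in> ball 0 1" for \<delta> z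
    proof -
      let ?T = "\<lambda>y v k. v $ k * (of_real (a \<delta> k) * D (Inr k) F (\<Phi> \<delta> y))
        + cnj (v $ k) * (of_real (a \<delta> k) * D (Inl k) F (\<Phi> \<delta> y))"
      have ad: "a \<delta> k * (c * \<delta> powr (s - e (Inl k))) = \<epsilon> * c * \<delta> powr s" for k c
        using d by (simp add: a_def powr_diff)
      have on: "onorm (\<lambda>v. \<Sum>k\<in>UNIV. ?T y v k) \<le> K * \<delta> powr s" if y: "y \<in> ball 0 1" for y
      proof (rule onorm_le)
        fix v :: "complex ^ 'n"
        have "norm (\<Sum>k\<in>UNIV. ?T y v k)
            \<le> (\<Sum>k\<in>UNIV. norm v * ((\<epsilon> * C (Inr k) + \<epsilon> * C (Inl k)) * \<delta> powr s))"
        proof (rule sum_norm_le)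
          fix k
          have b: "cmod (of_real (a \<delta> k) * D s' F (\<Phi> \<delta> y)) \<le> \<epsilon> * C s' * \<delta> powr s" if "e s' = e (Inl k)" for s'
          proof -
            have "a \<delta> k * cmod (D s' F (\<Phi> \<delta> y)) \<le> a \<delta> k * (C s' * \<delta> powr (s - e (Inl k)))"
              using C[OF d y, of s'] a_pos[OF d, of k] that by (intro mult_left_mono) auto
            then show ?thesis using a_pos[OF d, of k] by (simp add: ad norm_mult)
          qed
          have n: "norm (v $ k) \<le> norm v" by (rule Finite_Cartesian_Product.norm_nth_le)
          have "norm (?T y v k)
             \<le> norm (v $ k) * cmod (of_real (a \<delta> k) * D (Inr k) F (\<Phi> \<delta> y)) + norm (v $ k) * cmod (of_real (a \<delta> k) * D (Inl k) F (\<Phi> \<delta> y))"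
            by (rule order_trans[OF norm_triangle_ineq]) (simp add: norm_mult)
          also have "\<dots> \<le> norm v * (\<epsilon> * C (Inr k) * \<delta> powr s) + norm v * (\<epsilon> * C (Inl k) * \<delta> powr s)"
            by (intro add_mono mult_mono n b) (auto simp: e_Inr)
          also have "\<dots> = norm v * ((\<epsilon> * C (Inr k) + \<epsilon> * C (Inl k)) * \<delta> powr s)" by (simp add: algebra_simps)
          finally show "norm (?T y v k)
             \<le> norm v * ((\<epsilon> * C (Inr k) + \<epsilon> * C (Inl k)) * \<delta> powr s)" .
        qed
        also have "\<dots> = K * \<delta> powr s * norm v"
          by (simp add: K_def sum_distrib_left sum_distrib_right algebra_simps)
        finally show "norm (\<Sum>k\<in>UNIV. ?T y v k) \<le> K * \<delta> powr s * norm v" .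
      qed
      have "norm (F (\<Phi> \<delta> z) - F (\<Phi> \<delta> 0)) \<le> K * \<delta> powr s * norm (z - 0)"
        by (rule differentiable_bound[where S = "ball 0 1", OF convex_ball has_derivative_at_withinI[OF comp_derivative[OF d _ Suc.prems(2)]] on])
          (use z in auto)
      also have "\<dots> \<le> K * \<delta> powr s"
      proof -
        have "0 \<le> K * \<delta> powr s" using on[OF z] onorm_pos_le[OF has_derivative_bounded_linear[OF comp_derivative[OF d z Suc.prems(2)]]] by linarith
        then show ?thesis using z by (simp add: mult_left_le)
      qed
      finally have "cmod (F (\<Phi> \<delta> z)) \<le> cmod (F p) + K * \<delta> powr s"
        using norm_triangle_ineq2[of "F (\<Phi> \<delta> z)" "F p"] by (simp add: \<Phi>_0)
      moreover have "cmod (F p) \<le> C0 * \<delta> powr s"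
        using C0[OF d] d by (simp add: norm_mult norm_divide powr_minus field_simps)
      ultimately show ?thesis by (simp add: algebra_simps)
    qed
    then show ?case by blast
  qed
qed

end

section \<open>Pullbacks along the dilations\<close>

context scaled_chart begin

text \<open>A class of families of functions on the unit ball that is closed under partial derivatives and whose
  members are bounded uniformly in \<open>\<delta>\<close>: the factor \<open>a \<delta> k\<close> produced by a derivative is absorbed in
  the drop of the order from \<open>s\<close> to \<open>s - e (Inl k)\<close>.\<close>

definition uniform :: "(real \<Rightarrow> complex ^ 'n \<Rightarrow> complex) \<Rightarrow> bool" where
  "uniform h \<longleftrightarrow> (\<exists>F s. smooth F \<and> (\<forall>r. ord_ge r s F) \<and>
     (\<forall>\<delta>\<in>{0<..1}. \<forall>z\<in>ball 0 1. h \<delta> z = of_real (\<delta> powr (- s)) * F (\<Phi> \<delta> z)))"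

lemma uniform_cong:
  "uniform h \<Longrightarrow> (\<And>\<delta> z. \<delta> \<in> {0<..1} \<Longrightarrow> z \<in> ball 0 1 \<Longrightarrow> h' \<delta> z = h \<delta> z) \<Longrightarrow> uniform h'"
  unfolding uniform_def by (elim exE conjE) (intro exI conjI, auto)

lemma uniform_bounded:
  assumes "uniform h"
  shows "\<exists>C. \<forall>\<delta>\<in>{0<..1}. \<forall>z\<in>ball 0 1. cmod (h \<delta> z) \<le> C"
proof -
  obtain F s where F: "smooth F" "\<And>r. ord_ge r s F"
    and h: "\<And>\<delta> z. \<delta> \<in> {0<..1} \<Longrightarrow> z \<in> ball 0 1 \<Longrightarrow> h \<delta> z = of_real (\<delta> powr (- s)) * F (\<Phi> \<delta> z)"
    using assms unfolding uniform_def by blast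
  obtain n :: nat where "s \<le> real n" using real_arch_simple by blast
  from ord_ge_uniform_bound[OF this F] obtain C
    where C: "\<forall>\<delta>\<in>{0<..1}. \<forall>z\<in>ball 0 1. cmod (F (\<Phi> \<delta> z)) \<le> C * \<delta> powr s" ..
  have "cmod (h \<delta> z) \<le> C" if "\<delta> \<in> {0<..1}" "z \<in> ball 0 1" for \<delta> z
  proof -
    have "cmod (h \<delta> z) = \<delta> powr (- s) * cmod (F (\<Phi> \<delta> z))" using that by (simp add: h norm_mult)
    also have "\<dots> \<le> \<delta> powr (- s) * (C * \<delta> powr s)" using C that by (intro mult_left_mono) auto
    also have "\<dots> = C" using that by (simp add: powr_minus field_simps)
    finally show ?thesis .
  qed
  then show ?thesis by blast
qed

lemma uniform_differentiable:
  assumes "uniform h" "\<delta> \<in> {0<..1}" "z \<in> ball 0 1"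
  shows "h \<delta> differentiable (at z)"
proof -
  obtain F s where F: "smooth F"
    and h: "\<And>\<delta> z. \<delta> \<in> {0<..1} \<Longrightarrow> z \<in> ball 0 1 \<Longrightarrow> h \<delta> z = of_real (\<delta> powr (- s)) * F (\<Phi> \<delta> z)"
    using assms(1) unfolding uniform_def by blast
  obtain D' where "((\<lambda>z. of_real (\<delta> powr (- s)) * F (\<Phi> \<delta> z)) has_derivative D') (at z)"
    using has_derivative_mult_right[OF comp_derivative[OF assms(2,3) F]] by blast
  then have "(h \<delta> has_derivative D') (at z)"
    by (rule has_derivative_transform_within_open[OF _ open_ball assms(3)]) (use h[OF assms(2)] in auto)
  then show ?thesis by (auto simp: differentiable_def)
qed

lemma uniform_partial_deriv:
  assumes "uniform h" "v \<in> Basis"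
  shows "uniform (\<lambda>\<delta>. partial_deriv v (h \<delta>))"
proof -
  obtain F s where F: "smooth F" "\<And>r. ord_ge r s F"
    and h: "\<And>\<delta> z. \<delta> \<in> {0<..1} \<Longrightarrow> z \<in> ball 0 1 \<Longrightarrow> h \<delta> z = of_real (\<delta> powr (- s)) * F (\<Phi> \<delta> z)"
    using assms(1) unfolding uniform_def by blast
  obtain k c where v: "v = axis k c" using assms(2) by (auto simp: Basis_complex_vec)
  define G where "G = (\<lambda>z. of_real \<epsilon> * (c * D (Inr k) F z + cnj c * D (Inl k) F z))"
  have "smooth G" unfolding G_def by (intro smooth_mult smooth_add smooth_const D_smooth F)
  moreover have "ord_ge r (s - e (Inl k)) G" for r
  proof -
    have 1: "ord_ge r (s - e (Inl k)) (D (Inl k) F)" "ord_ge r (s - e (Inl k)) (D (Inr k) F)"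
      using D_ord_ge[OF F(1) F(2)[of "Suc r"], of "Inl k"] D_ord_ge[OF F(1) F(2)[of "Suc r"], of "Inr k"] by (simp_all add: e_Inr)
    have 2: "ord_ge r (s - e (Inl k)) f \<Longrightarrow> ord_ge r (s - e (Inl k)) (\<lambda>z. c * f z)" for f c
      using ord_ge_mult[OF ord_ge_const] by (metis add_0)
    show ?thesis unfolding G_def by (intro 2 ord_ge_add 1)
  qed
  moreover have "partial_deriv v (h \<delta>) z = of_real (\<delta> powr (- (s - e (Inl k)))) * G (\<Phi> \<delta> z)"
    if d: "\<delta> \<in> {0<..1}" and z: "z \<in> ball 0 1" for \<delta> z
  proof -
    have "partial_deriv v (h \<delta>) z = partial_deriv v (\<lambda>z. of_real (\<delta> powr (- s)) * F (\<Phi> \<delta> z)) z"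
      by (rule partial_deriv_cong_open[OF open_ball z h[OF d] uniform_differentiable[OF assms(1) d z]])
    also have "\<dots> = of_real (\<delta> powr (- s)) * (c * (of_real (a \<delta> k) * D (Inr k) F (\<Phi> \<delta> z))
        + cnj c * (of_real (a \<delta> k) * D (Inl k) F (\<Phi> \<delta> z)))"
      unfolding partial_deriv_eq[OF has_derivative_mult_right[OF comp_derivative[OF d z F(1)]]] v axis_sum ..
    also have "\<dots> = of_real (\<delta> powr (- s) * \<delta> powr e (Inl k)) * G (\<Phi> \<delta> z)"
      by (simp add: G_def a_def algebra_simps)
    also have "\<delta> powr (- s) * \<delta> powr e (Inl k) = \<delta> powr (- (s - e (Inl k)))"
      by (simp add: powr_add[symmetric])
    finally show ?thesis .
  qed
  ultimately show ?thesis unfolding uniform_def by blast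
qed

definition uniform_vec :: "(real \<Rightarrow> complex ^ 'n \<Rightarrow> complex ^ 'n) \<Rightarrow> bool" where
  "uniform_vec H \<longleftrightarrow> (\<forall>k. uniform (\<lambda>\<delta> z. H \<delta> z $ k))"

lemma uniform_vec_derivative:
  assumes "uniform_vec H" "\<delta> \<in> {0<..1}" "z \<in> ball 0 1"
  shows "(H \<delta> has_derivative (\<lambda>v. \<chi> k. partial_deriv v (\<lambda>z. H \<delta> z $ k) z)) (at z)"
proof (rule has_derivative_vec[OF _ refl])
  fix k
  have "(\<lambda>z. H \<delta> z $ k) differentiable (at z)"
    using uniform_differentiable[OF _ assms(2,3)] assms(1) unfolding uniform_vec_def by blast
  then have "((\<lambda>z. H \<delta> z $ k) has_derivative frechet_derivative (\<lambda>z. H \<delta> z $ k) (at z)) (at z)"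
    using frechet_derivative_works by blast
  then show "((\<lambda>z. H \<delta> z $ k) has_derivative (\<lambda>v. (\<chi> k. partial_deriv v (\<lambda>z. H \<delta> z $ k) z) $ k)) (at z)"
    by (simp add: partial_deriv_def)
qed

lemma uniform_vec_differentiable_on:
  "uniform_vec H \<Longrightarrow> \<delta> \<in> {0<..1} \<Longrightarrow> H \<delta> differentiable_on ball 0 1"
  unfolding differentiable_on_eq_differentiable_at[OF open_ball] differentiable_def
  by (intro ballI exI) (rule uniform_vec_derivative)

lemma uniform_vec_partial_deriv:
  assumes "uniform_vec H" "v \<in> Basis"
  shows "uniform_vec (\<lambda>\<delta>. partial_deriv v (H \<delta>))"
  unfolding uniform_vec_def
proof
  fix k
  have "uniform (\<lambda>\<delta>. partial_deriv v (\<lambda>z. H \<delta> z $ k))"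
    using assms uniform_partial_deriv unfolding uniform_vec_def by blast
  then show "uniform (\<lambda>\<delta> z. partial_deriv v (H \<delta>) z $ k)"
    by (rule uniform_cong) (simp add: partial_deriv_eq[OF uniform_vec_derivative[OF assms(1)]])
qed

lemma uniform_vec_foldr:
  "uniform_vec H \<Longrightarrow> set vs \<subseteq> Basis \<Longrightarrow> uniform_vec (\<lambda>\<delta>. foldr partial_deriv vs (H \<delta>))"
  by (induction vs) (auto intro: uniform_vec_partial_deriv)

lemma uniform_vec_Ck_on:
  "uniform_vec H \<Longrightarrow> \<delta> \<in> {0<..1} \<Longrightarrow> Ck_on n (ball 0 1) (H \<delta>)"
proof (induction n arbitrary: H)
  case 0
  then show ?case using differentiable_imp_continuous_on[OF uniform_vec_differentiable_on] by simp
next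
  case (Suc n)
  have "Ck_on n (ball 0 1) (partial_deriv v (H \<delta>))" if "v \<in> Basis" for v
    by (rule Suc.IH[OF uniform_vec_partial_deriv[OF Suc.prems(1) that] Suc.prems(2)])
  then show ?case using uniform_vec_differentiable_on[OF Suc.prems] by simp
qed

lemma uniform_vec_C_norm:
  assumes "uniform_vec H"
  shows "\<exists>C\<ge>0. \<forall>\<delta>\<in>{0<..1}. C_norm (ball 0 1) (H \<delta>) \<le> ennreal C"
proof -
  have "\<exists>C. \<forall>\<delta>\<in>{0<..1}. \<forall>z\<in>ball 0 1. cmod (H \<delta> z $ k) \<le> C" for k
    using uniform_bounded assms unfolding uniform_vec_def by blast
  then obtain C where C: "\<And>k \<delta> z. \<delta> \<in> {0<..1} \<Longrightarrow> z \<in> ball 0 1 \<Longrightarrow> cmod (H \<delta> z $ k) \<le> C k"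
    by metis
  have bound: "norm (H \<delta> z) \<le> sum C UNIV" if "\<delta> \<in> {0<..1}" "z \<in> ball 0 1" for \<delta> z
  proof -
    have "norm (H \<delta> z) \<le> (\<Sum>k\<in>UNIV. cmod (H \<delta> z $ k))"
      unfolding norm_vec_def by (rule L2_set_le_sum) simp
    also have "\<dots> \<le> sum C UNIV" by (intro sum_mono C that)
    finally show ?thesis .
  qed
  then have "sum C UNIV \<ge> 0" using order_trans[OF norm_ge_zero bound[of 1 0]] by simp
  moreover have "C_norm (ball 0 1) (H \<delta>) \<le> ennreal (sum C UNIV)" if "\<delta> \<in> {0<..1}" for \<delta>
    unfolding C_norm_def by (rule SUP_least) (rule ennreal_leI[OF bound[OF that]])
  ultimately show ?thesis by blast
qed

lemma uniform_vec_Ck_norm: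
  assumes "uniform_vec H"
  shows "(SUP \<delta>\<in>{0<..1}. Ck_norm n (ball 0 1) (H \<delta>)) < \<infinity>"
proof -
  let ?A = "{\<alpha>. set_mset \<alpha> \<subseteq> (Basis :: (complex ^ 'n) set) \<and> size \<alpha> \<le> n}"
  have "\<forall>\<alpha>\<in>?A. \<exists>C\<ge>0. \<forall>\<delta>\<in>{0<..1}. C_norm (ball 0 1) (multi_deriv \<alpha> (H \<delta>)) \<le> ennreal C"
  proof
    fix \<alpha> :: "(complex ^ 'n) multiset" assume "\<alpha> \<in> ?A"
    define es where "es = (SOME es. mset es = \<alpha>)"
    have "mset es = \<alpha>" unfolding es_def by (rule someI_ex) (rule ex_mset)
    then have "set es \<subseteq> Basis" using \<open>\<alpha> \<in> ?A\<close> by auto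
    then show "\<exists>C\<ge>0. \<forall>\<delta>\<in>{0<..1}. C_norm (ball 0 1) (multi_deriv \<alpha> (H \<delta>)) \<le> ennreal C"
      unfolding multi_deriv_def es_def[symmetric] by (intro uniform_vec_C_norm uniform_vec_foldr assms)
  qed
  from bchoice[OF this] obtain C where C: "\<forall>\<alpha>\<in>?A. C \<alpha> \<ge> 0 \<and>
    (\<forall>\<delta>\<in>{0<..1}. C_norm (ball 0 1) (multi_deriv \<alpha> (H \<delta>)) \<le> ennreal (C \<alpha>))" ..
  have "Ck_norm n (ball 0 1) (H \<delta>) \<le> ennreal (sum C ?A)" if "\<delta> \<in> {0<..1}" for \<delta>
  proof -
    have "Ck_norm n (ball 0 1) (H \<delta>) = (\<Sum>\<alpha>\<in>?A. C_norm (ball 0 1) (multi_deriv \<alpha> (H \<delta>)))"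
      using uniform_vec_Ck_on[OF assms that] by (simp add: Ck_norm_def)
    also have "\<dots> \<le> (\<Sum>\<alpha>\<in>?A. ennreal (C \<alpha>))" using C that by (intro sum_mono) blast
    also have "\<dots> = ennreal (sum C ?A)" using C by (intro sum_ennreal) blast
    finally show ?thesis .
  qed
  then have "(SUP \<delta>\<in>{0<..1}. Ck_norm n (ball 0 1) (H \<delta>)) \<le> ennreal (sum C ?A)" by (rule SUP_least)
  then show ?thesis unfolding infinity_ennreal_def by (rule order.strict_trans1) (rule ennreal_less_top)
qed

text \<open>The coefficients of the pullback are the derivatives of the functions \<open>cnj (z\<^sub>q)\<close> of the chart, which
  are \<open>cnj (w q) / a \<delta> q\<close> on the image. The differential of the chart is invertible because the
  matrix \<open>B\<close> of the differentials of \<open>w\<close> and their conjugates is inverse to the matrix of the coordinate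
  derivatives \<open>D\<close>; so the vector determined by these coefficients is the only solution.\<close>

lemma pullback_coeffs:
  assumes d: "\<delta> \<in> {0<..1}" and z: "z \<in> ball 0 1"
  shows "zbar_coeffs (pullback (\<Phi> \<delta>) Y z) $ q = vf_apply Y (\<lambda>z. cnj (w q z)) (\<Phi> \<delta> z) / of_real (a \<delta> q)"
proof -
  note mem = \<Phi>_mem(2)[OF d z]
  define c :: "'n + 'n \<Rightarrow> complex ^ 'n \<Rightarrow> complex" where "c = (\<lambda>i z. case i of Inl k \<Rightarrow> z $ k | Inr k \<Rightarrow> cnj (z $ k :: complex))"
  have c_smooth: "smooth (c i)" for i by (cases i) (auto simp: c_def intro: smooth_coordinate smooth_cnj)
  have tc: "tangent_apply T (c i) y = T $ i" for T i and y :: "complex ^ 'n"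
    by (cases i) (simp_all add: c_def tangent_apply_coordinate tangent_apply_cnj_coordinate)
  have tci: "tangent_apply T (\<lambda>z. c i (\<Phi> \<delta> z)) z = pushforward (\<Phi> \<delta>) z T $ i" for T i
    by (cases i) (simp_all add: c_def pushforward_def)
  let ?y = "\<Phi> \<delta> z"
  define B where "B = (\<lambda>i \<kappa>. tangent_apply (axis i 1) (what \<kappa>) ?y)"
  have BD: "(\<Sum>\<kappa>\<in>UNIV. B i \<kappa> * D \<kappa> (c j) ?y) = (if i = j then 1 else 0)" for i j
    using chain_rule[OF mem, of "axis i 1" "c j"] by (auto simp: B_def tc axis_nth_if)
  have DB: "(\<Sum>j\<in>UNIV. D \<kappa> (c j) ?y * B j \<mu>) = (if \<kappa> = \<mu> then 1 else 0)" for \<kappa> \<mu>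
    by (rule left_inverse_from_right[where M = B and N = "\<lambda>\<kappa> j. D \<kappa> (c j) ?y"]) (rule BD)
  define t :: "complex ^ ('n + 'n) \<Rightarrow> 'n + 'n \<Rightarrow> complex" where "t = (\<lambda>T \<kappa>. case \<kappa> of Inl k \<Rightarrow> of_real (a \<delta> k) * T $ Inr k | Inr k \<Rightarrow> of_real (a \<delta> k) * T $ Inl k)"
  have push: "pushforward (\<Phi> \<delta>) z T $ i = (\<Sum>\<kappa>\<in>UNIV. t T \<kappa> * D \<kappa> (c i) ?y)" for T i
    unfolding tci[symmetric] comp_tangent_apply[OF d z c_smooth] sum_UNIV_sum
    by (simp add: t_def sum.distrib algebra_simps)
  have inv: "(\<Sum>j\<in>UNIV. pushforward (\<Phi> \<delta>) z T $ j * B j \<mu>) = t T \<mu>" for T \<mu>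
  proof -
    have "(\<Sum>j\<in>UNIV. pushforward (\<Phi> \<delta>) z T $ j * B j \<mu>) = (\<Sum>\<kappa>\<in>UNIV. t T \<kappa> * (\<Sum>j\<in>UNIV. D \<kappa> (c j) ?y * B j \<mu>))"
      by (simp add: push sum_distrib_left sum_distrib_right mult.assoc) (rule sum.swap)
    then show ?thesis by (simp add: DB if_distrib[of "\<lambda>x. _ * x"] cong: if_cong)
  qed
  have anz: "complex_of_real (a \<delta> k) \<noteq> 0" for k using a_pos[OF d, of k] by simp
  define X :: "complex ^ ('n + 'n)" where "X = (\<chi> i. case i of
      Inl k \<Rightarrow> vf_apply Y (what (Inr k)) ?y / of_real (a \<delta> k) | Inr k \<Rightarrow> vf_apply Y (what (Inl k)) ?y / of_real (a \<delta> k))"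
  have tX: "t X \<kappa> = vf_apply Y (what \<kappa>) ?y" for \<kappa>
    using anz by (cases \<kappa>) (simp_all add: t_def X_def)
  have X_push: "pushforward (\<Phi> \<delta>) z X = Y ?y"
  proof -
    have "Y ?y $ i = (\<Sum>\<kappa>\<in>UNIV. t X \<kappa> * D \<kappa> (c i) ?y)" for i
      using chain_rule[OF mem, of "Y ?y" "c i"] by (simp only: tc tX vf_apply_def)
    then show ?thesis by (simp add: vec_eq_iff push)
  qed
  moreover have "T = X" if "pushforward (\<Phi> \<delta>) z T = Y ?y" for T
  proof -
    have tt: "t T \<mu> = t X \<mu>" for \<mu>
      using inv[of T \<mu>] inv[of X \<mu>] unfolding that X_push by simp
    have "T $ i = X $ i" for i
      using tt[of "Inr (projl i)"] tt[of "Inl (projr i)"] anz by (cases i) (simp_all add: t_def)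
    then show ?thesis by (simp add: vec_eq_iff)
  qed
  ultimately have "pullback (\<Phi> \<delta>) Y z = X" unfolding pullback_def by (rule the_equality)
  then show ?thesis by (simp add: zbar_coeffs_def X_def)
qed

definition rescale :: "real \<Rightarrow> complex ^ 'n \<Rightarrow> complex ^ 'n" where
  "rescale \<delta> z = (\<chi> k. z $ k / of_real (a \<delta> k))"

lemma rescale_matrix: "rescale \<delta> = (*v) (\<chi> i j. if i = j then 1 / of_real (a \<delta> i) else 0)"
  by (auto simp: rescale_def matrix_vector_mult_def fun_eq_iff vec_eq_iff if_distrib[of "\<lambda>x. x * _"] cong: if_cong)

lemma rescale_S: "\<delta> \<in> {0<..1} \<Longrightarrow> rescale \<delta> (S \<delta> z) = z" "\<delta> \<in> {0<..1} \<Longrightarrow> S \<delta> (rescale \<delta> z) = z"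
  using a_pos[of \<delta>] by (simp_all add: rescale_def S_def vec_eq_iff less_imp_neq[symmetric])

lemma rescale_derivative: "(rescale \<delta> has_derivative rescale \<delta>) (at z)"
  unfolding rescale_matrix
  using linear_matrix_complex linear_conv_bounded_linear bounded_linear_imp_has_derivative by blast

lemma \<Phi>_biholomorphism:
  assumes d: "\<delta> \<in> {0<..1}"
  shows "biholomorphism (\<Phi> \<delta>) (ball 0 1) (\<Phi> \<delta> ` ball 0 1)" "p \<in> \<Phi> \<delta> ` ball 0 1" "\<Phi> \<delta> ` ball 0 1 \<subseteq> U0"
proof -
  let ?W = "\<Phi> \<delta> ` ball 0 1"
  have left_inv: "rescale \<delta> (wmap (\<Phi> \<delta> z)) = z" if "z \<in> ball 0 1" for z
    using \<Phi>_mem(3)[OF d that] rescale_S(1)[OF d] by simp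
  have inj: "inj_on (\<Phi> \<delta>) (ball 0 1)" by (rule inj_on_inverseI[of _ "\<lambda>y. rescale \<delta> (wmap y)"]) (rule left_inv)
  have W: "?W = U' \<inter> (\<lambda>y. rescale \<delta> (wmap y)) -` ball 0 1"
  proof (intro equalityI subsetI)
    fix y assume "y \<in> ?W"
    then show "y \<in> U' \<inter> (\<lambda>y. rescale \<delta> (wmap y)) -` ball 0 1"
      using \<Phi>_mem(1)[OF d] left_inv by auto
  next
    fix y assume y: "y \<in> U' \<inter> (\<lambda>y. rescale \<delta> (wmap y)) -` ball 0 1"
    have "g (wmap y) = y" using homeo y unfolding homeomorphism_def by blast
    then have "\<Phi> \<delta> (rescale \<delta> (wmap y)) = y" by (simp add: \<Phi>_def rescale_S(2)[OF d])
    then show "y \<in> ?W" using y by (metis IntD2 imageI vimageD)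
  qed
  have "continuous_on U' (\<lambda>y. rescale \<delta> (wmap y))"
  proof (rule continuous_at_imp_continuous_on, rule ballI)
    fix y assume "y \<in> U'"
    then have "((\<lambda>y. rescale \<delta> (wmap y)) has_derivative (\<lambda>v. rescale \<delta> (jac y *v v))) (at y)"
      using U'(2) by (intro has_derivative_compose[OF wmap_derivative rescale_derivative]) auto
    then show "isCont (\<lambda>y. rescale \<delta> (wmap y)) y" by (rule has_derivative_continuous)
  qed
  then have oW: "open ?W" unfolding W using U'(1) by (intro continuous_open_preimage) auto
  have the_inv: "the_inv_into (ball 0 1) (\<Phi> \<delta>) y = rescale \<delta> (wmap y)" if "y \<in> ?W" for y
    using that left_inv by (auto intro!: the_inv_into_f_eq[OF inj])
  have "holomorphic_map_on (ball 0 1) (\<Phi> \<delta>)"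
    unfolding holomorphic_map_on_def by (meson \<Phi>_derivative[OF d])
  moreover have "holomorphic_map_on ?W (the_inv_into (ball 0 1) (\<Phi> \<delta>))"
    unfolding holomorphic_map_on_def
  proof
    fix y assume y: "y \<in> ?W"
    then have "y \<in> U0" using W U'(2) by blast
    then have "((\<lambda>y. rescale \<delta> (wmap y)) has_derivative (\<lambda>v. rescale \<delta> (jac y *v v))) (at y)"
      by (intro has_derivative_compose[OF wmap_derivative rescale_derivative])
    then have "(the_inv_into (ball 0 1) (\<Phi> \<delta>) has_derivative (\<lambda>v. rescale \<delta> (jac y *v v))) (at y)"
      by (rule has_derivative_transform_within_open[OF _ oW y]) (simp add: the_inv)
    then show "\<exists>A. (the_inv_into (ball 0 1) (\<Phi> \<delta>) has_derivative (*v) A) (at y)"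
      unfolding rescale_matrix matrix_vector_mul_assoc by blast
  qed
  ultimately show "biholomorphism (\<Phi> \<delta>) (ball 0 1) ?W"
    using oW inj by (simp add: biholomorphism_def bij_betw_def)
  show "p \<in> ?W" using \<Phi>_0[of \<delta>] by (metis centre_in_ball imageI zero_less_one)
  show "?W \<subseteq> U0" using W U'(2) by blast
qed

lemma pullback_Ck_norm:
  assumes F: "\<And>k. smooth (vf_apply Y (\<lambda>z. cnj (w k z)))" "\<And>r k. ord_ge r (e (Inl k) - s) (vf_apply Y (\<lambda>z. cnj (w k z)))"
    and Y: "\<And>\<delta> z. Y\<delta> \<delta> z = of_real (\<delta> powr s) *s Y z"
  shows "(SUP \<delta>\<in>{0<..1}. Ck_norm n (ball 0 1) (\<lambda>z. zbar_coeffs (pullback (\<Phi> \<delta>) (Y\<delta> \<delta>) z))) < \<infinity>"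
proof (rule uniform_vec_Ck_norm, unfold uniform_vec_def, rule allI)
  fix k
  have "zbar_coeffs (pullback (\<Phi> \<delta>) (Y\<delta> \<delta>) z) $ k
      = of_real (\<delta> powr (- (e (Inl k) - s))) * (of_real (1 / \<epsilon>) * vf_apply Y (\<lambda>z. cnj (w k z)) (\<Phi> \<delta> z))"
    if d: "\<delta> \<in> {0<..1}" and z: "z \<in> ball 0 1" for \<delta> z
  proof -
    have "\<delta> powr (- (e (Inl k) - s)) = \<delta> powr s / \<delta> powr e (Inl k)"
      by (simp add: powr_diff)
    then show ?thesis
      unfolding pullback_coeffs[OF d z] vf_apply_def Y tangent_apply_scale_left by (simp add: a_def)
  qed
  moreover have "smooth (\<lambda>z. of_real (1 / \<epsilon>) * vf_apply Y (\<lambda>z. cnj (w k z)) z)" by (intro smooth_mult smooth_const F)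
  moreover have "ord_ge r (e (Inl k) - s) (\<lambda>z. of_real (1 / \<epsilon>) * vf_apply Y (\<lambda>z. cnj (w k z)) z)" for r
    using ord_ge_mult[OF ord_ge_const F(2)] by (metis add_0)
  ultimately show "uniform (\<lambda>\<delta> z. zbar_coeffs (pullback (\<Phi> \<delta>) (Y\<delta> \<delta>) z) $ k)"
    unfolding uniform_def by (intro exI[of _ "\<lambda>z. of_real (1 / \<epsilon>) * vf_apply Y (\<lambda>z. cnj (w k z)) z"] exI[of _ "e (Inl k) - s"]) simp
qed

text \<open>The powers of \<open>\<delta>\<close> contributed by the fields and by the dilation cancel, since the fields of the frame
  and the coordinates have the same weights.\<close>

lemma pullback_det:
  assumes d: "\<delta> \<in> {0<..1}" and z: "z \<in> ball 0 1"
    and Y: "\<And>q z. Y q z = of_real (\<delta> powr e (Inl q)) *s Z (Inl q) z"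
  shows "cmod (det (\<chi> r q. zbar_coeffs (pullback (\<Phi> \<delta>) (Y q) z) $ r)) \<ge> (1 / \<epsilon>) ^ CARD('n) / 2"
proof -
  let ?m = "\<lambda>r q. vf_apply (Z (Inl q)) (what (Inl r)) (\<Phi> \<delta> z)"
  let ?A = "\<lambda>r. complex_of_real (1 / a \<delta> r)" and ?B = "\<lambda>q. complex_of_real (\<delta> powr e (Inl q))"
  have "zbar_coeffs (pullback (\<Phi> \<delta>) (Y q) z) $ r = ?A r * ?B q * ?m r q" for r q
  proof -
    have "vf_apply (Y q) h y = ?B q * vf_apply (Z (Inl q)) h y" for h y
      unfolding vf_apply_def Y by (rule tangent_apply_scale_left)
    then show ?thesis by (simp add: pullback_coeffs[OF d z])
  qed
  then have "(\<chi> r q. zbar_coeffs (pullback (\<Phi> \<delta>) (Y q) z) $ r) = (\<chi> r q. ?A r * ?B q * ?m r q)"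
    by (simp only:)
  then have "det (\<chi> r q. zbar_coeffs (pullback (\<Phi> \<delta>) (Y q) z) $ r) = prod ?A UNIV * prod ?B UNIV * det (\<chi> r q. ?m r q)"
    by (simp only: det_scale_rows_columns)
  also have "prod ?A UNIV * prod ?B UNIV = (\<Prod>r\<in>UNIV. ?A r * ?B r)" by (rule prod.distrib[symmetric])
  also have "\<dots> = of_real (1 / \<epsilon>) ^ CARD('n)"
    using d by (simp add: a_def)
  finally have "cmod (det (\<chi> r q. zbar_coeffs (pullback (\<Phi> \<delta>) (Y q) z) $ r)) = (1 / \<epsilon>) ^ CARD('n) * cmod (det (\<chi> r q. ?m r q))"
    using eps by (simp add: norm_mult norm_power norm_divide)
  also have "\<dots> \<ge> (1 / \<epsilon>) ^ CARD('n) * (1 / 2)"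
    using det_ge[OF S_in_V(1)[OF d z]] eps by (intro mult_left_mono) (auto simp: \<Phi>_def)
  finally show ?thesis by simp
qed

end

section \<open>A frame of minimal weight\<close>

text \<open>A spanning family contains a basis, and the matrix with a basis as rows is invertible.\<close>

lemma exists_invertible_rows:
  fixes l :: "'m::finite \<Rightarrow> complex ^ 'n::finite"
  assumes "vec.span (range l) = UNIV"
  obtains J :: "'n \<Rightarrow> 'm" where "det (\<chi> i k. l (J i) $ k) \<noteq> 0"
proof -
  obtain B where B: "B \<subseteq> range l" "vec.independent B" "range l \<subseteq> vec.span B"
    using vec.maximal_independent_subset by blast
  have span: "vec.span B = UNIV"
    using assms vec.span_minimal[OF B(3) vec.subspace_span] by blast
  have "card B = vec.dim (UNIV :: (complex ^ 'n) set)"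
    by (rule vec.basis_card_eq_dim) (use B span in auto)
  then have card: "card B = CARD('n)" by (simp only: vec_dim_card)
  then obtain h where h: "bij_betw h (UNIV :: 'n set) B"
    using finite_same_card_bij[of "UNIV :: 'n set" B] B(1) finite_subset[OF B(1)] by auto
  have "\<exists>j. h i = l j" for i using h B(1) by (auto simp: bij_betw_def)
  then obtain J where J: "\<And>i. h i = l (J i)" by metis
  have "rows (\<chi> i k. l (J i) $ k) = B"
  proof -
    have "row i (\<chi> i k. l (J i) $ k) = h i" for i by (simp add: row_def J vec_eq_iff)
    then have "rows (\<chi> i k. l (J i) $ k) = range h" by (auto simp: rows_def)
    then show ?thesis using h by (simp add: bij_betw_def)
  qed
  then have "\<exists>A :: complex ^ 'n ^ 'n. A ** (\<chi> i k. l (J i) $ k) = mat 1"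
    using matrix_left_invertible_span_rows_gen span by blast
  then have "det (\<chi> i k. l (J i) $ k) \<noteq> 0"
    by (metis det_I det_mul mult_zero_right zero_neq_one)
  then show ?thesis by (rule that)
qed

text \<open>Steinitz exchange: replacing a member of a basis of minimal total weight by a vector with a
  nonzero coefficient there gives a basis again, so it cannot lower the weight.\<close>

lemma exists_minimal_frame:
  fixes l :: "'m::finite \<Rightarrow> complex ^ 'n::finite" and d :: "'m \<Rightarrow> real"
  assumes "vec.span (range l) = UNIV"
  obtains J :: "'n \<Rightarrow> 'm" where "det (\<chi> i k. l (J i) $ k) \<noteq> 0"
    "\<And>x p i. l p = (\<Sum>i\<in>UNIV. x $ i *s l (J i)) \<Longrightarrow> d p < d (J i) \<Longrightarrow> x $ i = 0"
proof -
  let ?S = "{J :: 'n \<Rightarrow> 'm. det (\<chi> i k. l (J i) $ k) \<noteq> 0}"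
  obtain J0 where "J0 \<in> ?S" using exists_invertible_rows[OF assms] by blast
  then obtain J where J: "is_arg_min (\<lambda>J. \<Sum>i\<in>UNIV. d (J i)) (\<lambda>J. J \<in> ?S) J"
    using ex_is_arg_min_if_finite[of ?S "\<lambda>J. \<Sum>i\<in>UNIV. d (J i)"] by auto
  then have det: "det (\<chi> i k. l (J i) $ k) \<noteq> 0" by (simp add: is_arg_min_def)
  have "x $ q = 0" if p: "l p = (\<Sum>i\<in>UNIV. x $ i *s l (J i))" and less: "d p < d (J q)" for x p q
  proof (rule ccontr)
    assume ne: "x $ q \<noteq> 0"
    let ?A = "\<chi> i k. l (J i) $ k"
    have row: "row i ?A = l (J i)" for i by (simp add: row_def vec_eq_iff)
    have "(\<chi> i k. l ((J(q := p)) i) $ k) = (\<chi> i. if i = q then sum (\<lambda>i. x $ i *s row i ?A) UNIV else row i ?A)"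
      by (auto simp: vec_eq_iff row_def p)
    then have "det (\<chi> i k. l ((J(q := p)) i) $ k) = x $ q * det ?A"
      using cramer_lemma_transpose[of q x ?A] by simp
    then have "J(q := p) \<in> ?S" using ne det by simp
    moreover have "(\<Sum>i\<in>UNIV. d ((J(q := p)) i)) < (\<Sum>i\<in>UNIV. d (J i))"
    proof -
      have "(\<Sum>i\<in>UNIV. d ((J(q := p)) i)) = d p + (\<Sum>i\<in>UNIV - {q}. d (J i))"
        by (subst sum.remove[of _ q]) (auto intro!: sum.cong)
      also have "\<dots> < d (J q) + (\<Sum>i\<in>UNIV - {q}. d (J i))" using less by simp
      also have "\<dots> = (\<Sum>i\<in>UNIV. d (J i))" by (subst (2) sum.remove[of _ q]) auto
      finally show ?thesis .
    qed
    ultimately show False using J by (auto simp: is_arg_min_def)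
  qed
  then show ?thesis using that[OF det] by blast
qed

section \<open>Lie brackets of scaled and conjugate fields\<close>

lemma lie_bracket_antisym: "lie_bracket V Y z = - lie_bracket Y V z"
  by (simp add: lie_bracket_def vec_eq_iff)

lemma lie_bracket_scale:
  assumes "\<And>i. (\<lambda>w. V w $ i) differentiable (at z)" "\<And>i. (\<lambda>w. Y w $ i) differentiable (at z)"
  shows "lie_bracket (\<lambda>w. r *s V w) (\<lambda>w. s *s Y w) z = (r * s) *s lie_bracket V Y z"
proof -
  have "vf_apply (\<lambda>w. r *s V w) (\<lambda>w. (s *s Y w) $ i) z = r * (s * vf_apply V (\<lambda>w. Y w $ i) z)"
    if "(\<lambda>w. Y w $ i) differentiable (at z)" for V Y :: "'a cvf" and i r s
    using that by (simp add: vf_apply_def tangent_apply_scale_left tangent_apply_cmult)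
  then show ?thesis using assms by (simp add: lie_bracket_def vec_eq_iff algebra_simps)
qed

lemma lie_bracket_cnj:
  assumes "\<And>i. (\<lambda>w. V w $ i) differentiable (at z)" "\<And>i. (\<lambda>w. Y w $ i) differentiable (at z)"
  shows "lie_bracket (cnj_vf V) (cnj_vf Y) z = cnj_tangent (lie_bracket V Y z)"
proof -
  have "vf_apply (cnj_vf V) (\<lambda>w. cnj (Y w $ i)) z = cnj (vf_apply V (\<lambda>w. Y w $ i) z)"
    if "(\<lambda>w. Y w $ i) differentiable (at z)" for V Y :: "'a cvf" and i
    using vf_apply_cnj[OF that, of "cnj_vf V"] by (simp add: vf_apply_def cnj_vf_eq)
  then have "lie_bracket (cnj_vf V) (cnj_vf Y) z $ i = cnj_tangent (lie_bracket V Y z) $ i" for i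
    using assms by (cases i) (simp_all add: lie_bracket_def cnj_vf_eq[abs_def])
  then show ?thesis by (simp add: vec_eq_iff)
qed

text \<open>The bounds refer to the point \<open>p\<close> only, so the neighbourhoods may be shrunk.\<close>

lemma bdd_subset:
  assumes "bounded_calculus I U p" "bounded_calculus I U' p" "\<And>\<delta>. \<delta> \<in> I \<Longrightarrow> U' \<delta> \<subseteq> U \<delta>"
  shows "bounded_calculus.bdd X e I U p r F \<Longrightarrow> bounded_calculus.bdd X e I U' p r F"
proof (induction r arbitrary: F)
  case 0
  then show ?case
    using assms(3) by (auto simp: bounded_calculus.bdd.simps[OF assms(1)] bounded_calculus.bdd.simps[OF assms(2)]
        bounded_calculus.base_bdd_def[OF assms(1)] bounded_calculus.base_bdd_def[OF assms(2)] intro: differentiable_on_subset)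
next
  case (Suc r)
  have "bounded_calculus.base_bdd I U p F" "\<And>i. bounded_calculus.bdd X e I U p r (bounded_calculus.scaled_deriv X e i F)"
    using Suc.prems unfolding bounded_calculus.bdd.simps[OF assms(1)] by blast+
  moreover from this(1) have "bounded_calculus.base_bdd I U' p F"
    using assms(3) unfolding bounded_calculus.base_bdd_def[OF assms(1)] bounded_calculus.base_bdd_def[OF assms(2)]
    by (blast intro: differentiable_on_subset)
  ultimately show ?case
    unfolding bounded_calculus.bdd.simps[OF assms(2)] using Suc.IH by blast
qed

lemma with_cnj_simps [simp]: "with_cnj V (Inl j) = V j" "with_cnj V (Inr j) = cnj_vf (V j)"
  by (simp_all add: with_cnj_def)

section \<open>The frame attached to the scaled fields\<close>

text \<open>The data of the theorem together with the choice \<open>J\<close> of fields that form a frame at \<open>p\<close>. The condition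
  \<open>J_min\<close> states minimality of the total weight in the form in which it is used.\<close>

locale scaled_fields =
  fixes W :: "(complex ^ 'n::finite) set" and p :: "complex ^ 'n"
    and L :: "'m::finite \<Rightarrow> 'n cvf" and d :: "'m \<Rightarrow> real" and W' :: "real \<Rightarrow> (complex ^ 'n) set"
    and c1 c2 c3 :: "'m \<Rightarrow> 'm \<Rightarrow> 'm \<Rightarrow> real \<Rightarrow> complex ^ 'n \<Rightarrow> complex"
    and b :: "'m \<Rightarrow> 'n \<Rightarrow> complex ^ 'n \<Rightarrow> complex" and J :: "'n \<Rightarrow> 'm"
  assumes open_W: "open W" and p_in_W: "p \<in> W"
    and b_smooth: "smooth_on W (b j k)"
    and L_Inl: "z \<in> W \<Longrightarrow> L j z $ Inl k = 0" and L_Inr: "z \<in> W \<Longrightarrow> L j z $ Inr k = b j k z"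
    and d_ge_1: "d j \<ge> 1"
    and W': "\<delta> \<in> {0<..1} \<Longrightarrow> open (W' \<delta>) \<and> p \<in> W' \<delta>"
    and c1: "\<delta> \<in> {0<..1} \<Longrightarrow> z \<in> W' \<delta> \<Longrightarrow>
           lie_bracket (scaled_vf d \<delta> L j) (scaled_vf d \<delta> L j') z
             = (\<Sum>l\<in>UNIV. c1 j j' l \<delta> z *s scaled_vf d \<delta> L l z)"
    and c23: "\<delta> \<in> {0<..1} \<Longrightarrow> z \<in> W' \<delta> \<Longrightarrow>
           lie_bracket (scaled_vf d \<delta> L j) (scaled_vf d \<delta> (\<lambda>i. cnj_vf (L i)) j') z
             = (\<Sum>l\<in>UNIV. c2 j j' l \<delta> z *s scaled_vf d \<delta> L l z)
             + (\<Sum>l\<in>UNIV. c3 j j' l \<delta> z *s scaled_vf d \<delta> (\<lambda>i. cnj_vf (L i)) l z)"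
    and c_diff: "c \<in> {c1, c2, c3} \<Longrightarrow> \<delta> \<in> {0<..1} \<Longrightarrow>
           iter_apply (with_cnj (scaled_vf d \<delta> L)) s (c j j' l \<delta>) differentiable_on W' \<delta>"
    and c_bound: "c \<in> {c1, c2, c3} \<Longrightarrow>
           (SUP \<delta>\<in>{0<..1}. C_norm (W' \<delta>) (iter_apply (with_cnj (scaled_vf d \<delta> L)) s (c j j' l \<delta>))) < \<infinity>"
    and J_det: "det (\<chi> i k. L (J i) p $ Inr k) \<noteq> 0"
    and J_min: "L q p = (\<Sum>i\<in>UNIV. x $ i *s L (J i) p) \<Longrightarrow> d q < d (J i) \<Longrightarrow> x $ i = 0"
begin

definition \<Lambda> :: "'m + 'm \<Rightarrow> 'n cvf" where "\<Lambda> = with_cnj L"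
definition dd :: "'m + 'm \<Rightarrow> real" where "dd s = (case s of Inl j \<Rightarrow> d j | Inr j \<Rightarrow> d j)"
abbreviation T :: "'n + 'n \<Rightarrow> 'm + 'm" where "T \<equiv> map_sum J J"
definition Z :: "'n + 'n \<Rightarrow> 'n cvf" where "Z s = \<Lambda> (T s)"
definition e :: "'n + 'n \<Rightarrow> real" where "e s = dd (T s)"
definition A :: "complex ^ 'n \<Rightarrow> complex ^ 'n ^ 'n" where "A z = (\<chi> i k. b (J i) k z)"
definition U0 :: "(complex ^ 'n) set" where "U0 = {z \<in> W. det (A z) \<noteq> 0}"
definition U :: "real \<Rightarrow> (complex ^ 'n) set" where "U \<delta> = U0 \<inter> W' \<delta>"

lemma dd_simps [simp]: "dd (Inl j) = d j" "dd (Inr j) = d j"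
  by (simp_all add: dd_def)

lemma e_simps [simp]: "e (Inl i) = d (J i)" "e (Inr i) = d (J i)"
  by (simp_all add: e_def)

lemma \<Lambda>_simps [simp]: "\<Lambda> (Inl j) = L j" "\<Lambda> (Inr j) = cnj_vf (L j)"
  by (simp_all add: \<Lambda>_def)

lemma Z_simps [simp]: "Z (Inl i) = L (J i)" "Z (Inr i) = cnj_vf (L (J i))"
  by (simp_all add: Z_def)

interpretation W: smooth_calculus W p
  using open_W p_in_W by unfold_locales

lemma open_U0: "open U0"
proof -
  have "W.smooth (b j k)" for j k by (rule W.smooth_if_smooth_on[OF b_smooth]) simp
  then show ?thesis
    unfolding U0_def by (intro open_det_nonzero open_W) (simp add: A_def W.smooth_differentiable)
qed

lemma p_in_U0: "p \<in> U0"
  using p_in_W J_det by (simp add: U0_def A_def L_Inr)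

lemma U0_W: "z \<in> U0 \<Longrightarrow> z \<in> W"
  by (simp add: U0_def)

sublocale smooth_calculus U0 p
  using open_U0 p_in_U0 by unfold_locales

lemma coefficient_smooth: "smooth (b j k)"
  by (rule smooth_if_smooth_on[OF b_smooth]) (auto simp: U0_def)

lemma L_smooth: "smooth (\<lambda>z. L j z $ i)"
proof (cases i)
  case (Inl k)
  show ?thesis by (rule smooth_cong[OF smooth_const[of 0]]) (simp add: Inl L_Inl U0_W)
next
  case (Inr k)
  show ?thesis by (rule smooth_cong[OF coefficient_smooth[of j k]]) (simp add: Inr L_Inr U0_W)
qed

lemma \<Lambda>_smooth: "smooth (\<lambda>z. \<Lambda> s z $ i)"
proof (cases s)
  case (Inr j)
  then show ?thesis by (cases i) (simp_all add: cnj_vf_eq smooth_cnj L_smooth)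
qed (simp add: L_smooth)

sublocale weighted_calculus U0 p Z e U
proof unfold_locales
  show "open (U \<delta>)" "p \<in> U \<delta>" if "\<delta> \<in> {0<..1}" for \<delta>
    using W'[OF that] open_U0 p_in_U0 by (auto simp: U_def)
  show "U \<delta> \<subseteq> U0" for \<delta> by (auto simp: U_def)
  show "1 \<le> e s" for s by (cases s) (simp_all add: d_ge_1)
  show "smooth (\<lambda>z. Z s z $ i)" for s i unfolding Z_def by (rule \<Lambda>_smooth)
qed

text \<open>The inverse of the matrix of the frame, which consists of the block \<open>A\<close> and its conjugate.\<close>

definition \<Gamma> :: "'n + 'n \<Rightarrow> 'n + 'n \<Rightarrow> complex ^ 'n \<Rightarrow> complex" where
  "\<Gamma> k i z = (case k of
      Inl k \<Rightarrow> (case i of Inl i \<Rightarrow> 0 | Inr i \<Rightarrow> cnj (matrix_inv (A z) $ k $ i))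
    | Inr k \<Rightarrow> (case i of Inl i \<Rightarrow> matrix_inv (A z) $ k $ i | Inr i \<Rightarrow> 0))"

lemma Z_\<Gamma>:
  assumes z: "z \<in> U0"
  shows "(\<Sum>k\<in>UNIV. Z s z $ k * \<Gamma> k i z) = (if s = i then 1 else 0)"
proof -
  have "A z ** matrix_inv (A z) = mat 1" using z by (intro matrix_inv_right_inverse) (simp add: U0_def)
  then have 1: "(\<Sum>k\<in>UNIV. b (J i) k z * matrix_inv (A z) $ k $ j) = (if i = j then 1 else 0)" for i j
    by (simp add: matrix_matrix_mult_def vec_eq_iff mat_def A_def)
  have "(\<Sum>k\<in>UNIV. cnj (b (J i) k z) * cnj (matrix_inv (A z) $ k $ j)) = cnj (\<Sum>k\<in>UNIV. b (J i) k z * matrix_inv (A z) $ k $ j)" for i j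
    by simp
  then have 2: "(\<Sum>k\<in>UNIV. cnj (b (J i) k z) * cnj (matrix_inv (A z) $ k $ j)) = (if i = j then 1 else 0)" for i j
    unfolding 1 by simp
  show ?thesis
    by (cases s; cases i) (simp_all add: sum_UNIV_sum \<Gamma>_def L_Inl L_Inr U0_W[OF z] cnj_vf_eq 1 2)
qed

lemma \<Gamma>_Z:
  assumes z: "z \<in> U0"
  shows "(\<Sum>s\<in>UNIV. \<Gamma> i s z * Z s z $ j) = (if i = j then 1 else 0)"
  by (rule left_inverse_from_right[where M = "\<lambda>s k. Z s z $ k" and N = "\<lambda>k i. \<Gamma> k i z"]) (rule Z_\<Gamma>[OF z])

lemma \<Gamma>_smooth: "smooth (\<Gamma> k i)"
  by (rule smooth_inverse_matrix[where M = "\<lambda>s k z. Z s z $ k"]) (rule Z_\<Gamma>, assumption, rule Z_smooth)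

definition coef :: "'n + 'n \<Rightarrow> complex ^ 'n \<Rightarrow> complex ^ ('n + 'n) \<Rightarrow> complex" where
  "coef k z X = (\<Sum>i\<in>UNIV. X $ i * \<Gamma> i k z)"

lemma coef_linear:
  "coef k z (X + Y) = coef k z X + coef k z Y" "coef k z (r *s X) = r * coef k z X" "coef k z 0 = 0"
  by (simp_all add: coef_def sum.distrib sum_distrib_left algebra_simps)

lemma coef_sum: "coef k z (\<Sum>i\<in>S. X i) = (\<Sum>i\<in>S. coef k z (X i))"
  by (induction S rule: infinite_finite_induct) (simp_all add: coef_linear)

lemma coef_Z: "z \<in> U0 \<Longrightarrow> coef k z (Z s z) = (if s = k then 1 else 0)"
  by (simp add: coef_def Z_\<Gamma>)

lemma frame_coef:
  assumes z: "z \<in> U0"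
  shows "X = (\<Sum>k\<in>UNIV. coef k z X *s Z k z)"
proof -
  have "(\<Sum>k\<in>UNIV. coef k z X * Z k z $ j) = X $ j" for j
  proof -
    have "(\<Sum>k\<in>UNIV. coef k z X * Z k z $ j) = (\<Sum>i\<in>UNIV. X $ i * (\<Sum>k\<in>UNIV. \<Gamma> i k z * Z k z $ j))"
      unfolding coef_def by (simp add: sum_distrib_left sum_distrib_right mult.assoc) (rule sum.swap)
    then show ?thesis by (simp add: \<Gamma>_Z[OF z] if_distrib[of "\<lambda>x. _ * x"] cong: if_cong)
  qed
  then show ?thesis by (simp add: vec_eq_iff)
qed

definition \<alpha> :: "'m + 'm \<Rightarrow> 'n + 'n \<Rightarrow> complex ^ 'n \<Rightarrow> complex" where
  "\<alpha> s k z = coef k z (\<Lambda> s z)"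

lemma \<alpha>_smooth: "smooth (\<alpha> s k)"
  unfolding \<alpha>_def[abs_def] coef_def by (intro smooth_sum smooth_mult \<Lambda>_smooth \<Gamma>_smooth)

lemma \<Lambda>_expand: "z \<in> U0 \<Longrightarrow> \<Lambda> s z = (\<Sum>k\<in>UNIV. \<alpha> s k z *s Z k z)"
  unfolding \<alpha>_def by (rule frame_coef)

text \<open>For the antiholomorphic fields this is minimality of the frame, and the conjugate fields have the
  conjugate coefficients. It is what starts the induction in \<open>bdd_\<alpha>\<close>: the values at \<open>p\<close> carry no
  negative powers of \<open>\<delta>\<close>.\<close>

lemma \<alpha>_p:
  assumes "dd s < e k"
  shows "\<alpha> s k p = 0"
proof -
  have L: "L q p = (\<Sum>i\<in>UNIV. \<alpha> (Inl q) (Inl i) p *s L (J i) p)" and z: "\<alpha> (Inl q) (Inr i) p = 0" for q i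
  proof -
    have 0: "\<alpha> (Inl q) (Inr i) p = 0" for i
      by (simp add: \<alpha>_def coef_def sum_UNIV_sum \<Gamma>_def L_Inl p_in_W)
    then show "\<alpha> (Inl q) (Inr i) p = 0" .
    show "L q p = (\<Sum>i\<in>UNIV. \<alpha> (Inl q) (Inl i) p *s L (J i) p)"
      using \<Lambda>_expand[OF p_in_U0, of "Inl q"] by (simp add: sum_UNIV_sum 0)
  qed
  have 1: "\<alpha> (Inl q) (Inl i) p = 0" if "d q < d (J i)" for q i
  proof -
    have "(\<chi> i. \<alpha> (Inl q) (Inl i) p) $ i = 0"
      by (rule J_min[OF _ that]) (simp only: vec_lambda_beta, rule L)
    then show ?thesis by simp
  qed
  have 2: "\<alpha> (Inr q) (Inr i) p = cnj (\<alpha> (Inl q) (Inl i) p)" and 3: "\<alpha> (Inr q) (Inl i) p = 0" for q i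
    by (simp_all add: \<alpha>_def coef_def sum_UNIV_sum \<Gamma>_def L_Inl p_in_W cnj_vf_eq)
  show ?thesis using assms 1 2 3 z by (cases s; cases k) auto
qed

text \<open>The coefficients of all brackets between the fields and their conjugates. The cases that are not
  given follow from antisymmetry and conjugation.\<close>

definition C :: "'m + 'm \<Rightarrow> 'm + 'm \<Rightarrow> 'm + 'm \<Rightarrow> real \<Rightarrow> complex ^ 'n \<Rightarrow> complex" where
  "C s t r \<delta> z = (case s of
      Inl j \<Rightarrow> (case t of
          Inl k \<Rightarrow> (case r of Inl l \<Rightarrow> c1 j k l \<delta> z | Inr l \<Rightarrow> 0)
        | Inr k \<Rightarrow> (case r of Inl l \<Rightarrow> c2 j k l \<delta> z | Inr l \<Rightarrow> c3 j k l \<delta> z))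
    | Inr j \<Rightarrow> (case t of
          Inl k \<Rightarrow> (case r of Inl l \<Rightarrow> - c2 k j l \<delta> z | Inr l \<Rightarrow> - c3 k j l \<delta> z)
        | Inr k \<Rightarrow> (case r of Inl l \<Rightarrow> 0 | Inr l \<Rightarrow> cnj (c1 j k l \<delta> z))))"

lemma scaled_\<Lambda>: "with_cnj (scaled_vf d \<delta> L) s z = of_real (\<delta> powr dd s) *s \<Lambda> s z"
  by (cases s) (simp_all add: scaled_vf_def cnj_vf_eq)

lemma cnj_symmetric: "\<exists>j. e j = e i \<and> (\<forall>z. Z j z = cnj_tangent (Z i z))"
proof (cases i)
  case (Inl k)
  then show ?thesis by (intro exI[of _ "Inr k"]) (simp add: cnj_vf_eq)
next
  case (Inr k)
  then show ?thesis by (intro exI[of _ "Inl k"]) (simp add: cnj_vf_eq)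
qed

lemma bdd_c:
  assumes c: "c \<in> {c1, c2, c3}"
  shows "bdd r (\<lambda>\<delta>. iter_apply (with_cnj (scaled_vf d \<delta> L)) s (c j k l \<delta>))"
proof (induction r arbitrary: s)
  case 0
  let ?F = "\<lambda>\<delta>. iter_apply (with_cnj (scaled_vf d \<delta> L)) s (c j k l \<delta>)"
  let ?C = "SUP \<delta>\<in>{0<..1}. C_norm (W' \<delta>) (?F \<delta>)"
  show ?case
  proof (rule bdd_0I)
    show "?F \<delta> differentiable (at z)" if "\<delta> \<in> {0<..1}" "z \<in> U \<delta>" for \<delta> z
      by (rule differentiable_onD_open[OF c_diff[OF c that(1)]]) (use W'[OF that(1)] that(2) in \<open>auto simp: U_def\<close>)
    show "cmod (?F \<delta> p) \<le> enn2real ?C" if "\<delta> \<in> {0<..1}" for \<delta>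
    proof -
      have "ennreal (cmod (?F \<delta> p)) \<le> C_norm (W' \<delta>) (?F \<delta>)"
        unfolding C_norm_def by (rule SUP_upper) (use W'[OF that] in auto)
      also have "\<dots> \<le> ?C" by (rule SUP_upper[OF that])
      also have "\<dots> = ennreal (enn2real ?C)"
        using c_bound[OF c, of s j k l] by (intro ennreal_enn2real[symmetric]) simp
      finally show ?thesis by (simp add: ennreal_le_iff)
    qed
  qed
next
  case (Suc r)
  let ?F = "\<lambda>\<delta>. iter_apply (with_cnj (scaled_vf d \<delta> L)) s (c j k l \<delta>)"
  have "scaled_deriv i ?F = (\<lambda>\<delta>. iter_apply (with_cnj (scaled_vf d \<delta> L)) (T i # s) (c j k l \<delta>))" for i
    by (intro ext) (simp add: scaled_deriv_def iter_apply_def vf_apply_def scaled_\<Lambda> tangent_apply_scale_left Z_def e_def)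
  then have "bdd r (scaled_deriv i ?F)" for i using Suc.IH[of "T i # s"] by (simp only:)
  moreover have "bdd 0 ?F" using Suc.IH[of s] bdd_0 by blast
  ultimately show ?case by simp
qed

lemma bdd_C: "bdd r (C s t q)"
proof -
  have c: "bdd r (c j k l)" if "c \<in> {c1, c2, c3}" for c j k l
    using bdd_c[OF that, of r "[]"] by (simp add: iter_apply_def)
  have z: "bdd r (\<lambda>\<delta> z. 0)" by (rule bdd_const[of "\<lambda>_. 0" 0]) simp
  show ?thesis
    unfolding C_def[abs_def]
    by (cases s; cases t; cases q) (simp_all add: z c bdd_uminus bdd_cnj[OF cnj_symmetric])
qed

lemma bracket_C:
  assumes dz: "\<delta> \<in> {0<..1}" "z \<in> U \<delta>"
  shows "of_real (\<delta> powr dd s * \<delta> powr dd t) *s lie_bracket (\<Lambda> s) (\<Lambda> t) z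
    = (\<Sum>q\<in>UNIV. (C s t q \<delta> z * of_real (\<delta> powr dd q)) *s \<Lambda> q z)"
proof -
  have zU: "z \<in> U0" and zW: "z \<in> W' \<delta>" using dz by (auto simp: U_def)
  let ?V = "with_cnj (scaled_vf d \<delta> L)"
  have V: "?V s = (\<lambda>z. of_real (\<delta> powr dd s) *s \<Lambda> s z)" for s by (rule ext) (rule scaled_\<Lambda>)
  have dL: "(\<lambda>w. \<Lambda> s w $ i) differentiable (at z)" for s i by (rule smooth_differentiable[OF \<Lambda>_smooth zU])
  have dV: "(\<lambda>w. ?V s w $ i) differentiable (at z)" for s i
    unfolding V by (simp add: differentiable_mult dL)
  have sc: "scaled_vf d \<delta> (\<lambda>i. cnj_vf (L i)) k = ?V (Inr k)" for k
    by (rule ext) (simp add: scaled_vf_def cnj_vf_eq)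
  have scz: "scaled_vf d \<delta> (\<lambda>i. cnj_vf (L i)) k z = ?V (Inr k) z" for k z by (simp only: sc)
  have 23: "lie_bracket (?V (Inl j)) (?V (Inr k)) z = (\<Sum>q\<in>UNIV. C (Inl j) (Inr k) q \<delta> z *s ?V q z)" for j k
    using c23[OF dz(1) zW, of j k] unfolding sc by (simp add: sum_UNIV_sum C_def)
  have 1: "lie_bracket (?V (Inl j)) (?V (Inl k)) z = (\<Sum>q\<in>UNIV. C (Inl j) (Inl k) q \<delta> z *s ?V q z)" for j k
    using c1[OF dz(1) zW, of j k] by (simp add: sum_UNIV_sum C_def)
  have "lie_bracket (?V s) (?V t) z = (\<Sum>q\<in>UNIV. C s t q \<delta> z *s ?V q z)"
  proof (cases s)
    case (Inl j)
    then show ?thesis using 1 23 by (cases t) auto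
  next
    case s: (Inr j)
    show ?thesis
    proof (cases t)
      case t: (Inl k)
      have "lie_bracket (?V s) (?V t) z = - (\<Sum>q\<in>UNIV. C (Inl k) (Inr j) q \<delta> z *s ?V q z)"
        unfolding s t by (subst lie_bracket_antisym) (simp only: 23)
      also have "\<dots> = (\<Sum>q\<in>UNIV. C s t q \<delta> z *s ?V q z)"
        unfolding sum_negf[symmetric] s t by (rule sum.cong) (auto simp: C_def vec_eq_iff split: sum.splits)
      finally show ?thesis .
    next
      case t: (Inr k)
      have "lie_bracket (?V s) (?V t) z = cnj_tangent (lie_bracket (?V (Inl j)) (?V (Inl k)) z)"
        unfolding s t using lie_bracket_cnj[OF dV[of "Inl j"] dV[of "Inl k"]] by simp
      also have "\<dots> = (\<Sum>q\<in>UNIV. C s t q \<delta> z *s ?V q z)"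
        unfolding 1 s t by (simp add: cnj_tangent_sum sum_UNIV_sum C_def cnj_vf_eq)
      finally show ?thesis .
    qed
  qed
  moreover have "lie_bracket (?V s) (?V t) z = of_real (\<delta> powr dd s * \<delta> powr dd t) *s lie_bracket (\<Lambda> s) (\<Lambda> t) z"
    unfolding V using lie_bracket_scale[of "\<Lambda> s" z "\<Lambda> t"] dL by simp
  ultimately show ?thesis by (simp add: V)
qed

lemma bracket_coef:
  assumes dz: "\<delta> \<in> {0<..1}" "z \<in> U \<delta>"
  shows "of_real (\<delta> powr dd s * \<delta> powr dd t) * coef k z (lie_bracket (\<Lambda> s) (\<Lambda> t) z)
    = (\<Sum>q\<in>UNIV. C s t q \<delta> z * (of_real (\<delta> powr dd q) * \<alpha> q k z))"
  using arg_cong[OF bracket_C[OF dz, of s t], of "coef k z"]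
  by (simp add: coef_linear coef_sum \<alpha>_def mult.assoc)

text \<open>Expand \<open>\<Lambda> s\<close> in the frame and take the bracket with \<open>Z t\<close>. By \<open>bracket_coef\<close> the right-hand side is
  a polynomial in the bracket coefficients and in \<open>\<alpha>\<close> itself, so the system is closed.\<close>

lemma \<alpha>_derivative:
  assumes z: "z \<in> U0"
  shows "vf_apply (Z t) (\<alpha> s k) z = coef k z (lie_bracket (Z t) (\<Lambda> s) z)
     - (\<Sum>i\<in>UNIV. \<alpha> s i z * coef k z (lie_bracket (Z t) (Z i) z))"
proof -
  have "lie_bracket (Z t) (\<Lambda> s) z
      = (\<Sum>i\<in>UNIV. vf_apply (Z t) (\<alpha> s i) z *s Z i z) + (\<Sum>i\<in>UNIV. \<alpha> s i z *s lie_bracket (Z t) (Z i) z)"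
  proof -
    have "lie_bracket (Z t) (\<Lambda> s) z $ j = (\<Sum>i\<in>UNIV. vf_apply (Z t) (\<alpha> s i) z * Z i z $ j) + (\<Sum>i\<in>UNIV. \<alpha> s i z * lie_bracket (Z t) (Z i) z $ j)" for j
    proof -
      have "vf_apply (Z t) (\<lambda>w. \<Lambda> s w $ j) z = vf_apply (Z t) (\<lambda>w. \<Sum>i\<in>UNIV. \<alpha> s i w * Z i w $ j) z"
        by (rule vf_apply_cong_open[OF smooth_differentiable[OF \<Lambda>_smooth z] open_U0 z]) (simp add: \<Lambda>_expand)
      also have "\<dots> = (\<Sum>i\<in>UNIV. vf_apply (Z t) (\<alpha> s i) z * Z i z $ j + \<alpha> s i z * vf_apply (Z t) (\<lambda>w. Z i w $ j) z)"
        using smooth_differentiable[OF \<alpha>_smooth z] smooth_differentiable[OF Z_smooth z]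
        by (simp add: vf_apply_sum vf_apply_mult differentiable_mult)
      finally have 1: "vf_apply (Z t) (\<lambda>w. \<Lambda> s w $ j) z
         = (\<Sum>i\<in>UNIV. vf_apply (Z t) (\<alpha> s i) z * Z i z $ j + \<alpha> s i z * vf_apply (Z t) (\<lambda>w. Z i w $ j) z)" .
      have 2: "vf_apply (\<Lambda> s) (\<lambda>w. Z t w $ j) z = (\<Sum>i\<in>UNIV. \<alpha> s i z * vf_apply (Z i) (\<lambda>w. Z t w $ j) z)"
        unfolding vf_apply_def \<Lambda>_expand[OF z, of s] tangent_apply_sum_left tangent_apply_scale_left ..
      show ?thesis
        by (simp add: lie_bracket_def 1 2 sum.distrib sum_subtractf right_diff_distrib)
    qed
    then show ?thesis by (simp add: vec_eq_iff)
  qed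
  then have "coef k z (lie_bracket (Z t) (\<Lambda> s) z)
      = (\<Sum>i\<in>UNIV. vf_apply (Z t) (\<alpha> s i) z * coef k z (Z i z)) + (\<Sum>i\<in>UNIV. \<alpha> s i z * coef k z (lie_bracket (Z t) (Z i) z))"
    by (simp add: coef_linear coef_sum)
  then show ?thesis by (simp add: coef_Z[OF z] if_distrib[of "\<lambda>x. _ * x"] cong: if_cong)
qed

text \<open>By \<open>\<alpha>_derivative\<close>, a derivative of the scaled coefficients is a polynomial in the scaled
  coefficients and in \<open>C\<close>; hence bounds for \<open>r\<close> derivatives imply bounds for \<open>r + 1\<close>.\<close>

lemma bdd_\<alpha>: "bdd r (\<lambda>\<delta> z. of_real (\<delta> powr (dd s - e k)) * \<alpha> s k z)"
proof (induction r arbitrary: s k)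
  case 0
  show ?case
  proof (rule bdd_0I)
    show "(\<lambda>z. of_real (\<delta> powr (dd s - e k)) * \<alpha> s k z) differentiable (at z)" if "z \<in> U \<delta>" for \<delta> z
      using that by (intro differentiable_mult smooth_differentiable[OF \<alpha>_smooth]) (auto simp: U_def)
    show "cmod (of_real (\<delta> powr (dd s - e k)) * \<alpha> s k p) \<le> cmod (\<alpha> s k p)" if "\<delta> \<in> {0<..1}" for \<delta>
      using that \<alpha>_p[of s k] by (cases "dd s < e k") (auto simp: norm_mult intro!: mult_left_le_one_le powr_le1)
  qed
next
  case (Suc r)
  let ?a = "\<lambda>s k \<delta> z. of_real (\<delta> powr (dd s - e k)) * \<alpha> s k z"
  have "bdd r (scaled_deriv t (?a s k))" for t
  proof (rule bdd_cong)
    show "bdd r (\<lambda>\<delta> z. (\<Sum>q\<in>UNIV. C (T t) s q \<delta> z * ?a q k \<delta> z)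
        - (\<Sum>i\<in>UNIV. ?a s i \<delta> z * (\<Sum>q\<in>UNIV. C (T t) (T i) q \<delta> z * ?a q k \<delta> z)))"
      by (intro bdd_diff bdd_sum bdd_mult bdd_C Suc.IH)
    fix \<delta> z assume dz: "\<delta> \<in> {0<..1}" "z \<in> U \<delta>"
    have zU: "z \<in> U0" using dz by (simp add: U_def)
    have pw: "\<delta> powr (dd q - e k) = \<delta> powr dd q * \<delta> powr (- e k)" for q by (simp add: powr_add[symmetric])
    have S: "(\<Sum>q\<in>UNIV. C s' t' q \<delta> z * ?a q k \<delta> z) = of_real (\<delta> powr (- e k) * (\<delta> powr dd s' * \<delta> powr dd t')) * coef k z (lie_bracket (\<Lambda> s') (\<Lambda> t') z)" for s' t'
    proof -
      have "(\<Sum>q\<in>UNIV. C s' t' q \<delta> z * ?a q k \<delta> z) = of_real (\<delta> powr (- e k)) * (\<Sum>q\<in>UNIV. C s' t' q \<delta> z * (of_real (\<delta> powr dd q) * \<alpha> q k z))"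
        unfolding sum_distrib_left by (rule sum.cong) (simp_all add: pw algebra_simps)
      then show ?thesis unfolding bracket_coef[OF dz, symmetric] by simp
    qed
    have "scaled_deriv t (?a s k) \<delta> z = of_real (\<delta> powr e t * \<delta> powr (dd s - e k)) * vf_apply (Z t) (\<alpha> s k) z"
      by (simp add: scaled_deriv_def vf_apply_cmult[OF smooth_differentiable[OF \<alpha>_smooth zU]])
    also have "\<dots> = of_real (\<delta> powr (- e k) * (\<delta> powr dd (T t) * \<delta> powr dd s)) * coef k z (lie_bracket (\<Lambda> (T t)) (\<Lambda> s) z)
        - (\<Sum>i\<in>UNIV. of_real (\<delta> powr e t * \<delta> powr (dd s - e k)) * (\<alpha> s i z * coef k z (lie_bracket (\<Lambda> (T t)) (\<Lambda> (T i)) z)))"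
      unfolding \<alpha>_derivative[OF zU] right_diff_distrib sum_distrib_left by (simp add: Z_def e_def pw[unfolded e_def] algebra_simps)
    also have "(\<Sum>i\<in>UNIV. of_real (\<delta> powr e t * \<delta> powr (dd s - e k)) * (\<alpha> s i z * coef k z (lie_bracket (\<Lambda> (T t)) (\<Lambda> (T i)) z)))
        = (\<Sum>i\<in>UNIV. ?a s i \<delta> z * (of_real (\<delta> powr (- e k) * (\<delta> powr dd (T t) * \<delta> powr dd (T i))) * coef k z (lie_bracket (\<Lambda> (T t)) (\<Lambda> (T i)) z)))"
    proof (rule sum.cong[OF refl])
      fix i
      have "\<delta> powr e t * \<delta> powr (dd s - e k) = \<delta> powr (dd s - e i) * (\<delta> powr (- e k) * (\<delta> powr dd (T t) * \<delta> powr dd (T i)))"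
        by (simp add: e_def powr_add[symmetric] algebra_simps)
      then show "of_real (\<delta> powr e t * \<delta> powr (dd s - e k)) * (\<alpha> s i z * coef k z (lie_bracket (\<Lambda> (T t)) (\<Lambda> (T i)) z))
        = ?a s i \<delta> z * (of_real (\<delta> powr (- e k) * (\<delta> powr dd (T t) * \<delta> powr dd (T i))) * coef k z (lie_bracket (\<Lambda> (T t)) (\<Lambda> (T i)) z))"
        by (simp only: of_real_mult mult_ac)
    qed
    finally show "(\<Sum>q\<in>UNIV. C (T t) s q \<delta> z * ?a q k \<delta> z)
        - (\<Sum>i\<in>UNIV. ?a s i \<delta> z * (\<Sum>q\<in>UNIV. C (T t) (T i) q \<delta> z * ?a q k \<delta> z)) = scaled_deriv t (?a s k) \<delta> z"
      unfolding S by simp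
  qed
  moreover have "bdd 0 (?a s k)" using Suc.IH bdd_0 by blast
  ultimately show ?case by simp
qed

lemma \<alpha>_ord_ge: "ord_ge r (e k - dd s) (\<alpha> s k)"
  using bdd_\<alpha>[of r s k] by (simp add: ord_ge_def)

definition g :: "'n + 'n \<Rightarrow> 'n + 'n \<Rightarrow> 'n + 'n \<Rightarrow> complex ^ 'n \<Rightarrow> complex" where
  "g s t k z = coef k z (lie_bracket (Z s) (Z t) z)"

text \<open>The brackets of the frame are combinations of all fields with coefficients \<open>C\<close>; expanding these
  fields in the frame by \<open>\<alpha>\<close> shows that the scaled structure functions are bounded.\<close>

sublocale graded_frame U0 p Z e U g
proof unfold_locales
  show "smooth (g s t k)" for s t k
    unfolding g_def[abs_def] coef_def lie_bracket_def vec_lambda_beta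
    by (intro smooth_sum smooth_mult \<Gamma>_smooth smooth_diff smooth_Z Z_smooth)
  show "lie_bracket (Z s) (Z t) z = (\<Sum>k\<in>UNIV. g s t k z *s Z k z)" if "z \<in> U0" for z s t
    unfolding g_def by (rule frame_coef[OF that])
  show "ord_ge r (e k - e s - e t) (g s t k)" for r k s t
    unfolding ord_ge_def
  proof (rule bdd_cong)
    let ?a = "\<lambda>s k \<delta> z. of_real (\<delta> powr (dd s - e k)) * \<alpha> s k z"
    show "bdd r (\<lambda>\<delta> z. \<Sum>q\<in>UNIV. C (T s) (T t) q \<delta> z * ?a q k \<delta> z)"
      by (intro bdd_sum bdd_mult bdd_C bdd_\<alpha>)
    fix \<delta> z assume dz: "\<delta> \<in> {0<..1}" "z \<in> U \<delta>"
    have pw: "\<delta> powr (dd q - e k) = \<delta> powr dd q * \<delta> powr (- e k)" for q by (simp add: powr_add[symmetric])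
    have "(\<Sum>q\<in>UNIV. C (T s) (T t) q \<delta> z * ?a q k \<delta> z)
        = of_real (\<delta> powr (- e k)) * (\<Sum>q\<in>UNIV. C (T s) (T t) q \<delta> z * (of_real (\<delta> powr dd q) * \<alpha> q k z))"
      unfolding sum_distrib_left by (rule sum.cong) (simp_all add: pw algebra_simps)
    also have "\<dots> = of_real (\<delta> powr (- e k) * (\<delta> powr dd (T s) * \<delta> powr dd (T t))) * g s t k z"
      unfolding bracket_coef[OF dz, symmetric] by (simp add: g_def Z_def)
    also have "\<delta> powr (- e k) * (\<delta> powr dd (T s) * \<delta> powr dd (T t)) = \<delta> powr (- (e k - e s - e t))"
      by (simp add: e_def powr_add[symmetric] algebra_simps)
    finally show "(\<Sum>q\<in>UNIV. C (T s) (T t) q \<delta> z * ?a q k \<delta> z) = of_real (\<delta> powr (- (e k - e s - e t))) * g s t k z" .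
  qed
qed

end

section \<open>Holomorphic coordinates of the right orders\<close>

context scaled_fields begin

definition hol :: "(complex ^ 'n \<Rightarrow> complex) \<Rightarrow> bool" where
  "hol f \<longleftrightarrow> smooth f \<and> (\<forall>z\<in>U0. \<forall>X. (\<forall>k. X $ Inl k = 0) \<longrightarrow> tangent_apply X f z = 0)"

lemma hol_const: "hol (\<lambda>_. c)"
  by (simp add: hol_def)

lemma hol_add: "hol f \<Longrightarrow> hol h \<Longrightarrow> hol (\<lambda>z. f z + h z)"
  by (simp add: hol_def smooth_add tangent_apply_add smooth_differentiable)

lemma hol_mult: "hol f \<Longrightarrow> hol h \<Longrightarrow> hol (\<lambda>z. f z * h z)"
  by (simp add: hol_def smooth_mult tangent_apply_mult smooth_differentiable)

lemma hol_coordinate: "hol (\<lambda>z. z $ k)"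
  by (simp add: hol_def smooth_coordinate tangent_apply_coordinate)

lemma hol_sum: "(\<And>i. i \<in> S \<Longrightarrow> hol (f i)) \<Longrightarrow> hol (\<lambda>z. \<Sum>i\<in>S. f i z)"
  by (induction S rule: infinite_finite_induct) (simp_all add: hol_const hol_add)

text \<open>The linear functions dual to the conjugate frame at \<open>p\<close> are corrected by \<open>exists_graded\<close>. The letters
  outside the range of \<open>Inr\<close> are the antiholomorphic fields, which annihilate every function in \<open>hol\<close>.\<close>

lemma exists_holomorphic_coordinates:
  obtains w where "\<And>k. hol (w k)" "\<And>k. w k p = 0"
    "\<And>i s. vf_apply (Z i) (conj_pair w s) p = (if i = s then 1 else 0)"
    "\<And>r s. ord_ge r (e s) (conj_pair w s)"
proof -
  define u :: "'n \<Rightarrow> complex ^ 'n \<Rightarrow> complex" where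
    "u = (\<lambda>k z. \<Sum>q\<in>UNIV. \<Gamma> (Inl q) (Inr k) p * (z $ q + (- (p $ q))))"
  have u_hol: "hol (u k)" for k
    unfolding u_def by (intro hol_sum hol_mult hol_add hol_const hol_coordinate)
  have smooth_hol: "smooth f" if "hol f" for f using that by (simp add: hol_def)
  have u_p: "u k p = 0" for k by (simp add: u_def)
  have dq: "(\<lambda>z. z $ q + (- (p $ q))) differentiable (at z)" for q z
    by (intro differentiable_add differentiable_const bounded_linear_imp_differentiable bounded_linear_vec_nth)
  have Z_u: "vf_apply (Z a) (u k) p = (if a = Inr k then 1 else 0)" for a k
  proof -
    have "tangent_apply X (\<lambda>z. z $ q + (- (p $ q))) z = X $ Inl q" for X q z
      by (subst tangent_apply_add) (auto simp: tangent_apply_coordinate bounded_linear_imp_differentiable bounded_linear_vec_nth)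
    then have "vf_apply (Z a) (u k) p = (\<Sum>q\<in>UNIV. \<Gamma> (Inl q) (Inr k) p * Z a p $ Inl q)"
      using dq unfolding u_def vf_apply_def by (simp add: tangent_apply_sum tangent_apply_cmult differentiable_mult)
    also have "\<dots> = (\<Sum>i\<in>UNIV. Z a p $ i * \<Gamma> i (Inr k) p)"
      by (simp add: sum_UNIV_sum \<Gamma>_def mult.commute)
    also have "\<dots> = (if a = Inr k then 1 else 0)" by (rule Z_\<Gamma>[OF p_in_U0])
    finally show ?thesis .
  qed
  have Z_hol: "vf_apply (Z a) f z = 0" if f: "hol f" and a: "a \<notin> range Inr" and z: "z \<in> U0" for f a z
  proof -
    obtain i where "a = Inl i" using a by (cases a) auto
    then show ?thesis using f z by (simp add: hol_def vf_apply_def L_Inl U0_W)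
  qed
  have "\<exists>f. hol f \<and> f p = 0 \<and> (\<forall>a. vf_apply (Z a) f p = (if a = Inr k then 1 else 0)) \<and> (\<forall>r. ord_ge r (e (Inr k)) f)" for k
  proof -
    show ?thesis
    proof (rule exists_graded[where u = u and \<beta> = Inr and H = hol and i = k])
      show "inj (Inr :: 'n \<Rightarrow> 'n + 'n)" by simp
      show "\<exists>f. hol f \<and> f p = 0 \<and> (\<forall>a. vf_apply (Z a) f p = (if a = Inr k then 1 else 0)) \<and> (\<forall>r. ord_ge r (e (Inr k)) f)"
        if "hol f" "f p = 0" "\<And>a. vf_apply (Z a) f p = (if a = Inr k then 1 else 0)" "\<And>r. ord_ge r (e (Inr k)) f" for f
        using that by blast
    qed (fact smooth_hol[OF u_hol] u_p Z_u u_hol hol_const hol_mult hol_add smooth_hol Z_hol)+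
  qed
  then obtain w where w: "\<And>k. hol (w k)" "\<And>k. w k p = 0"
    "\<And>k a. vf_apply (Z a) (w k) p = (if a = Inr k then 1 else 0)" "\<And>k r. ord_ge r (e (Inr k)) (w k)" by metis
  have "vf_apply (Z i) (conj_pair w s) p = (if i = s then 1 else 0)" for i s
  proof (cases s)
    case (Inl k)
    have "vf_apply (Z i) (\<lambda>z. cnj (w k z)) p = cnj (vf_apply (Z (case i of Inl k \<Rightarrow> Inr k | Inr k \<Rightarrow> Inl k)) (w k) p)"
      unfolding vf_apply_cnj[OF smooth_differentiable[OF smooth_hol[OF w(1)] p_in_U0]]
      by (cases i) (simp_all add: vf_apply_def cnj_vf_eq)
    then show ?thesis by (cases i) (simp_all add: Inl w(3) del: Z_simps)
  next
    case (Inr k)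
    then show ?thesis by (simp add: w(3) del: Z_simps)
  qed
  moreover have "ord_ge r (e s) (conj_pair w s)" for r s
  proof (cases s)
    case (Inl k)
    then show ?thesis using ord_ge_cnj[OF cnj_symmetric w(4)[of r k]] by simp
  next
    case (Inr k)
    then show ?thesis using w(4)[of r k] by simp
  qed
  ultimately show ?thesis using that w(1,2) by blast
qed

text \<open>The coefficient of \<open>Z i\<close> in \<open>\<Lambda> s\<close> has order \<open>e i - dd s\<close>, which makes up for the difference between the
  weights of the two fields.\<close>

lemma ord_ge_field:
  assumes "smooth f" "\<And>r. ord_ge r t f"
  shows "ord_ge r (t - dd s) (vf_apply (\<Lambda> s) f)"
proof (rule ord_ge_cong)
  have "ord_ge r ((e i - dd s) + (t - e i)) (\<lambda>z. \<alpha> s i z * vf_apply (Z i) f z)" for i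
    by (intro ord_ge_mult \<alpha>_ord_ge ord_ge_Z assms)
  then show "ord_ge r (t - dd s) (\<lambda>z. \<Sum>i\<in>UNIV. \<alpha> s i z * vf_apply (Z i) f z)"
    by (intro ord_ge_sum) simp
  show "(\<Sum>i\<in>UNIV. \<alpha> s i z * vf_apply (Z i) f z) = vf_apply (\<Lambda> s) f z" if "z \<in> U0" for z
    unfolding vf_apply_def[of "\<Lambda> s"] \<Lambda>_expand[OF that, of s] tangent_apply_sum_left tangent_apply_scale_left
    by (simp add: vf_apply_def)
qed

text \<open>The neighbourhood is shrunk twice, to make the coordinate derivatives available and to keep the
  determinant of the frame in the coordinates \<open>w\<close>, which is \<open>1\<close> at \<open>p\<close>, above \<open>1 / 2\<close>.\<close>

lemma exists_uniform_charts:
  "\<exists>(\<Phi> :: real \<Rightarrow> complex ^ 'n \<Rightarrow> complex ^ 'n) (W\<Phi> :: real \<Rightarrow> (complex ^ 'n) set).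
     (\<forall>\<delta>\<in>{0<..1}. open (W\<Phi> \<delta>) \<and> p \<in> W\<Phi> \<delta> \<and> W\<Phi> \<delta> \<subseteq> W \<and>
        biholomorphism (\<Phi> \<delta>) (ball 0 1) (W\<Phi> \<delta>) \<and> \<Phi> \<delta> 0 = p) \<and>
     (\<forall>k. (MAX j\<in>UNIV. SUP \<delta>\<in>{0<..1}.
        Ck_norm k (ball 0 1) (\<lambda>z. zbar_coeffs (pullback (\<Phi> \<delta>) (scaled_vf d \<delta> L j) z))) < \<infinity>) \<and>
     (INF \<delta>\<in>{0<..1}. MAX J\<in>(UNIV :: ('n \<Rightarrow> 'm) set). INF z\<in>ball 0 1.
        cmod (det (\<chi> r q. zbar_coeffs (pullback (\<Phi> \<delta>) (scaled_vf d \<delta> L (J q)) z) $ r))) > 0"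
proof -
  obtain w where w: "\<And>k. hol (w k)" "\<And>k. w k p = 0"
    "\<And>i s. vf_apply (Z i) (conj_pair w s) p = (if i = s then 1 else 0)"
    "\<And>r s. ord_ge r (e s) (conj_pair w s)"
    using exists_holomorphic_coordinates by blast
  have w_smooth: "smooth (w k)" for k using w(1)[of k] by (simp add: hol_def)
  have what_smooth: "smooth (conj_pair w s)" for s by (cases s) (simp_all add: w_smooth smooth_cnj)
  define M :: "complex ^ 'n \<Rightarrow> complex ^ ('n + 'n) ^ ('n + 'n)" where
    "M = (\<lambda>z. \<chi> i j. vf_apply (Z i) (conj_pair w j) z)"
  define N where "N = (\<lambda>k l z. matrix_inv (M z) $ k $ l)"
  define U1 where "U1 = {z \<in> U0. det (M z) \<noteq> 0}"
  define UU where "UU = (\<lambda>\<delta>. U \<delta> \<inter> U1)"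
  have open_U1: "open U1"
    unfolding U1_def using smooth_differentiable[OF smooth_Z[OF what_smooth]]
    by (intro open_det_nonzero open_U0) (simp add: M_def)
  have "M p = mat 1" by (simp add: M_def w(3) mat_def)
  then have p_U1: "p \<in> U1" by (simp add: U1_def p_in_U0)
  have U1_U0: "z \<in> U0" if "z \<in> U1" for z using that by (simp add: U1_def)
  interpret smc: smooth_calculus U1 p by unfold_locales (fact open_U1 p_U1)+
  have smoothI: "smc.smooth f" if "smooth f" for f
    using that unfolding smooth_def smc.smooth_def
    by (auto intro: bdd_subset[OF crd.bounded_calculus_axioms smc.crd.bounded_calculus_axioms] U1_U0)
  interpret wc: weighted_calculus U1 p Z e UU
  proof unfold_locales
    show "open (UU \<delta>)" "p \<in> UU \<delta>" if "\<delta> \<in> {0<..1}" for \<delta>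
      using open_U[OF that] p_in_U[OF that] open_U1 p_U1 by (auto simp: UU_def)
    show "UU \<delta> \<subseteq> U1" for \<delta> by (auto simp: UU_def)
    show "1 \<le> e s" for s by (rule e_ge_1)
    show "smc.smooth (\<lambda>z. Z s z $ i)" for s i by (rule smoothI[OF Z_smooth])
  qed
  have ord_geI: "wc.ord_ge r s f" if "ord_ge r s f" for r s f
    using that unfolding ord_ge_def wc.ord_ge_def
    by (rule bdd_subset[OF bounded_calculus_axioms wc.bounded_calculus_axioms, rotated]) (auto simp: UU_def)
  interpret gc: graded_coordinates U1 p Z e UU w \<Gamma> N
  proof unfold_locales
    show "(\<Sum>s\<in>UNIV. \<Gamma> i s z * Z s z $ j) = (if i = j then 1 else 0)" if "z \<in> U1" for z i j
      by (rule \<Gamma>_Z[OF U1_U0[OF that]])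
    show "e (Inr k) = e (Inl k)" for k by simp
    show "smc.smooth (w k)" for k by (rule smoothI[OF w_smooth])
    show "w k p = 0" for k by (rule w(2))
    show "tangent_apply X (w k) z = 0" if "z \<in> U1" "\<And>k. X $ Inl k = 0" for z k X
      using w(1)[of k] that U1_U0 by (simp add: hol_def)
    show "vf_apply (Z i) (conj_pair w s) p = (if i = s then 1 else 0)" for i s by (rule w(3))
    show "(\<Sum>j\<in>UNIV. vf_apply (Z i) (conj_pair w j) z * N j l z) = (if i = l then 1 else 0)" if "z \<in> U1" for z i l
    proof -
      have "M z ** matrix_inv (M z) = mat 1" using that by (intro matrix_inv_right_inverse) (simp add: U1_def)
      then show ?thesis by (simp add: matrix_matrix_mult_def vec_eq_iff mat_def M_def N_def)
    qed
    show "wc.ord_ge r (e s) (conj_pair w s)" for r s by (rule ord_geI[OF w(4)])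
  qed
  obtain U' V g where UVg: "open U'" "U' \<subseteq> U1" "p \<in> U'" "open V" "0 \<in> V" "homeomorphism U' V gc.wmap g"
    "\<And>y. y \<in> V \<Longrightarrow> \<exists>A. (g has_derivative (*v) A) (at y)"
    by (rule gc.local_inverse) blast
  let ?m = "\<lambda>z. \<chi> r q. vf_apply (Z (Inl q)) (conj_pair w (Inl r)) z"
  have "gc.wmap p = 0" by (simp add: gc.wmap_def w(2) zero_vec_def)
  then have g0: "g 0 = p" using UVg(3,6) unfolding homeomorphism_def by metis
  have "(\<lambda>z. det (?m z)) differentiable (at p)"
    by (rule differentiable_det) (simp only: vec_lambda_beta smooth_differentiable[OF smooth_Z[OF what_smooth] p_in_U0])
  then have "isCont (\<lambda>z. det (?m z)) (g 0)" unfolding g0 by (rule differentiable_imp_continuous_within)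
  moreover have "isCont g 0" using UVg(7)[OF UVg(5)] has_derivative_continuous by blast
  ultimately have "isCont (\<lambda>y. det (?m (g y))) 0" by (rule isCont_o2[rotated])
  then have lim: "((\<lambda>y. cmod (det (?m (g y)))) \<longlongrightarrow> cmod (det (?m (g 0)))) (at 0)"
    unfolding isCont_def by (rule tendsto_norm)
  have "?m p = mat 1" by (simp add: w(3) mat_def vec_eq_iff del: conj_pair_simps Z_simps)
  then have m_0: "cmod (det (?m (g 0))) = 1" by (simp only: g0 det_I norm_one)
  have "\<forall>\<^sub>F y in at 0. cmod (det (?m (g y))) > 1 / 2"
    by (rule order_tendstoD(1)[OF lim]) (use m_0 in linarith)
  then obtain e1 where e1: "e1 > 0" "\<And>y. y \<noteq> 0 \<Longrightarrow> dist y 0 < e1 \<Longrightarrow> cmod (det (?m (g y))) > 1 / 2"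
    unfolding eventually_at by blast
  obtain e2 where e2: "e2 > 0" "cball 0 e2 \<subseteq> V" using UVg(4,5) open_contains_cball by blast
  \<comment> \<open>half of \<open>e1\<close>, because the estimate is needed on a closed ball\<close>
  define \<epsilon> where "\<epsilon> = min (e1 / 2) e2"
  have m_ge: "cmod (det (?m (g y))) \<ge> 1 / 2" if "y \<in> cball 0 \<epsilon>" for y
  proof (cases "y = 0")
    case True
    show ?thesis unfolding True using m_0 by linarith
  next
    case False
    then show ?thesis using e1(2)[of y] that e1(1) by (simp add: \<epsilon>_def)
  qed
  interpret sc: scaled_chart U1 p Z e UU w \<Gamma> N \<epsilon> g U' V
  proof unfold_locales
    show "0 < \<epsilon>" using e1(1) e2(1) by (simp add: \<epsilon>_def)
    show "cball 0 \<epsilon> \<subseteq> V" using e2(2) by (auto simp: \<epsilon>_def)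
  qed (fact UVg m_ge)+
  have field_smooth: "smc.smooth (vf_apply (L j) (\<lambda>z. cnj (w k z)))" for j k
    by (rule smoothI[OF smooth_vf_apply[OF L_smooth smooth_cnj[OF w_smooth]]])
  have field_ord_ge: "wc.ord_ge r (e (Inl k) - d j) (vf_apply (L j) (\<lambda>z. cnj (w k z)))" for r k j
    using ord_geI[OF ord_ge_field[of "conj_pair w (Inl k)" "e (Inl k)" r "Inl j", OF what_smooth w(4)]] by simp
  show ?thesis
  proof (intro exI[of _ sc.\<Phi>] exI[of _ "\<lambda>\<delta>. sc.\<Phi> \<delta> ` ball 0 1"] conjI ballI allI)
    fix \<delta> :: real assume d: "\<delta> \<in> {0<..1}"
    show "open (sc.\<Phi> \<delta> ` ball 0 1)" using sc.\<Phi>_biholomorphism(1)[OF d] by (simp add: biholomorphism_def)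
    show "p \<in> sc.\<Phi> \<delta> ` ball 0 1" by (rule sc.\<Phi>_biholomorphism(2)[OF d])
    show "sc.\<Phi> \<delta> ` ball 0 1 \<subseteq> W" using sc.\<Phi>_biholomorphism(3)[OF d] U1_U0 U0_W by blast
    show "biholomorphism (sc.\<Phi> \<delta>) (ball 0 1) (sc.\<Phi> \<delta> ` ball 0 1)" by (rule sc.\<Phi>_biholomorphism(1)[OF d])
    show "sc.\<Phi> \<delta> 0 = p" by (rule sc.\<Phi>_0)
  next
    fix k
    have "(SUP \<delta>\<in>{0<..1}. Ck_norm k (ball 0 1) (\<lambda>z. zbar_coeffs (pullback (sc.\<Phi> \<delta>) (scaled_vf d \<delta> L j) z))) < \<infinity>" for j
      by (rule sc.pullback_Ck_norm[where Y = "L j" and s = "d j" and Y\<delta> = "\<lambda>\<delta>. scaled_vf d \<delta> L j"])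
        (fact field_smooth field_ord_ge scaled_vf_def)+
    then show "(MAX j\<in>UNIV. SUP \<delta>\<in>{0<..1}.
        Ck_norm k (ball 0 1) (\<lambda>z. zbar_coeffs (pullback (sc.\<Phi> \<delta>) (scaled_vf d \<delta> L j) z))) < \<infinity>"
      by (subst Max_less_iff) auto
  next
    let ?D = "\<lambda>\<delta> (J :: 'n \<Rightarrow> 'm) z. cmod (det (\<chi> r q. zbar_coeffs (pullback (sc.\<Phi> \<delta>) (scaled_vf d \<delta> L (J q)) z) $ r))"
    have pos: "(1 / \<epsilon>) ^ CARD('n) / 2 > 0" using sc.eps by simp
    have le_J: "(1 / \<epsilon>) ^ CARD('n) / 2 \<le> (INF z\<in>ball 0 1. ?D \<delta> J z)" if "\<delta> \<in> {0<..1}" for \<delta>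
    proof (rule cINF_greatest)
      show "(1 / \<epsilon>) ^ CARD('n) / 2 \<le> ?D \<delta> J z" if "z \<in> ball 0 1" for z
        by (rule sc.pullback_det[OF \<open>\<delta> \<in> {0<..1}\<close> that]) (simp add: scaled_vf_def)
    qed simp
    have le_Max: "(INF z\<in>ball 0 1. ?D \<delta> J z) \<le> (MAX J\<in>UNIV. INF z\<in>ball 0 1. ?D \<delta> J z)" for \<delta>
      by (rule Max_ge) auto
    have "(1 / \<epsilon>) ^ CARD('n) / 2 \<le> (INF \<delta>\<in>{0<..1}. MAX J\<in>UNIV. INF z\<in>ball 0 1. ?D \<delta> J z)"
    proof (rule cINF_greatest)
      show "(1 / \<epsilon>) ^ CARD('n) / 2 \<le> (MAX J\<in>UNIV. INF z\<in>ball 0 1. ?D \<delta> J z)" if "\<delta> \<in> {0<..1}" for \<delta>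
        by (rule order_trans[OF le_J[OF that] le_Max])
    qed simp
    then show "0 < (INF \<delta>\<in>{0<..1}. MAX J\<in>UNIV. INF z\<in>ball 0 1. ?D \<delta> J z)" using pos by linarith
  qed
qed

end

theorem corollary1p5:
  fixes W :: "(complex ^ 'n::finite) set"
    and \<zeta>0 :: "complex ^ 'n"
    and b :: "'m::finite \<Rightarrow> 'n \<Rightarrow> complex ^ 'n \<Rightarrow> complex"
    and L :: "'m \<Rightarrow> 'n cvf"
    and d :: "'m \<Rightarrow> real"
    and \<xi> :: real
    and W' :: "real \<Rightarrow> (complex ^ 'n) set"
    and c1 c2 c3 :: "'m \<Rightarrow> 'm \<Rightarrow> 'm \<Rightarrow> real \<Rightarrow> complex ^ 'n \<Rightarrow> complex"
  assumes "open W" and "\<zeta>0 \<in> W"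
    and "\<And>j k. smooth_on W (b j k)"
    and "\<And>j \<zeta>. \<zeta> \<in> W \<Longrightarrow> L j \<zeta> = (\<Sum>k\<in>UNIV. b j k \<zeta> *s dzbar k)"
    and "\<And>\<zeta>. \<zeta> \<in> W \<Longrightarrow> vec.span (range (\<lambda>j. L j \<zeta>)) = vec.span (range dzbar)"
    and "\<And>j. d j \<ge> 1"
    and "\<xi> > 0"
    and "\<And>\<delta>. \<delta> \<in> {0<..1} \<Longrightarrow> open (W' \<delta>) \<and> \<zeta>0 \<in> W' \<delta> \<and> W' \<delta> \<subseteq> W"
    and "\<And>\<delta>. \<delta> \<in> {0<..1} \<Longrightarrow> cc_ball W (scaled_vf d \<delta> L) \<zeta>0 \<xi> \<subseteq> W' \<delta>"
    and "\<And>\<delta> j k \<zeta>. \<delta> \<in> {0<..1} \<Longrightarrow> \<zeta> \<in> W' \<delta> \<Longrightarrow>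
           lie_bracket (scaled_vf d \<delta> L j) (scaled_vf d \<delta> L k) \<zeta>
             = (\<Sum>l\<in>UNIV. c1 j k l \<delta> \<zeta> *s scaled_vf d \<delta> L l \<zeta>)"
    and "\<And>\<delta> j k \<zeta>. \<delta> \<in> {0<..1} \<Longrightarrow> \<zeta> \<in> W' \<delta> \<Longrightarrow>
           lie_bracket (scaled_vf d \<delta> L j) (scaled_vf d \<delta> (\<lambda>i. cnj_vf (L i)) k) \<zeta>
             = (\<Sum>l\<in>UNIV. c2 j k l \<delta> \<zeta> *s scaled_vf d \<delta> L l \<zeta>)
             + (\<Sum>l\<in>UNIV. c3 j k l \<delta> \<zeta> *s scaled_vf d \<delta> (\<lambda>i. cnj_vf (L i)) l \<zeta>)"
      \<comment> \<open>all iterated derivatives of the coefficients along the fields exist \<dots>\<close>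
    and "\<And>c j k l \<delta> s. c \<in> {c1, c2, c3} \<Longrightarrow> \<delta> \<in> {0<..1} \<Longrightarrow>
           iter_apply (with_cnj (scaled_vf d \<delta> L)) s (c j k l \<delta>) differentiable_on W' \<delta>"
      \<comment> \<open>\<dots> and are bounded uniformly in \<open>\<delta>\<close>\<close>
    and "\<And>c j k l s. c \<in> {c1, c2, c3} \<Longrightarrow>
           (SUP \<delta>\<in>{0<..1}.
              C_norm (W' \<delta>) (iter_apply (with_cnj (scaled_vf d \<delta> L)) s (c j k l \<delta>))) < \<infinity>"
  shows "\<exists>(\<Phi> :: real \<Rightarrow> complex ^ 'n \<Rightarrow> complex ^ 'n) (W\<Phi> :: real \<Rightarrow> (complex ^ 'n) set).
     (\<forall>\<delta>\<in>{0<..1}. open (W\<Phi> \<delta>) \<and> \<zeta>0 \<in> W\<Phi> \<delta> \<and> W\<Phi> \<delta> \<subseteq> W \<and>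
        biholomorphism (\<Phi> \<delta>) (ball 0 1) (W\<Phi> \<delta>) \<and> \<Phi> \<delta> 0 = \<zeta>0) \<and>
     (\<forall>k. (MAX j\<in>UNIV. SUP \<delta>\<in>{0<..1}.
        Ck_norm k (ball 0 1) (\<lambda>z. zbar_coeffs (pullback (\<Phi> \<delta>) (scaled_vf d \<delta> L j) z))) < \<infinity>) \<and>
     (INF \<delta>\<in>{0<..1}. MAX J\<in>(UNIV :: ('n \<Rightarrow> 'm) set). INF z\<in>ball 0 1.
        cmod (det (\<chi> r q. zbar_coeffs (pullback (\<Phi> \<delta>) (scaled_vf d \<delta> L (J q)) z) $ r))) > 0"
proof -
  define l where "l = (\<lambda>j. zbar_coeffs (L j \<zeta>0))"
  have zb: "zbar_coeffs (X + Y) = zbar_coeffs X + zbar_coeffs Y" "zbar_coeffs (r *s X) = r *s zbar_coeffs X" "zbar_coeffs 0 = 0"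
    for X Y :: "complex ^ ('n + 'n)" and r
    by (simp_all add: zbar_coeffs_def vec_eq_iff)
  have zb_sum: "zbar_coeffs (\<Sum>i\<in>S. X i) = (\<Sum>i\<in>S. zbar_coeffs (X i))" for S and X :: "'i \<Rightarrow> complex ^ ('n + 'n)"
    by (induction S rule: infinite_finite_induct) (simp_all add: zb)
  have dz: "(\<Sum>k\<in>UNIV. c k *s dzbar k) $ Inl q = 0" "(\<Sum>k\<in>UNIV. c k *s dzbar k) $ Inr q = c q" for c :: "'n \<Rightarrow> complex" and q
    by (simp_all add: dzbar_def axis_nth_if if_distrib[of "\<lambda>x. _ * x"] cong: if_cong)
  have "vec.span (range l) = UNIV"
  proof (intro equalityI subsetI UNIV_I)
    fix v :: "complex ^ 'n"
    have "vec.subspace {X. zbar_coeffs X \<in> vec.span (range l)}"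
      by (rule vec.subspaceI) (simp_all add: zb vec.span_zero vec.span_add vec.span_scale)
    moreover have "range (\<lambda>j. L j \<zeta>0) \<subseteq> {X. zbar_coeffs X \<in> vec.span (range l)}"
      by (auto simp: l_def intro: vec.span_base)
    ultimately have "vec.span (range (\<lambda>j. L j \<zeta>0)) \<subseteq> {X. zbar_coeffs X \<in> vec.span (range l)}"
      by (rule vec.span_minimal[rotated])
    moreover have "(\<Sum>k\<in>UNIV. v $ k *s dzbar k) \<in> vec.span (range dzbar)"
      by (intro vec.span_sum vec.span_scale vec.span_base) auto
    ultimately have "zbar_coeffs (\<Sum>k\<in>UNIV. v $ k *s dzbar k) \<in> vec.span (range l)"
      using assms(5)[OF assms(2)] by blast
    moreover have "zbar_coeffs (\<Sum>k\<in>UNIV. v $ k *s dzbar k) = v"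
      unfolding zbar_coeffs_def dz by simp
    ultimately show "v \<in> vec.span (range l)" by simp
  qed
  then obtain J :: "'n \<Rightarrow> 'm" where J: "det (\<chi> i k. l (J i) $ k) \<noteq> 0"
    "\<And>x q i. l q = (\<Sum>i\<in>UNIV. x $ i *s l (J i)) \<Longrightarrow> d q < d (J i) \<Longrightarrow> x $ i = 0"
    by (rule exists_minimal_frame[where d = d]) blast
  interpret scaled_fields W \<zeta>0 L d W' c1 c2 c3 b J
  proof unfold_locales
    show "L j z $ Inl k = 0" "L j z $ Inr k = b j k z" if "z \<in> W" for z j k
      unfolding assms(4)[OF that] by (fact dz)+
    show "det (\<chi> i k. L (J i) \<zeta>0 $ Inr k) \<noteq> 0"
      using J(1) by (simp add: l_def zbar_coeffs_def)
    show "x $ i = 0" if "L q \<zeta>0 = (\<Sum>i\<in>UNIV. x $ i *s L (J i) \<zeta>0)" "d q < d (J i)" for q x i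
    proof (rule J(2)[OF _ that(2)])
      show "l q = (\<Sum>i\<in>UNIV. x $ i *s l (J i))"
        unfolding l_def that(1) by (simp add: zb_sum zb)
    qed
    show "open (W' \<delta>) \<and> \<zeta>0 \<in> W' \<delta>" if "\<delta> \<in> {0<..1}" for \<delta> using assms(8)[OF that] by blast
  qed (fact assms)+
  show ?thesis by (rule exists_uniform_charts)
qed

end
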